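(* Let $\lambda>0$, $P>0$, $N_0>0$, $r_0>0$, $\eta>2$, and let $\mathbf S$ be the unit-power square $M$-QAM constellation. Consider the downlink of a single-tier cellular network modeled via a Poisson point process of intensity $\lambda$, with Rayleigh fading, universal frequency reuse, nearest-base-station association and no intra-cell interference, in which the useful symbol is $M$-QAM modulated and the interfering symbols are Gaussian, as described in the context. Then the average symbol error probability $\bar{\mathcal S}(r_0)$ of a user located at distance $r_0$ from its serving base station is $$\bar{\mathcal{S}}(r_0)=\sum_{c=1}^2 w_c\left(1-\frac{c}{\sqrt{\pi}}\int_0^{\infty}\frac{\operatorname{erfc}\left(\sqrt{z}\,\mathbf 1_{\{c=2\}}\right)}{\sqrt{z}}\exp\left\{-z\left(1+\frac{N_0r_0^\eta}{P\beta_c}\right)-\frac{2\pi\lambda z r_0^{2}}{\beta_c(\eta-2)}\,{}_2F_1\left(1,1-\frac2\eta;2-\frac2\eta;-\frac{z}{\beta_c}\right)\right\}\mathrm dz\right),$$ and in the case $\eta=4$ this equals $$\sum_{c=1}^2 w_c\left(1-\frac{c}{\sqrt{\pi}}\int_0^{\infty}\frac{\operatorname{erfc}\left(\sqrt{z}\,\mathbf 1_{\{c=2\}}\right)}{\sqrt{z}}\exp\left\{-z\left(1+\frac{N_0r_0^4}{P\beta_c}\right)-\pi\lambda r_0^{2}\sqrt{\frac{z}{\beta_c}}\arctan\left(\sqrt{\frac{z}{\beta_c}}\right)\right\}\mathrm dz\right),$$ where $$w_1=2\,\frac{\sqrt M-1}{\sqrt M},\qquad w_2=-\left(\frac{\sqrt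 M-1}{\sqrt M}\right)^2,\qquad \beta_1=\beta_2=\frac{3}{2(M-1)}.$$
   Context: Constellation. $M\ge 4$ is a perfect square. The square $M$-QAM constellation with unit average power is the set $\mathbf S$ of the $M$ points $\sqrt{\tfrac{3}{2(M-1)}}\,\big((2a-\sqrt M-1)+\jmath(2b-\sqrt M-1)\big)$, $a,b\in\{1,\dots,\sqrt M\}$. Network and received signal. All base stations (BSs) form a homogeneous Poisson point process in $\mathbb R^2$ of intensity $\lambda$. All BSs transmit with power $P$ on the same channel. The test user is at the origin and is served by its nearest BS, at distance $r_0$. Everything is conditioned on $r_0$, so the interfering BSs form a homogeneous Poisson point process of intensity $\lambda$ on $\{x\in\mathbb R^2:\|x\|>r_0\}$. Let $\{r_k\}_{k\ge1}$ be the distances of the interfering BSs to the origin. The received baseband signal is $$y_0=\sqrt P\,s_0h_0r_0^{-\eta/2}+\sum_{k\ge1}\sqrt P\,\tilde s_kh_kr_k^{-\eta/2}+n ,$$ where the useful symbol $s_0$ is uniform on $\mathbf S$, the interfering symbols $\tilde s_k$ are i.i.d. $\mathcal{CN}(0,1)$ (circularly symmetric complex Gaussian with mean $0$ and variance $1$), the fading coefficients $h_0,h_k$ are i.i.d. $\mathcal{CN}(0,1)$ (Rayleigh fading), $n\sim\mathcal{CN}(0,N_0)$, and all of these variables and the point process are mutually independent. Average symbol error probability. The receiver is the coherent maximum-likelihood detector for $M$-QAM treating interference as Gaussian noise, that is, it knows $h_0$ and outputs $\hat s\in\arg\min_{s\in\mathbf S}\left|y_0-\sqrt P\,h_0r_0^{-\eta/2}s\right|$.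 The average symbol error probability is $\bar{\mathcal S}(r_0)=\mathbb P\{\hat s\ne s_0\}$, where the probability is over all of the random quantities above with $r_0$ fixed. Notation. $\operatorname{erfc}(x)=\frac{2}{\sqrt\pi}\int_x^\infty e^{-t^2}\mathrm dt$. ${}_2F_1(a,b;c;x)$ is the Gauss hypergeometric function, given by $\sum_{n\ge0}\frac{(a)_n(b)_n}{(c)_n}\frac{x^n}{n!}$ for $|x|<1$ with $(a)_n=\Gamma(a+n)/\Gamma(a)$, and by analytic continuation to $\mathbb C\setminus[1,\infty)$ otherwise. $\mathbf 1_{\{c=2\}}$ equals $1$ if $c=2$ and $0$ otherwise. *)

theory Defs
  imports "HOL-Probability.Probability"
begin

section \<open>Special functions\<close>

definition erfc :: "real \<Rightarrow> real" where
  "erfc x = 2 / sqrt pi * (LBINT t:{x..}. exp (- t\<^sup>2))"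

text \<open>
  The Gauss hypergeometric function on the plane slit along \<open>[1, \<infinity>)\<close>: the value at \<open>z\<close> of the
  holomorphic function on the slit plane whose power series on the unit disc is the hypergeometric
  series. The slit plane is connected, so this function is unique. On the slit the value is
  unspecified. If \<open>c\<close> is a non-positive integer, division by zero truncates the series.
\<close>

definition slit_plane :: "complex set" where
  "slit_plane = - {z. Im z = 0 \<and> 1 \<le> Re z}"

definition hypergeometric_2F1 :: "complex \<Rightarrow> complex \<Rightarrow> complex \<Rightarrow> complex \<Rightarrow> complex" where
  "hypergeometric_2F1 a b c z = (THE w. z \<in> slit_plane \<and>
     (\<exists>g. g holomorphic_on slit_plane \<and>
          (\<forall>x. cmod x < 1 \<longrightarrow>
             (\<lambda>n. pochhammer a n * pochhammer b n / pochhammer c n * x ^ n / fact n) sums g x) \<and>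
          w = g z))"


section \<open>The constellation\<close>

definition qam :: "nat \<Rightarrow> complex set" where
  "qam M = {complex_of_real (sqrt (3 / (2 * (real M - 1)))) *
              Complex (2 * real a - sqrt (real M) - 1) (2 * real b - sqrt (real M) - 1) | a b :: nat.
            1 \<le> a \<and> real a \<le> sqrt (real M) \<and> 1 \<le> b \<and> real b \<le> sqrt (real M)}"


section \<open>Random quantities\<close>

context prob_space
begin

definition uniform_on :: "('a \<Rightarrow> complex) \<Rightarrow> complex set \<Rightarrow> bool" where
  "uniform_on X S \<longleftrightarrow> random_variable borel X \<and>
     (\<forall>s\<in>S. \<P>(\<omega> in M. X \<omega> = s) = 1 / real (card S))"

text \<open>
  \<open>circular_gaussian Z v\<close>: the law of \<open>Z\<close> is \<open>\<C>\<N>(0, v)\<close>. The variance \<open>v = \<E>|Z|\<^sup>2 > 0\<close> is split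
  equally between the real and the imaginary part.
\<close>

definition circular_gaussian :: "('a \<Rightarrow> complex) \<Rightarrow> real \<Rightarrow> bool" where
  "circular_gaussian Z v \<longleftrightarrow>
     distributed M lborel (\<lambda>\<omega>. Re (Z \<omega>)) (\<lambda>x. ennreal (normal_density 0 (sqrt (v / 2)) x)) \<and>
     distributed M lborel (\<lambda>\<omega>. Im (Z \<omega>)) (\<lambda>x. ennreal (normal_density 0 (sqrt (v / 2)) x)) \<and>
     indep_var borel (\<lambda>\<omega>. Re (Z \<omega>)) borel (\<lambda>\<omega>. Im (Z \<omega>))"

text \<open>
  \<open>homogeneous_ppp X lam D\<close>: the points \<open>X 0, X 1, \<dots>\<close>, listed in some order, form a homogeneous
  Poisson point process of intensity \<open>lam\<close> on \<open>D\<close>. An enumeration by all of \<open>\<nat>\<close> requires \<open>D\<close> to have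
  infinite volume, for then the process has almost surely infinitely many points. Taking sets \<open>B\<close>
  disjoint from \<open>D\<close> shows that almost surely all points lie in \<open>D\<close>. The counts are taken with
  \<^const>\<open>card\<close>, which is \<open>0\<close> on infinite sets, whence the separate finiteness condition.
\<close>

definition homogeneous_ppp :: "(nat \<Rightarrow> 'a \<Rightarrow> 'b::euclidean_space) \<Rightarrow> real \<Rightarrow> 'b set \<Rightarrow> bool" where
  "homogeneous_ppp X lam D \<longleftrightarrow>
     (\<forall>k. random_variable borel (X k)) \<and>
     (\<forall>B\<in>sets borel. bounded B \<longrightarrow>
        (AE \<omega> in M. finite {k. X k \<omega> \<in> B}) \<and>
        (\<forall>n. \<P>(\<omega> in M. card {k. X k \<omega> \<in> B} = n) =
           exp (- (lam * measure lborel (B \<inter> D))) * (lam * measure lborel (B \<inter> D)) ^ n / fact n)) \<and>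
     (\<forall>B :: nat \<Rightarrow> 'b set. (\<forall>i. B i \<in> sets borel \<and> bounded (B i)) \<and> disjoint_family B \<longrightarrow>
        indep_vars (\<lambda>_. count_space UNIV) (\<lambda>i \<omega>. card {k. X k \<omega> \<in> B i}) UNIV)"

end

text \<open>
  Joint independence of the sources of randomness. The library's \<open>indep_vars\<close> requires all variables
  to have the same type, so independence is expressed by the generated \<open>\<sigma>\<close>-algebras. The point
  process enters as the sequence of its points: the order in which the points are listed must not
  depend on the other variables either, because the interference series need not converge absolutely.
\<close>

datatype source = Points | Useful_Symbol | Useful_Fading | Noise | Symbol nat | Fading nat

definition (in prob_space) mutually_independent ::
  "(nat \<Rightarrow> 'a \<Rightarrow> 'b::euclidean_space) \<Rightarrow> ('a \<Rightarrow> complex) \<Rightarrow> ('a \<Rightarrow> complex) \<Rightarrow> ('a \<Rightarrow> complex) \<Rightarrow>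
   (nat \<Rightarrow> 'a \<Rightarrow> complex) \<Rightarrow> (nat \<Rightarrow> 'a \<Rightarrow> complex) \<Rightarrow> bool" where
  "mutually_independent X s0 h0 n s h \<longleftrightarrow>
     indep_sets
       (\<lambda>i. case i of
          Points \<Rightarrow> {(\<lambda>\<omega> k. X k \<omega>) -` A \<inter> space M | A. A \<in> sets (\<Pi>\<^sub>M k\<in>UNIV. borel)}
        | Useful_Symbol \<Rightarrow> {s0 -` A \<inter> space M | A. A \<in> sets borel}
        | Useful_Fading \<Rightarrow> {h0 -` A \<inter> space M | A. A \<in> sets borel}
        | Noise \<Rightarrow> {n -` A \<inter> space M | A. A \<in> sets borel}
        | Symbol k \<Rightarrow> {s k -` A \<inter> space M | A. A \<in> sets borel}
        | Fading k \<Rightarrow> {h k -` A \<inter> space M | A. A \<in> sets borel})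
       UNIV"


section \<open>Received signal and detection\<close>

definition useful_gain :: "real \<Rightarrow> real \<Rightarrow> real \<Rightarrow> complex \<Rightarrow> complex" where
  "useful_gain P r0 \<eta> h0 = complex_of_real (sqrt P) * h0 * complex_of_real (r0 powr (- \<eta> / 2))"

definition received_signal ::
  "real \<Rightarrow> real \<Rightarrow> real \<Rightarrow> complex \<Rightarrow> complex \<Rightarrow> complex \<Rightarrow>
   (nat \<Rightarrow> 'b::euclidean_space) \<Rightarrow> (nat \<Rightarrow> complex) \<Rightarrow> (nat \<Rightarrow> complex) \<Rightarrow> complex" where
  "received_signal P r0 \<eta> s0 h0 n x s h =
     useful_gain P r0 \<eta> h0 * s0 +
     (\<Sum>k. complex_of_real (sqrt P) * s k * h k * complex_of_real (norm (x k) powr (- \<eta> / 2))) + n"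

definition ml_detection :: "complex set \<Rightarrow> complex \<Rightarrow> complex \<Rightarrow> complex \<Rightarrow> bool" where
  "ml_detection S g y shat \<longleftrightarrow> is_arg_min (\<lambda>s. cmod (y - g * s)) (\<lambda>s. s \<in> S) shat"

end

theory Submission
  imports Defs "HOL-Complex_Analysis.Complex_Analysis"
begin

text \<open>
  Given the fading coefficients and the positions of the interferers, the interference is a series
  of independent complex Gaussian variables. It converges almost surely by Kolmogorov's inequality,
  and its sum is complex Gaussian with variance \<open>P\<close> times \<open>J = (\<Sum>k. |h\<^sub>k|^2 r\<^sub>k powr (- \<eta>))\<close>. Hence the
  detector faces Gaussian noise of variance \<open>N0 + P J\<close>. The decision regions are products of two
  intervals, so the conditional probability of a correct decision, averaged over the symbols, is
  \<open>(1 - \<rho> e)^2\<close> with \<open>\<rho> = (sqrt M - 1) / sqrt M\<close> and \<open>e = erfc (sqrt (|h\<^sub>0|^2 / A))\<close>, where \<open>A\<close> is affine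
  in \<open>J\<close>. Writing \<open>1 - e ^ c\<close> as an integral over \<open>0 < z < |h\<^sub>0|^2 / A\<close> and using that \<open>|h\<^sub>0|^2\<close> is
  exponentially distributed leaves the expectation of \<open>exp (- A z)\<close>, that is, the Laplace transform
  of \<open>J\<close>. The generating functional of the Poisson process gives it as the exponential of a radial
  integral, which is Euler's integral for the hypergeometric function.
\<close>


section \<open>Planar radial integrals and the complementary error function\<close>

text \<open>The obstacle is that for \<open>\<eta> \<le> 4\<close> the interference series does not
  converge absolutely: the distances, in increasing order, almost surely grow like
  \<open>sqrt k\<close>, so the amplitudes \<open>r_k powr (- \<eta> / 2)\<close> are summable only
  for \<open>\<eta> > 4\<close>, but their squares for every \<open>\<eta> > 2\<close>. Convergence
  has to come from the independence of the symbols. The law of the sum is found without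
  characteristic functions: the partial sums have explicit densities, and these are compared on open
  sets.

  Finiteness of \<open>J\<close> is itself a result. The transform is computed as the mean of an
  infinite product, which is \<open>0\<close> wherever \<open>J\<close> diverges; letting its
  argument tend to \<open>0\<close> shows that divergence is a null event.

  The weights come from \<open>1 - (1 - \<rho> e)^2 = 2 \<rho> e - \<rho>^2 e^2\<close>, one term
  for each power \<open>c\<close> of \<open>e\<close>, and \<open>\<beta>\<close> is the square of
  half the distance between neighbouring constellation points. Ties may be broken in any measurable
  way, so the event of a correct decision is only enclosed between two events, which turn out to be
  equally likely.\<close>

lemma nn_integral_norm_square:
  fixes F :: "real \<Rightarrow> ennreal"
  assumes dim: "DIM('a::euclidean_space) = 2" and [measurable]: "F \<in> borel_measurable borel"
  shows "(\<integral>\<^sup>+x. F ((norm (x::'a))^2) \<partial>lborel) = ennreal pi * (\<integral>\<^sup>+u. F u * indicator {0..} u \<partial>lborel)"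
proof -
  \<comment> \<open>The minus sign matters: measures on the line agree if they have the same finite
    values on all half-lines \<open>{x<..}\<close>. For \<open>- (norm x)^2\<close> the preimages of
    these are balls of finite area; without the sign they would be complements of balls.\<close>
  define M1 where "M1 = distr lborel borel (\<lambda>x::'a. - (norm x)\<^sup>2)"
  define M2 where "M2 = density lborel (\<lambda>w. ennreal pi * indicator {..0::real} w)"
  have 1: "emeasure M1 {x<..} = ennreal (pi * max 0 (- x))" for x
  proof -
    have "emeasure M1 {x<..} = emeasure lborel {y::'a. (norm y)^2 < - x}"
      unfolding M1_def by (subst emeasure_distr) (auto intro!: arg_cong[where f="emeasure lborel"])
    also have "\<dots> = ennreal (pi * max 0 (- x))"
    proof (cases "x < 0")
      case True
      have "{y::'a. (norm y)^2 < - x} = ball 0 (sqrt (- x))"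
        using True by (auto simp: real_less_rsqrt ) (smt (verit) norm_ge_zero real_less_rsqrt real_sqrt_less_iff real_sqrt_pow2 real_sqrt_abs power2_less_imp_less)
      then show ?thesis
        using True by (simp add: emeasure_ball dim unit_ball_vol_2)
    next
      case False
      then have "{y::'a. (norm y)^2 < - x} = {}" by (auto simp: not_less) (smt (verit) zero_le_power2)
      with False show ?thesis by (simp add: max_def)
    qed
    finally show ?thesis .
  qed
  have 2: "emeasure M2 {x<..} = ennreal (pi * max 0 (- x))" for x
  proof -
    have "emeasure M2 {x<..} = ennreal pi * emeasure lborel {x<..0}"
      unfolding M2_def by (subst emeasure_density)
        (auto simp: nn_integral_cmult[symmetric] mult.assoc simp flip: nn_integral_indicator intro!: nn_integral_cong split: split_indicator)
    also have "emeasure lborel {x<..0} = ennreal (max 0 (- x))"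
      by (cases "x \<le> 0") auto
    finally show ?thesis by (subst ennreal_mult') auto
  qed
  have eq: "M1 = M2"
    by (rule measure_eqI_lessThan) (auto simp: 1 2, auto simp: M1_def M2_def)
  have "(\<integral>\<^sup>+x. F ((norm (x::'a))^2) \<partial>lborel) = (\<integral>\<^sup>+w. F (- w) \<partial>M1)"
    unfolding M1_def by (subst nn_integral_distr) auto
  also have "\<dots> = ennreal pi * (\<integral>\<^sup>+w. F (- w) * indicator {..0} w \<partial>lborel)"
    unfolding eq M2_def by (subst nn_integral_density) (auto simp: nn_integral_cmult[symmetric] mult_ac)
  also have "(\<integral>\<^sup>+w. F (- w) * indicator {..0} w \<partial>lborel) = (\<integral>\<^sup>+u. F u * indicator {0..} u \<partial>lborel)"
    by (subst (2) nn_integral_real_affine[where c="-1" and t=0]) (auto intro!: nn_integral_cong split: split_indicator)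
  finally show ?thesis .
qed

section \<open>The complementary error function: bounds, derivative, layer-cake formula\<close>

lemma gauss_integrable: "integrable lborel (\<lambda>t::real. exp (- t\<^sup>2))"
proof -
  have "integrable lborel (\<lambda>t. sqrt pi * normal_density 0 (sqrt (1/2)) t)" by simp
  then show ?thesis by (simp add: normal_density_def)
qed

lemma gauss_integral: "(LBINT t. exp (- t\<^sup>2)) = sqrt pi"
proof -
  have "(LBINT t. sqrt pi * normal_density 0 (sqrt (1/2)) t) = sqrt pi" by simp
  then show ?thesis by (simp add: normal_density_def)
qed

lemma gauss_set_integrable: "A \<in> sets borel \<Longrightarrow> set_integrable lborel A (\<lambda>t::real. exp (- t\<^sup>2))"
  unfolding set_integrable_def by (rule integrable_mult_indicator) (auto intro: gauss_integrable)

lemma erfc_nonneg: "0 \<le> erfc x"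
  unfolding erfc_def set_lebesgue_integral_def by (auto intro!: mult_nonneg_nonneg Bochner_Integration.integral_nonneg)

lemma erfc_antimono: "x \<le> y \<Longrightarrow> erfc y \<le> erfc x"
  unfolding erfc_def set_lebesgue_integral_def
  by (intro mult_left_mono integral_mono gauss_set_integrable[unfolded set_integrable_def])
     (auto split: split_indicator)

lemma erfc_0: "erfc 0 = 1"
proof -
  have "(LBINT t:{0..}. exp (- t\<^sup>2)) = (LBINT t:{..0}. exp (- t\<^sup>2) :: real)"
    unfolding set_lebesgue_integral_def
    by (subst lborel_integral_real_affine[where c="-1" and t=0]) (auto intro!: Bochner_Integration.integral_cong split: split_indicator)
  moreover have "(LBINT t:{0..}. exp (- t\<^sup>2)) = (LBINT t:{0<..}. exp (- t\<^sup>2) :: real)"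
    by (rule set_integral_cong_set) (auto simp: set_borel_measurable_def intro!: AE_I[where N="{0}"])
  moreover have "(LBINT t:({..0} \<union> {0<..}). exp (- t\<^sup>2) :: real) = (LBINT t:{..0}. exp (- t\<^sup>2)) + (LBINT t:{0<..}. exp (- t\<^sup>2))"
    by (rule set_integral_Un) (auto intro: gauss_set_integrable)
  moreover have "{..0} \<union> {0<..} = (UNIV::real set)" by auto
  ultimately have "2 * (LBINT t:{0..}. exp (- t\<^sup>2) :: real) = sqrt pi"
    using gauss_integral by (simp add: set_lebesgue_integral_def)
  then show ?thesis unfolding erfc_def by (simp add: field_simps)
qed

lemma erfc_le_1: "0 \<le> x \<Longrightarrow> erfc x \<le> 1" using erfc_antimono[of 0 x] by (simp add: erfc_0)

lemma measurable_erfc [measurable]: "erfc \<in> borel_measurable borel"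
proof -
  have "(\<lambda>x. - erfc x) \<in> borel_measurable borel"
    by (rule borel_measurable_mono) (auto simp: mono_def erfc_antimono)
  then have "(\<lambda>x. - (- erfc x)) \<in> borel_measurable borel" by (rule borel_measurable_uminus)
  then show ?thesis by simp
qed

lemma erfc_diff: "x \<le> y \<Longrightarrow> erfc x - erfc y = 2 / sqrt pi * (LBINT t=x..y. exp (- t\<^sup>2))"
proof -
  assume xy: "x \<le> y"
  have "(LBINT t:({x..<y} \<union> {y..}). exp (- t\<^sup>2) :: real) = (LBINT t:{x..<y}. exp (- t\<^sup>2)) + (LBINT t:{y..}. exp (- t\<^sup>2))"
    by (rule set_integral_Un) (auto intro: gauss_set_integrable)
  moreover have "{x..<y} \<union> {y..} = {x..}" using xy by auto
  moreover have "(LBINT t:{x..<y}. exp (- t\<^sup>2)) = (LBINT t=x..y. exp (- t\<^sup>2) :: real)"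
    using xy by (simp add: interval_integral_Ico)
  ultimately show ?thesis unfolding erfc_def by (simp add: algebra_simps)
qed

text \<open>The improper tail integral is rewritten with the finite base point \<open>x - 1\<close>,
  so that the fundamental theorem of calculus on \<open>{x - 1..x + 1}\<close> applies at the
  interior point \<open>x\<close>.\<close>

lemma erfc_has_derivative: "(erfc has_real_derivative (- 2 / sqrt pi * exp (- x\<^sup>2))) (at x)"
proof -
  let ?a = "x - 1" and ?b = "x + 1"
  have eq: "erfc u = erfc ?a - 2 / sqrt pi * (LBINT t=?a..u. exp (- t\<^sup>2))" if "?a \<le> u" for u
    using erfc_diff[OF that] by simp
  have "((\<lambda>u. LBINT t=?a..u. exp (- t\<^sup>2)) has_vector_derivative exp (- x\<^sup>2)) (at x within {?a..?b})"
    by (rule interval_integral_FTC2[where c="?a"]) (auto intro!: continuous_intros)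
  then have "((\<lambda>u. LBINT t=?a..u. exp (- t\<^sup>2)) has_real_derivative exp (- x\<^sup>2)) (at x)"
    unfolding has_real_derivative_iff_has_vector_derivative by (subst (asm) at_within_interior) auto
  then have "((\<lambda>u. erfc ?a - 2 / sqrt pi * (LBINT t=?a..u. exp (- t\<^sup>2))) has_real_derivative (0 - 2 / sqrt pi * exp (- x\<^sup>2))) (at x)"
    by (intro DERIV_diff DERIV_const DERIV_cmult)
  then have "((\<lambda>u. erfc ?a - 2 / sqrt pi * (LBINT t=?a..u. exp (- t\<^sup>2))) has_real_derivative (- 2 / sqrt pi * exp (- x\<^sup>2))) (at x)"
    by simp
  then show ?thesis
  proof (rule DERIV_cong_ev[THEN iffD1, rotated -1])
    have "\<forall>\<^sub>F u in nhds x. u \<in> {?a<..<?b}" by (rule eventually_nhds_in_open) auto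
    then show "\<forall>\<^sub>F u in nhds x. erfc ?a - 2 / sqrt pi * (LBINT t=?a..u. exp (- t\<^sup>2)) = erfc u"
      by (rule eventually_mono) (rule eq[symmetric], simp)
  qed simp_all
qed

lemma isCont_erfc: "isCont erfc x"
  using erfc_has_derivative by (rule DERIV_isCont)


text \<open>For \<open>z > 0\<close> this is the derivative of \<open>1 - erfc (sqrt z) ^ c\<close>.
  Its singularity at \<open>0\<close> is integrable.\<close>

definition erfc_kernel :: "nat \<Rightarrow> real \<Rightarrow> real" where
  "erfc_kernel c z = real c / sqrt pi * (erfc (sqrt z) ^ (c - 1) / sqrt z * exp (- z))"

lemma measurable_erfc_kernel [measurable]: "erfc_kernel c \<in> borel_measurable borel"
  unfolding erfc_kernel_def by measurable

lemma erfc_kernel_nonneg: "0 \<le> z \<Longrightarrow> 0 \<le> erfc_kernel c z"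
  unfolding erfc_kernel_def by (auto intro!: mult_nonneg_nonneg divide_nonneg_nonneg zero_le_power erfc_nonneg)

text \<open>The antiderivative is continuous up to \<open>0\<close> and the kernel is nonnegative,
  so the fundamental theorem also yields integrability across the singularity. With a random
  \<open>x\<close>, the randomness enters the left side only through the event
  \<open>z < x\<close>.\<close>

lemma erfc_power_layer_cake:
  assumes "0 \<le> x"
  shows "(\<integral>\<^sup>+z. ennreal (erfc_kernel c z) * indicator {0<..<x} z \<partial>lborel) = ennreal (1 - erfc (sqrt x) ^ c)"
proof (cases "x = 0")
  case True
  then show ?thesis by (simp add: erfc_0)
next
  case False
  with assms have x: "0 < x" by simp
  let ?F = "\<lambda>z. - (erfc (sqrt z) ^ c)"
  have cont_sqrt: "isCont (\<lambda>z. erfc (sqrt z)) z" for z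
    by (intro isCont_o2[OF _ isCont_erfc] continuous_intros)
  have contF: "isCont ?F z" for z by (intro continuous_intros cont_sqrt)
  have deriv: "(?F has_real_derivative erfc_kernel c z) (at z)" if "0 < z" for z
  proof -
    have "((\<lambda>z. erfc (sqrt z)) has_real_derivative (- 2 / sqrt pi * exp (- (sqrt z)\<^sup>2)) * (inverse (sqrt z) / 2)) (at z)"
      by (rule DERIV_chain2[OF erfc_has_derivative DERIV_real_sqrt[OF that]])
    then have "(?F has_real_derivative - (real c * (erfc (sqrt z) ^ (c - Suc 0) * ((- 2 / sqrt pi * exp (- (sqrt z)\<^sup>2)) * (inverse (sqrt z) / 2))))) (at z)"
      by (intro DERIV_minus DERIV_power[THEN DERIV_cong]) auto
    also have "- (real c * (erfc (sqrt z) ^ (c - Suc 0) * ((- 2 / sqrt pi * exp (- (sqrt z)\<^sup>2)) * (inverse (sqrt z) / 2)))) = erfc_kernel c z"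
      using that unfolding erfc_kernel_def by (simp add: inverse_eq_divide)
    finally show ?thesis .
  qed
  have contk: "isCont (erfc_kernel c) z" if "0 < z" for z
    unfolding erfc_kernel_def using that by (intro continuous_intros cont_sqrt) auto
  \<comment> \<open>The fundamental theorem on an open interval asks for limits at extended real
    endpoints. Since \<open>?F\<close> is continuous on the whole line, one statement serves both
    ends.\<close>
  have lims: "((?F \<circ> real_of_ereal) \<longlongrightarrow> ?F a) (at (ereal a) within S)" for a S
  proof -
    have "isCont (?F \<circ> real_of_ereal) (ereal a)"
      by (intro continuous_at_compose continuous_at_of_ereal) (auto simp: contF)
    then have "continuous (at (ereal a) within S) (?F \<circ> real_of_ereal)"
      by (rule continuous_at_imp_continuous_at_within)
    then show ?thesis unfolding continuous_within by simp
  qed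
  have *: "set_integrable lborel (einterval (ereal 0) (ereal x)) (erfc_kernel c)"
    "(LBINT z=ereal 0..ereal x. erfc_kernel c z) = ?F x - ?F 0"
    by (rule interval_integral_FTC_nonneg[OF _ _ _ _ lims lims];
        use x in \<open>auto intro!: deriv contk erfc_kernel_nonneg\<close>)+
  have ei: "einterval (ereal 0) (ereal x) = {0<..<x}" by (auto simp: einterval_def)
  have "(\<integral>\<^sup>+z. ennreal (erfc_kernel c z) * indicator {0<..<x} z \<partial>lborel) =
    (\<integral>\<^sup>+z. ennreal (indicator {0<..<x} z *\<^sub>R erfc_kernel c z) \<partial>lborel)"
    by (intro nn_integral_cong) (auto split: split_indicator)
  also have "\<dots> = ennreal (\<integral>z. indicator {0<..<x} z *\<^sub>R erfc_kernel c z \<partial>lborel)"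
    using *(1) unfolding set_integrable_def ei
    by (intro nn_integral_eq_integral) (auto split: split_indicator intro!: AE_I2 erfc_kernel_nonneg)
  also have "(\<integral>z. indicator {0<..<x} z *\<^sub>R erfc_kernel c z \<partial>lborel) = ?F x - ?F 0"
    using *(2) x unfolding interval_lebesgue_integral_def set_lebesgue_integral_def ei by simp
  finally show ?thesis by (simp add: erfc_0)
qed


section \<open>Almost sure convergence of independent series\<close>

context prob_space begin

text \<open>The events \<open>A k\<close>, that \<open>k\<close> is the first index with a large
  partial sum, are disjoint, and each carries at least \<open>\<epsilon>^2 * prob (A k)\<close> of
  the second moment of the full sum \<open>S n\<close>. By orthogonality that second moment is the
  sum of the variances.\<close>

lemma kolmogorov_maximal:
  fixes Y :: "nat \<Rightarrow> 'a \<Rightarrow> real"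
  assumes ind: "indep_vars (\<lambda>_. borel) Y UNIV"
    and int: "\<And>i. integrable M (Y i)" and mean: "\<And>i. expectation (Y i) = 0"
    and sq: "\<And>i. integrable M (\<lambda>x. (Y i x)^2)"
    and eps: "\<epsilon> > 0"
  shows "prob {x\<in>space M. \<exists>k\<le>n. \<epsilon> \<le> \<bar>\<Sum>i<k. Y i x\<bar>} \<le> (\<Sum>i<n. expectation (\<lambda>x. (Y i x)^2)) / \<epsilon>^2"
proof -
  define S where "S k x = (\<Sum>i<k. Y i x)" for k x
  define A where "A k = {x\<in>space M. \<epsilon> \<le> \<bar>S k x\<bar> \<and> (\<forall>j<k. \<bar>S j x\<bar> < \<epsilon>)}" for k
  have Y_meas [measurable]: "Y i \<in> borel_measurable M" for i using int by auto
  have S_meas [measurable]: "S k \<in> borel_measurable M" for k unfolding S_def by measurable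
  have A_meas [measurable]: "A k \<in> sets M" for k unfolding A_def by measurable
  have intYY: "integrable M (\<lambda>x. Y i x * Y j x)" for i j
  proof (rule Bochner_Integration.integrable_bound[of M "\<lambda>x. (Y i x)^2 + (Y j x)^2"])
    show "AE x in M. norm (Y i x * Y j x) \<le> norm ((Y i x)^2 + (Y j x)^2)"
    proof (rule AE_I2)
      fix x
      have "0 \<le> (\<bar>Y i x\<bar> - \<bar>Y j x\<bar>)\<^sup>2" by simp
      then have "2 * (\<bar>Y i x\<bar> * \<bar>Y j x\<bar>) \<le> (Y i x)\<^sup>2 + (Y j x)^2"
        by (simp add: power2_diff)
      moreover have "0 \<le> \<bar>Y i x\<bar> * \<bar>Y j x\<bar>" by simp
      ultimately show "norm (Y i x * Y j x) \<le> norm ((Y i x)^2 + (Y j x)^2)"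
        unfolding real_norm_def abs_mult by linarith
    qed
  qed (auto intro: sq)
  have intSS: "integrable M (\<lambda>x. S k x * S l x)" for k l
    unfolding S_def sum_product by (intro Bochner_Integration.integrable_sum intYY)
  have orth: "expectation (\<lambda>x. Y i x * Y j x) = 0" if "i \<noteq> j" for i j
  proof -
    have "indep_vars (\<lambda>_. borel) Y {i, j}" using ind by (rule indep_vars_subset) simp
    from indep_vars_lebesgue_integral[OF _ this] int mean that show ?thesis by simp
  qed
  have ES: "expectation (\<lambda>x. (S n x)^2) = (\<Sum>i<n. expectation (\<lambda>x. (Y i x)^2))"
  proof -
    have "expectation (\<lambda>x. (S n x)^2) = (\<Sum>i<n. \<Sum>j<n. expectation (\<lambda>x. Y i x * Y j x))"
      unfolding S_def power2_eq_square sum_product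
      by (simp add: Bochner_Integration.integral_sum intYY)
    also have "\<dots> = (\<Sum>i<n. \<Sum>j<n. if j = i then expectation (\<lambda>x. (Y i x)^2) else 0)"
      by (intro sum.cong) (auto simp: orth power2_eq_square)
    finally show ?thesis by (simp add: sum.delta')
  qed
  let ?w = "\<lambda>k x. indicator (A k) x * (S n x)^2"
  \<comment> \<open>Expand \<open>S n = S k + R\<close> on \<open>A k\<close> and drop the square of
    the remainder \<open>R\<close>. The cross term has mean zero: \<open>S k\<close> cut off to
    \<open>A k\<close> is a function of the variables before \<open>k\<close>, and \<open>R\<close>
    of those from \<open>k\<close> on.\<close>
  have key: "\<epsilon>^2 * prob (A k) \<le> expectation (?w k)" if "k \<le> n" for k
  proof -
    let ?V = "\<lambda>x. indicator (A k) x * S k x" and ?R = "\<lambda>x. \<Sum>i\<in>{k..<n}. Y i x"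
    have SnR: "S n x = S k x + ?R x" for x
      using that unfolding S_def by (subst sum.atLeastLessThan_concat[symmetric, of 0 k n, simplified atLeast0LessThan]) auto
    \<comment> \<open>\<open>G\<close> and \<open>H\<close> are the two factors as functions of a
      sequence. Membership in \<open>A k\<close> is expressed through coordinates below
      \<open>k\<close>, because block independence speaks of the restricted families
      \<open>?p\<close> and \<open>?q\<close>.\<close>
    define G :: "(nat \<Rightarrow> real) \<Rightarrow> real" where
      "G y = (if \<epsilon> \<le> \<bar>\<Sum>i<k. y i\<bar> \<and> (\<forall>j<k. \<bar>\<Sum>i<j. y i\<bar> < \<epsilon>) then (\<Sum>i<k. y i) else 0)" for y
    define H :: "(nat \<Rightarrow> real) \<Rightarrow> real" where "H y = (\<Sum>i\<in>{k..<n}. y i)" for y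
    let ?p = "\<lambda>x. restrict (\<lambda>i. Y i x) {..<k}" and ?q = "\<lambda>x. restrict (\<lambda>i. Y i x) {k..<n}"
    have sub: "(\<lambda>y. \<Sum>i<j. y i) \<in> borel_measurable (\<Pi>\<^sub>M i\<in>{..<k}. borel :: real measure)" if "j \<le> k" for j
      using that by (intro borel_measurable_sum measurable_component_singleton) auto
    have G_meas: "G \<in> borel_measurable (\<Pi>\<^sub>M i\<in>{..<k}. borel)"
    proof -
      have [measurable]: "Measurable.pred (\<Pi>\<^sub>M i\<in>{..<k}. borel) (\<lambda>y. \<forall>j<k. \<bar>\<Sum>i<j. y i\<bar> < \<epsilon>)"
      proof -
        have *: "(\<forall>j<k. \<bar>\<Sum>i<j. y i\<bar> < \<epsilon>) = (\<forall>j\<in>{..<k}. \<bar>\<Sum>i<j. y i\<bar> < \<epsilon>)" for y :: "nat \<Rightarrow> real" by auto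
        show ?thesis unfolding *
        proof (rule pred_intros_finite)
          fix j assume "j \<in> {..<k}"
          then have [measurable]: "(\<lambda>y. \<Sum>i<j. y i) \<in> borel_measurable (\<Pi>\<^sub>M i\<in>{..<k}. borel :: real measure)"
            using sub[of j] by auto
          show "Measurable.pred (\<Pi>\<^sub>M i\<in>{..<k}. borel) (\<lambda>y. \<bar>\<Sum>i<j. y i\<bar> < \<epsilon>)" by measurable
        qed simp
      qed
      note [measurable] = sub[OF order_refl]
      show ?thesis unfolding G_def by measurable
    qed
    have H_meas: "H \<in> borel_measurable (\<Pi>\<^sub>M i\<in>{k..<n}. borel)"
      unfolding H_def by (intro borel_measurable_sum measurable_component_singleton) auto
    have "indep_var (PiM {..<k} (\<lambda>_. borel)) (\<lambda>\<omega>. restrict (\<lambda>i. Y i \<omega>) {..<k})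
                    (PiM {k..<n} (\<lambda>_. borel)) (\<lambda>\<omega>. restrict (\<lambda>i. Y i \<omega>) {k..<n})"
      by (rule indep_var_restrict[OF ind]) auto
    from indep_var_compose[OF this G_meas H_meas]
    have iv: "indep_var borel (\<lambda>x. G (?p x)) borel (\<lambda>x. H (?q x))"
      by (simp add: comp_def)
    have H_eq: "H (?q x) = ?R x" for x unfolding H_def by auto
    have G_eq: "G (?p x) = ?V x" if "x \<in> space M" for x
    proof -
      have "(\<Sum>i<j. restrict (\<lambda>i. Y i x) {..<k} i) = S j x" if "j \<le> k" for j
        unfolding S_def using that by (intro sum.cong) auto
      then show ?thesis using that by (auto simp: G_def A_def)
    qed
    have intSi: "integrable M (S i)" for i unfolding S_def by (intro Bochner_Integration.integrable_sum int)
    have intV: "integrable M ?V" using integrable_mult_indicator[OF A_meas intSi] by (simp)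
    have intG: "integrable M (\<lambda>x. G (?p x))"
      using intV by (rule Bochner_Integration.integrable_cong[THEN iffD1, rotated -1]) (auto simp: G_eq)
    have intR: "integrable M ?R" by (intro Bochner_Integration.integrable_sum int)
    have "expectation (\<lambda>x. G (?p x) * H (?q x)) = 0"
      by (subst indep_var_lebesgue_integral[OF iv intG]) (auto simp: H_eq intR Bochner_Integration.integral_sum int mean)
    moreover have "expectation (\<lambda>x. G (?p x) * H (?q x)) = expectation (\<lambda>x. ?V x * ?R x)"
      by (intro Bochner_Integration.integral_cong) (auto simp: G_eq H_eq)
    ultimately have cross: "expectation (\<lambda>x. ?V x * ?R x) = 0" by simp
    have intVR: "integrable M (\<lambda>x. ?V x * ?R x)"
    proof -
      have "integrable M (\<lambda>x. indicator (A k) x *\<^sub>R (S k x * S n x - S k x * S k x))"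
        by (intro integrable_mult_indicator A_meas Bochner_Integration.integrable_diff intSS)
      then show ?thesis by (simp add: SnR algebra_simps)
    qed
    have "\<epsilon>^2 * prob (A k) = expectation (\<lambda>x. \<epsilon>^2 * indicator (A k) x)" by simp
    also have "\<dots> = expectation (\<lambda>x. \<epsilon>^2 * indicator (A k) x + 2 * (?V x * ?R x))"
      using cross intVR by (subst Bochner_Integration.integral_add) (auto simp: emeasure_eq_measure)
    also have "\<dots> \<le> expectation (?w k)"
    proof (rule integral_mono)
      show "integrable M (\<lambda>x. \<epsilon>^2 * indicator (A k) x + 2 * (?V x * ?R x))"
        using intVR by (auto simp: emeasure_eq_measure)
      show "integrable M (?w k)"
        using integrable_mult_indicator[OF A_meas intSS[of n n]] by (simp add: power2_eq_square)
      fix x assume x: "x \<in> space M"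
      show "\<epsilon>^2 * indicator (A k) x + 2 * (?V x * ?R x) \<le> indicator (A k) x * (S n x)^2"
      proof (cases "x \<in> A k")
        case True
        then have "\<epsilon> \<le> \<bar>S k x\<bar>" by (simp add: A_def)
        then have "\<epsilon>^2 \<le> (S k x)\<^sup>2" using eps by (metis abs_of_pos power2_abs power_mono less_eq_real_def)
        then show ?thesis using True by (simp add: SnR power2_sum add_increasing2)
      qed simp
    qed
    finally show ?thesis .
  qed
  have disj: "disjoint_family_on A {..n}"
    unfolding disjoint_family_on_def A_def by (auto) (metis linorder_neqE_nat not_less)
  have Un: "{x\<in>space M. \<exists>k\<le>n. \<epsilon> \<le> \<bar>\<Sum>i<k. Y i x\<bar>} = (\<Union>k\<in>{..n}. A k)"
  proof safe
    fix x k assume x: "x \<in> space M" and k: "k \<le> n" "\<epsilon> \<le> \<bar>\<Sum>i<k. Y i x\<bar>"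
    let ?k = "LEAST k. \<epsilon> \<le> \<bar>S k x\<bar>"
    have "\<epsilon> \<le> \<bar>S ?k x\<bar>" by (rule LeastI[of _ k]) (use k in \<open>simp add: S_def\<close>)
    moreover have "?k \<le> k" by (rule Least_le) (use k in \<open>simp add: S_def\<close>)
    moreover have "\<forall>j<?k. \<bar>S j x\<bar> < \<epsilon>" using not_less_Least by force
    ultimately show "x \<in> (\<Union>k\<in>{..n}. A k)" using x k by (auto simp: A_def intro!: bexI[of _ ?k])
  qed (auto simp: A_def S_def)
  have "\<epsilon>^2 * prob {x\<in>space M. \<exists>k\<le>n. \<epsilon> \<le> \<bar>\<Sum>i<k. Y i x\<bar>} = (\<Sum>k\<le>n. \<epsilon>^2 * prob (A k))"
    unfolding Un by (subst finite_measure_finite_Union) (auto simp: disj sum_distrib_left)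
  also have "\<dots> \<le> (\<Sum>k\<le>n. expectation (?w k))"
    by (intro sum_mono key) auto
  also have "\<dots> = expectation (\<lambda>x. (\<Sum>k\<le>n. indicator (A k) x) * (S n x)^2)"
    using integrable_mult_indicator[OF A_meas intSS[of n n]]
    by (subst Bochner_Integration.integral_sum[symmetric]) (auto simp: power2_eq_square sum_distrib_right)
  also have "\<dots> \<le> expectation (\<lambda>x. (S n x)^2)"
  proof (rule integral_mono)
    have eq: "(\<Sum>k\<le>n. indicator (A k) x :: real) = indicator (\<Union>k\<in>{..n}. A k) x" for x
      by (rule indicator_UN_disjoint[symmetric]) (auto simp: disj)
    have "(\<Union>k\<in>{..n}. A k) \<in> sets M" by auto
    from integrable_mult_indicator[OF this intSS[of n n]]
    show "integrable M (\<lambda>x. (\<Sum>k\<le>n. indicator (A k) x) * (S n x)^2)" by (simp add: eq power2_eq_square)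
    show "(\<Sum>k\<le>n. indicator (A k) x) * (S n x)^2 \<le> (S n x)\<^sup>2" for x
      unfolding eq by (auto split: split_indicator)
  qed (use intSS in \<open>simp add: power2_eq_square\<close>)
  finally show ?thesis using eps ES by (simp add: field_simps)
qed

text \<open>The partial sums starting at \<open>m\<close> ever exceed \<open>\<epsilon>\<close> with
  probability at most the tail of the variances divided by \<open>\<epsilon>^2\<close>. As
  \<open>m\<close> grows this tends to \<open>0\<close>, so almost surely the Cauchy criterion holds
  for every \<open>\<epsilon> = 1 / Suc j\<close>.\<close>

lemma AE_summable_indep:
  fixes Y :: "nat \<Rightarrow> 'a \<Rightarrow> real"
  assumes ind: "indep_vars (\<lambda>_. borel) Y UNIV"
    and int: "\<And>i. integrable M (Y i)" and mean: "\<And>i. expectation (Y i) = 0"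
    and sq: "\<And>i. integrable M (\<lambda>x. (Y i x)^2)"
    and summ: "summable (\<lambda>i. expectation (\<lambda>x. (Y i x)^2))"
  shows "AE x in M. summable (\<lambda>i. Y i x)"
proof -
  have Y_meas [measurable]: "Y i \<in> borel_measurable M" for i using int by auto
  let ?v = "\<lambda>i. expectation (\<lambda>x. (Y i x)^2)"
  define B where "B m \<epsilon> = {x\<in>space M. \<exists>k. \<epsilon> \<le> \<bar>\<Sum>i<k. Y (m + i) x\<bar>}" for m and \<epsilon> :: real
  have B_meas [measurable]: "B m \<epsilon> \<in> sets M" for m \<epsilon> unfolding B_def by measurable
  have bound: "prob (B m \<epsilon>) \<le> (\<Sum>i. ?v (m + i)) / \<epsilon>^2" if "\<epsilon> > 0" for m \<epsilon>
  proof -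
    let ?C = "\<lambda>n. {x\<in>space M. \<exists>k\<le>n. \<epsilon> \<le> \<bar>\<Sum>i<k. Y (m + i) x\<bar>}"
    \<comment> \<open>Independence of the shifted family: group the variables into the one-element
      blocks \<open>{m + j}\<close> and read off the single coordinate.\<close>
    have ind': "indep_vars (\<lambda>_. borel) (\<lambda>i. Y (m + i)) UNIV"
    proof -
      have "indep_vars (\<lambda>j. \<Pi>\<^sub>M i\<in>{m + j}. borel) (\<lambda>j x. restrict (\<lambda>i. Y i x) {m + j}) UNIV"
        using ind by (rule indep_vars_restrict) (auto simp: disjoint_family_on_def)
      then have "indep_vars (\<lambda>_. borel) (\<lambda>j x. (\<lambda>y. y (m + j)) (restrict (\<lambda>i. Y i x) {m + j})) UNIV"
        by (rule indep_vars_compose2) (rule measurable_component_singleton, simp)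
      then show ?thesis by simp
    qed
    have summ': "summable (\<lambda>i. ?v (m + i))" using summ by (subst add.commute) (rule summable_ignore_initial_segment)
    have "prob (?C n) \<le> (\<Sum>i. ?v (m + i)) / \<epsilon>^2" for n
    proof -
      have "prob (?C n) \<le> (\<Sum>i<n. ?v (m + i)) / \<epsilon>^2"
        by (rule kolmogorov_maximal[OF ind' int mean sq that])
      also have "\<dots> \<le> (\<Sum>i. ?v (m + i)) / \<epsilon>^2"
        using summ' by (intro divide_right_mono sum_le_suminf) auto
      finally show ?thesis .
    qed
    moreover have "(\<lambda>n. prob (?C n)) \<longlonglongrightarrow> prob (\<Union>n. ?C n)"
    proof (rule finite_Lim_measure_incseq)
      show "range ?C \<subseteq> sets M" by auto
      show "incseq ?C" by (auto simp: incseq_def) (meson order_trans)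
    qed
    moreover have "(\<Union>n. ?C n) = B m \<epsilon>" unfolding B_def by auto
    ultimately show ?thesis by (auto intro: LIMSEQ_le_const2)
  qed
  have lim: "(\<lambda>m. (\<Sum>i. ?v (m + i)) / \<epsilon>^2) \<longlonglongrightarrow> 0" if "\<epsilon> > 0" for \<epsilon>
    using that suminf_exist_split2[OF summ] by (auto intro!: tendsto_eq_intros simp: add.commute)
  have "AE x in M. \<exists>m. x \<notin> B m (1 / Suc j)" for j
  proof -
    let ?N = "\<Inter>m. B m (1 / Suc j)"
    have N: "?N \<in> sets M" by auto
    have "prob ?N \<le> (\<Sum>i. ?v (m + i)) / (1 / Suc j)^2" for m
      using bound[of "1 / Suc j" m] finite_measure_mono[of ?N "B m (1 / Suc j)"] by force
    then have "prob ?N \<le> 0" by (intro LIMSEQ_le_const[OF lim[of "1 / Suc j"]]) auto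
    then have "prob ?N = 0" using measure_nonneg[of M ?N] by linarith
    then show ?thesis using N by (intro AE_I[of _ _ ?N]) (auto simp: emeasure_eq_measure)
  qed
  then have "AE x in M. \<forall>j. \<exists>m. x \<notin> B m (1 / Suc j)" by (simp add: AE_all_countable)
  then show ?thesis
  proof (rule AE_mp, intro AE_I2 impI)
    fix x assume x: "x \<in> space M" and *: "\<forall>j. \<exists>m. x \<notin> B m (1 / Suc j)"
    show "summable (\<lambda>i. Y i x)"
      unfolding summable_Cauchy
    proof safe
      fix e :: real assume "0 < e"
      then obtain j where j: "1 / Suc j < e / 2" using reals_Archimedean[of "e/2"] by (auto simp: inverse_eq_divide)
      from * obtain m where m: "x \<notin> B m (1 / Suc j)" by blast
      have d: "\<bar>\<Sum>i<k. Y (m + i) x\<bar> < e / 2" for k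
      proof -
        have "\<bar>\<Sum>i<k. Y (m + i) x\<bar> < 1 / Suc j" using m x unfolding B_def by (auto simp: not_le)
        then show ?thesis using j by linarith
      qed
      \<comment> \<open>A block from \<open>p\<close> to \<open>q\<close> is the difference of two
        sums that start at \<open>m\<close>, each below \<open>e / 2\<close>.\<close>
      have "norm (sum (\<lambda>i. Y i x) {p..<q}) < e" if "p \<ge> m" for p q
      proof (cases "p \<le> q")
        case True
        have "(\<Sum>i<k. Y (m + i) x) = sum (\<lambda>i. Y i x) {m..<m+k}" for k
          by (simp add: sum.atLeastLessThan_shift_0 atLeast0LessThan)
        from this[of "p - m"] this[of "q - m"] True that
        have "sum (\<lambda>i. Y i x) {p..<q} = (\<Sum>i<q-m. Y (m + i) x) - (\<Sum>i<p-m. Y (m + i) x)"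
          using sum.atLeastLessThan_concat[of m p q "\<lambda>i. Y i x"] by simp
        then show ?thesis using d[of "q - m"] d[of "p - m"] by (simp only: real_norm_def)
      qed (use \<open>0 < e\<close> in auto)
      then show "\<exists>N. \<forall>m\<ge>N. \<forall>n. norm (sum (\<lambda>i. Y i x) {m..<n}) < e" by blast
    qed
  qed
qed

end


section \<open>The generating functional of a Poisson process\<close>

text \<open>For factors in the unit interval the partial products decrease, so the infimum is their
  limit. It exists without any convergence hypothesis and is \<open>0\<close> for a product that
  diverges to zero.\<close>

definition inf_prod :: "(nat \<Rightarrow> real) \<Rightarrow> ennreal" where
  "inf_prod a = (INF n. ennreal (\<Prod>k<n. a k))"

lemma decseq_prod_unit:
  fixes a :: "nat \<Rightarrow> real"
  assumes "\<And>k. 0 \<le> a k" "\<And>k. a k \<le> 1"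
  shows "decseq (\<lambda>n. \<Prod>k<n. a k)"
  by (rule decseq_SucI) (use assms in \<open>auto intro!: mult_right_le_one_le prod_nonneg\<close>)

lemma inf_prod_LIMSEQ:
  assumes "\<And>k. 0 \<le> a k" "\<And>k. a k \<le> 1"
  shows "(\<lambda>n. ennreal (\<Prod>k<n. a k)) \<longlonglongrightarrow> inf_prod a"
  unfolding inf_prod_def
  by (rule LIMSEQ_INF) (use decseq_prod_unit[OF assms] in \<open>auto simp: decseq_def intro!: ennreal_leI\<close>)

lemma inf_prod_le_1: "inf_prod a \<le> 1"
  unfolding inf_prod_def by (rule INF_lower2[of 0]) auto

lemma inf_prod_eqI:
  assumes "\<And>k. 0 \<le> a k" "\<And>k. a k \<le> 1" "(\<lambda>n. \<Prod>k<n. a k) \<longlonglongrightarrow> c"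
  shows "inf_prod a = ennreal c"
  using inf_prod_LIMSEQ[OF assms(1,2)] tendsto_ennrealI[OF assms(3)] by (rule LIMSEQ_unique)

text \<open>Both the number of factors and the index \<open>i\<close> act monotonically, so the two
  limits are infima and may be interchanged.\<close>

lemma inf_prod_LIMSEQ_decseq:
  assumes "\<And>i k. 0 \<le> a i k" "\<And>i k. a i k \<le> 1" "\<And>k. decseq (\<lambda>i. a i k)" "\<And>k. (\<lambda>i. a i k) \<longlonglongrightarrow> b k"
  shows "(\<lambda>i. inf_prod (a i)) \<longlonglongrightarrow> inf_prod b"
proof -
  have dec: "decseq (\<lambda>i. ennreal (\<Prod>k<n. a i k))" for n
    using assms by (auto simp: decseq_def intro!: ennreal_leI prod_mono)
  have inner: "(INF i. ennreal (\<Prod>k<n. a i k)) = ennreal (\<Prod>k<n. b k)" for n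
    by (rule LIMSEQ_unique[OF LIMSEQ_INF[OF dec]]) (intro tendsto_ennrealI tendsto_prod assms)
  have "decseq (\<lambda>i. inf_prod (a i))"
    unfolding inf_prod_def decseq_def using dec by (auto simp: decseq_def intro!: INF_mono)
  then have "(\<lambda>i. inf_prod (a i)) \<longlonglongrightarrow> (INF i. inf_prod (a i))" by (rule LIMSEQ_INF)
  also have "(INF i. inf_prod (a i)) = inf_prod b"
    unfolding inf_prod_def by (subst INF_commute) (simp add: inner)
  finally show ?thesis .
qed

context prob_space begin

lemma poisson_pgf:
  assumes [measurable]: "N \<in> measurable M (count_space UNIV)"
    and P: "\<And>n. prob {w\<in>space M. N w = n} = exp (- \<mu>) * \<mu> ^ n / fact n"
    and "0 \<le> \<mu>" "0 \<le> v"
  shows "(\<integral>\<^sup>+w. ennreal (v ^ N w) \<partial>M) = ennreal (exp (- (\<mu> * (1 - v))))"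
proof -
  have "(\<integral>\<^sup>+w. ennreal (v ^ N w) \<partial>M) = (\<integral>\<^sup>+w. (\<Sum>n. ennreal (v ^ n) * indicator {w\<in>space M. N w = n} w) \<partial>M)"
  proof (rule nn_integral_cong)
    fix w assume w: "w \<in> space M"
    have "(\<Sum>n. ennreal (v ^ n) * indicator {w\<in>space M. N w = n} w) = (\<Sum>n\<in>{N w}. ennreal (v ^ n) * indicator {w\<in>space M. N w = n} w)"
      by (rule suminf_finite) auto
    then show "ennreal (v ^ N w) = (\<Sum>n. ennreal (v ^ n) * indicator {w\<in>space M. N w = n} w)" using w by simp
  qed
  also have "\<dots> = (\<Sum>n. \<integral>\<^sup>+w. ennreal (v ^ n) * indicator {w\<in>space M. N w = n} w \<partial>M)"
    by (rule nn_integral_suminf) measurable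
  also have "\<dots> = (\<Sum>n. ennreal (exp (- \<mu>) * ((\<mu> * v) ^ n /\<^sub>R fact n)))"
    using assms(3,4) by (intro suminf_cong, subst nn_integral_cmult_indicator)
      (auto simp: emeasure_eq_measure P ennreal_mult'[symmetric] power_mult_distrib divide_inverse mult_ac)
  also have "\<dots> = ennreal (exp (- \<mu>) * exp (\<mu> * v))"
    by (rule suminf_ennreal_eq) (use assms exp_converges[of "\<mu> * v"] in \<open>auto intro!: sums_mult mult_nonneg_nonneg\<close>)
  finally show ?thesis by (simp add: exp_add[symmetric] algebra_simps)
qed

text \<open>For a step function with value \<open>v j\<close> on \<open>B j\<close>, the product
  over all points regroups into the powers \<open>v j ^ ?N j w\<close> of the counts, which are
  independent Poisson variables. The sets form an infinite family because
  \<open>homogeneous_ppp\<close> states independence for such families; only the first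
  \<open>m\<close> carry a value.\<close>

lemma ppp_pgfl_step:
  fixes X :: "nat \<Rightarrow> 'a \<Rightarrow> 'b::euclidean_space"
  assumes ppp: "homogeneous_ppp X lam D" and lam: "0 \<le> lam"
    and B: "\<And>j::nat. B j \<in> sets borel" "\<And>j. bounded (B j)" and disj: "disjoint_family B"
    and v: "\<And>j. 0 \<le> v j" "\<And>j. v j \<le> 1"
  shows "(\<integral>\<^sup>+w. inf_prod (\<lambda>k. \<Prod>j<m. if X k w \<in> B j then v j else 1) \<partial>M) =
    ennreal (exp (- (lam * (\<Sum>j<m. measure lborel (B j \<inter> D) * (1 - v j)))))"
proof -
  let ?q = "\<lambda>w. inf_prod (\<lambda>k. \<Prod>j<m. if X k w \<in> B j then v j else 1)"
  let ?N = "\<lambda>j w. card {k. X k w \<in> B j}"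
  have ind: "indep_vars (\<lambda>_. count_space UNIV) ?N UNIV"
    using ppp B disj unfolding homogeneous_ppp_def by blast
  have N_meas: "?N j \<in> measurable M (count_space UNIV)" for j
    using ind unfolding indep_vars_def by auto
  have pgf: "(\<integral>\<^sup>+w. ennreal (v j ^ ?N j w) \<partial>M) = ennreal (exp (- (lam * measure lborel (B j \<inter> D) * (1 - v j))))" for j
    by (rule poisson_pgf[OF N_meas]) (use ppp B lam v in \<open>auto simp: homogeneous_ppp_def\<close>)
  have "AE w in M. \<forall>j. finite {k. X k w \<in> B j}"
    unfolding AE_all_countable using ppp B unfolding homogeneous_ppp_def by blast
  then have "AE w in M. ?q w = (\<Prod>j<m. ennreal (v j ^ ?N j w))"
  proof (rule AE_mp, intro AE_I2 impI)
    fix w assume fin: "\<forall>j. finite {k. X k w \<in> B j}"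
    have "(\<lambda>n. \<Prod>k<n. \<Prod>j<m. if X k w \<in> B j then v j else 1) \<longlonglongrightarrow> (\<Prod>j<m. v j ^ ?N j w)"
    proof (subst prod.swap, rule tendsto_prod)
      fix j
      obtain K where K: "\<And>k. X k w \<in> B j \<Longrightarrow> k < K"
        using fin finite_nat_set_iff_bounded[of "{k. X k w \<in> B j}"] by auto
      have "(\<Prod>k<n. if X k w \<in> B j then v j else 1) = v j ^ ?N j w" if "n \<ge> K" for n
      proof -
        have "{..<n} \<inter> {k. X k w \<in> B j} = {k. X k w \<in> B j}" using K that by force
        then show ?thesis by (simp add: prod.If_cases)
      qed
      then show "(\<lambda>n. \<Prod>k<n. if X k w \<in> B j then v j else 1) \<longlonglongrightarrow> v j ^ ?N j w"
        by (intro tendsto_eventually eventually_sequentiallyI[of K])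
    qed
    then show "?q w = (\<Prod>j<m. ennreal (v j ^ ?N j w))"
      by (subst inf_prod_eqI) (auto simp: prod_ennreal v intro!: prod_nonneg prod_le_1)
  qed
  then have "(\<integral>\<^sup>+w. ?q w \<partial>M) = (\<integral>\<^sup>+w. (\<Prod>j<m. ennreal (v j ^ ?N j w)) \<partial>M)"
    by (rule nn_integral_cong_AE)
  also have "\<dots> = (\<Prod>j<m. \<integral>\<^sup>+w. ennreal (v j ^ ?N j w) \<partial>M)"
  proof (rule indep_vars_nn_integral)
    show "indep_vars (\<lambda>_. borel) (\<lambda>j w. ennreal (v j ^ ?N j w)) {..<m}"
      by (rule indep_vars_compose2[OF indep_vars_subset[OF ind]]) auto
  qed auto
  also have "\<dots> = ennreal (\<Prod>j<m. exp (- (lam * measure lborel (B j \<inter> D) * (1 - v j))))"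
    by (simp add: pgf prod_ennreal)
  also have "(\<Prod>j<m. exp (- (lam * measure lborel (B j \<inter> D) * (1 - v j)))) = exp (- (lam * (\<Sum>j<m. measure lborel (B j \<inter> D) * (1 - v j))))"
    by (simp add: exp_sum[symmetric] sum_negf sum_distrib_left mult.assoc)
  finally show ?thesis .
qed

text \<open>The function \<open>1 - \<phi>\<close> is approximated from below by step functions with
  bounded support. Monotonicity moves the limit through the infinite product, and finiteness of the
  integral \<open>I\<close> gives convergence of the exponents.\<close>

lemma ppp_pgfl:
  fixes X :: "nat \<Rightarrow> 'a \<Rightarrow> 'b::euclidean_space"
  assumes ppp: "homogeneous_ppp X lam D" and lam: "0 \<le> lam" and D [measurable]: "D \<in> sets borel"
    and [measurable]: "\<phi> \<in> borel_measurable borel"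
    and \<phi>: "\<And>x. 0 \<le> \<phi> x" "\<And>x. \<phi> x \<le> 1"
    and I: "(\<integral>\<^sup>+x. ennreal (1 - \<phi> x) * indicator D x \<partial>lborel) = ennreal I" "0 \<le> I"
  shows "(\<integral>\<^sup>+w. inf_prod (\<lambda>k. \<phi> (X k w)) \<partial>M) = ennreal (exp (- (lam * I)))"
proof -
  have X_meas [measurable]: "X k \<in> borel_measurable M" for k using ppp by (simp add: homogeneous_ppp_def)
  define f where "f x = 1 - \<phi> x" for x
  have f01: "0 \<le> f x" "f x \<le> 1" for x using \<phi>[of x] by (auto simp: f_def)
  have [measurable]: "f \<in> borel_measurable borel" unfolding f_def by measurable
  \<comment> \<open>\<open>g i\<close> rounds \<open>f\<close> down to a multiple of
    \<open>1 / 2 ^ i\<close> and cuts it off at radius \<open>i\<close>; \<open>B i j\<close> is the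
    part of the ball where the rounded value is \<open>j / 2 ^ i\<close>. As
    \<open>f \<le> 1\<close>, the levels are \<open>0\<close> to \<open>2 ^ i\<close>, whence the
    bound \<open>2^i+1\<close> below. The value \<open>1\<close> of \<open>v i j\<close> beyond them
    keeps all values in the unit interval.\<close>
  define g where "g i x = (if norm x < real i then real_of_int \<lfloor>2 ^ i * f x\<rfloor> / 2 ^ i else 0)" for i :: nat and x
  define B where "B i j = {x. norm x < real i \<and> \<lfloor>2 ^ i * f x\<rfloor> = int j}" for i j :: nat
  define v where "v i j = (if j \<le> 2 ^ i then 1 - real j / 2 ^ i else 1)" for i j :: nat
  have [measurable]: "g i \<in> borel_measurable borel" for i unfolding g_def by measurable
  have B_meas [measurable]: "B i j \<in> sets borel" for i j unfolding B_def by measurable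
  have B_bdd: "bounded (B i j)" for i j by (rule bounded_subset[of "ball 0 (real i)"]) (auto simp: B_def)
  have B_disj: "disjoint_family (B i)" for i by (auto simp: disjoint_family_on_def B_def)
  have v01: "0 \<le> v i j" "v i j \<le> 1" for i j
    by (auto simp: v_def)
  have in_B: "\<exists>j\<le>2 ^ i. x \<in> B i j \<and> g i x = real j / 2 ^ i" if "norm x < real i" for i x
  proof -
    have "0 \<le> \<lfloor>2 ^ i * f x\<rfloor>" using f01[of x] by simp
    then obtain j where j: "\<lfloor>2 ^ i * f x\<rfloor> = int j" using nonneg_int_cases by metis
    have "2 ^ i * f x \<le> 2 ^ i" using f01[of x] by (simp add: mult_left_le)
    then have "\<lfloor>2 ^ i * f x\<rfloor> \<le> \<lfloor>2 ^ i :: real\<rfloor>" by (rule floor_mono)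
    also have "\<lfloor>2 ^ i :: real\<rfloor> = 2 ^ i" by (metis floor_of_int of_int_numeral of_int_power)
    finally have "\<lfloor>2 ^ i * f x\<rfloor> \<le> 2 ^ i" .
    then have "j \<le> 2 ^ i" using j by (metis of_nat_le_iff of_nat_numeral of_nat_power)
    with j that show ?thesis by (auto simp: B_def g_def)
  qed
  have notin_B: "x \<notin> B i j" "g i x = 0" if "\<not> norm x < real i" for i j x
    using that by (auto simp: B_def g_def)
  have uniq: "x \<in> B i j' \<longleftrightarrow> j' = j" if "x \<in> B i j" for x i j j' using that by (auto simp: B_def)
  have step: "(\<Prod>j<2^i+1. if x \<in> B i j then v i j else 1) = 1 - g i x" for i x
  proof (cases "norm x < real i")
    case True
    from in_B[OF this] obtain j where j: "j \<le> 2 ^ i" "x \<in> B i j" "g i x = real j / 2 ^ i" by blast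
    have "(\<Prod>j'<2^i+1. if x \<in> B i j' then v i j' else 1) = (\<Prod>j'<2^i+1. if j' = j then v i j' else 1)"
      by (simp add: uniq[OF j(2)])
    also have "\<dots> = v i j" using j(1) by (simp add: prod.delta)
    finally show ?thesis using j by (simp add: v_def)
  qed (simp add: notin_B)
  define J where "J i = (\<Sum>j<2^i+1. measure lborel (B i j \<inter> D) * (1 - v i j))" for i
  have int_g: "(\<integral>\<^sup>+x. ennreal (g i x) * indicator D x \<partial>lborel) = ennreal (J i)" for i
  proof -
    have fin: "emeasure lborel (B i j \<inter> D) < \<infinity>" for j
      by (rule emeasure_bounded_finite) (rule bounded_subset[OF B_bdd[of i j]], auto)
    have "(\<integral>\<^sup>+x. ennreal (g i x) * indicator D x \<partial>lborel) =
      (\<integral>\<^sup>+x. (\<Sum>j<2^i+1. ennreal (1 - v i j) * indicator (B i j \<inter> D) x) \<partial>lborel)"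
    proof (rule nn_integral_cong)
      fix x
      show "ennreal (g i x) * indicator D x = (\<Sum>j<2^i+1. ennreal (1 - v i j) * indicator (B i j \<inter> D) x)"
      proof (cases "norm x < real i")
        case True
        from in_B[OF this] obtain j where j: "j \<le> 2 ^ i" "x \<in> B i j" "g i x = real j / 2 ^ i" by blast
        have "(\<Sum>j'<2^i+1. ennreal (1 - v i j') * indicator (B i j' \<inter> D) x) = (\<Sum>j'<2^i+1. if j' = j then ennreal (1 - v i j) * indicator D x else 0)"
          by (intro sum.cong) (auto simp: indicator_def uniq[OF j(2)])
        also have "\<dots> = ennreal (1 - v i j) * indicator D x" using j(1) by (simp add: sum.delta)
        finally show ?thesis using j by (simp add: v_def)
      qed (simp add: notin_B)
    qed
    also have "\<dots> = (\<Sum>j<2^i+1. ennreal (1 - v i j) * emeasure lborel (B i j \<inter> D))"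
      by (subst nn_integral_sum) (auto simp del: sum.lessThan_Suc simp: nn_integral_cmult_indicator)
    also have "\<dots> = (\<Sum>j<2^i+1. ennreal (measure lborel (B i j \<inter> D) * (1 - v i j)))"
      using fin v01 by (intro sum.cong refl) (simp add: emeasure_eq_ennreal_measure less_top ennreal_mult mult.commute)
    also have "\<dots> = ennreal (J i)"
      unfolding J_def using v01 by (intro sum_ennreal) simp
    finally show ?thesis .
  qed
  have J_nonneg: "0 \<le> J i" for i unfolding J_def using v01 by (intro sum_nonneg) simp
  have E: "(\<integral>\<^sup>+w. inf_prod (\<lambda>k. 1 - g i (X k w)) \<partial>M) = ennreal (exp (- (lam * J i)))" for i
    using ppp_pgfl_step[OF ppp lam, where B="B i" and v="v i" and m="2^i+1", OF B_meas B_bdd B_disj v01]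
    unfolding step J_def .
  have g01: "0 \<le> g i x" "g i x \<le> f x" for i x
    using f01[of x] by (auto simp: g_def field_simps) 
  have g_inc: "incseq (\<lambda>i. g i x)" for x
  proof (rule incseq_SucI)
    fix i
    have "2 * \<lfloor>2 ^ i * f x\<rfloor> \<le> \<lfloor>2 ^ Suc i * f x\<rfloor>"
      unfolding le_floor_iff using of_int_floor_le[of "2 ^ i * f x"] by (simp add: mult.assoc)
    then have "2 * real_of_int \<lfloor>2 ^ i * f x\<rfloor> \<le> real_of_int \<lfloor>2 ^ Suc i * f x\<rfloor>" by linarith
    then have "real_of_int \<lfloor>2 ^ i * f x\<rfloor> / 2 ^ i \<le> real_of_int \<lfloor>2 ^ Suc i * f x\<rfloor> / 2 ^ Suc i"
      by (simp add: field_simps)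
    then show "g i x \<le> g (Suc i) x" using f01[of x] by (auto simp: g_def)
  qed
  have g_lim: "(\<lambda>i. g i x) \<longlonglongrightarrow> f x" for x
  proof (rule tendsto_sandwich)
    show "\<forall>\<^sub>F i in sequentially. f x - (1/2) ^ i \<le> g i x"
    proof (rule eventually_sequentiallyI)
      fix i assume "nat \<lceil>norm x + 1\<rceil> \<le> i"
      then have "norm x < real i" by linarith
      moreover have "2 ^ i * f x - 1 \<le> real_of_int \<lfloor>2 ^ i * f x\<rfloor>" by linarith
      then have "(2 ^ i * f x - 1) / 2 ^ i \<le> real_of_int \<lfloor>2 ^ i * f x\<rfloor> / 2 ^ i" by (rule divide_right_mono) simp
      ultimately show "f x - (1/2) ^ i \<le> g i x" by (simp add: g_def diff_divide_distrib power_one_over)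
    qed
    have "(\<lambda>i. f x - (1/2) ^ i) \<longlonglongrightarrow> f x - 0" by (intro tendsto_intros) auto
    then show "(\<lambda>i. f x - (1/2) ^ i) \<longlonglongrightarrow> f x" by simp
    show "\<forall>\<^sub>F i in sequentially. g i x \<le> f x" using g01 by simp
  qed auto
  let ?Q = "\<integral>\<^sup>+w. inf_prod (\<lambda>k. \<phi> (X k w)) \<partial>M"
  have "(\<lambda>i. \<integral>\<^sup>+w. inf_prod (\<lambda>k. 1 - g i (X k w)) \<partial>M) \<longlonglongrightarrow> ?Q"
  proof (rule nn_integral_dominated_convergence[where w="\<lambda>_. 1"])
    show "AE w in M. (\<lambda>i. inf_prod (\<lambda>k. 1 - g i (X k w))) \<longlonglongrightarrow> inf_prod (\<lambda>k. \<phi> (X k w))"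
    proof (intro AE_I2 inf_prod_LIMSEQ_decseq)
      fix w and i k
      show "0 \<le> 1 - g i (X k w)" "1 - g i (X k w) \<le> 1" using g01[of i "X k w"] f01[of "X k w"] by auto
      show "decseq (\<lambda>i. 1 - g i (X k w))" using g_inc[of "X k w"] by (auto simp: incseq_def decseq_def)
      have "(\<lambda>i. 1 - g i (X k w)) \<longlonglongrightarrow> 1 - f (X k w)" by (intro tendsto_intros g_lim)
      then show "(\<lambda>i. 1 - g i (X k w)) \<longlonglongrightarrow> \<phi> (X k w)" by (simp add: f_def)
    qed
  qed (auto simp: inf_prod_le_1 emeasure_space_1, auto simp: inf_prod_def)
  then have 1: "(\<lambda>i. ennreal (exp (- (lam * J i)))) \<longlonglongrightarrow> ?Q" unfolding E .
  have "(\<lambda>i. \<integral>\<^sup>+x. ennreal (g i x) * indicator D x \<partial>lborel) \<longlonglongrightarrow> (\<integral>\<^sup>+x. ennreal (f x) * indicator D x \<partial>lborel)"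
    by (rule nn_integral_dominated_convergence[where w="\<lambda>x. ennreal (f x) * indicator D x"])
       (use I g01 g_lim in \<open>auto intro!: tendsto_ennrealI ennreal_leI simp: f_def indicator_def\<close>)
  then have "(\<lambda>i. ennreal (J i)) \<longlonglongrightarrow> ennreal I" using I by (simp add: int_g J_def f_def)
  then have "J \<longlonglongrightarrow> I" using J_nonneg I by simp
  then have "(\<lambda>i. ennreal (exp (- (lam * J i)))) \<longlonglongrightarrow> ennreal (exp (- (lam * I)))"
    by (intro tendsto_ennrealI tendsto_intros)
  then show ?thesis using 1 LIMSEQ_unique by blast
qed

end


section \<open>Complex Gaussian measures\<close>

text \<open>The planar density of a circular Gaussian with total variance \<open>v\<close>. Each
  coordinate has variance \<open>v / 2\<close>, so no factor \<open>2\<close> appears in the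
  exponent.\<close>

abbreviation (input) gauss_density :: "real \<Rightarrow> real \<Rightarrow> real \<Rightarrow> real" where
  "gauss_density v x y \<equiv> 1 / (pi * v) * exp (- ((x^2 + y^2) / v))"

lemma measurable_Complex [measurable (raw)]:
  assumes [measurable]: "f \<in> borel_measurable M" "g \<in> borel_measurable M"
  shows "(\<lambda>x. Complex (f x) (g x)) \<in> borel_measurable M"
  unfolding Complex_eq by measurable

text \<open>Indexed by the variance of the complex variable of which it is one coordinate, hence the
  \<open>v / 2\<close>.\<close>

definition rgauss :: "real \<Rightarrow> real measure" where
  "rgauss v = density lborel (\<lambda>x. ennreal (normal_density 0 (sqrt (v / 2)) x))"

definition cgauss :: "real \<Rightarrow> complex measure" where
  "cgauss v = distr (rgauss v \<Otimes>\<^sub>M rgauss v) borel (\<lambda>p. Complex (fst p) (snd p))"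

lemma sets_rgauss [simp, measurable_cong]: "sets (rgauss v) = sets borel"
  by (simp add: rgauss_def)

lemma space_rgauss [simp]: "space (rgauss v) = UNIV"
  by (simp add: rgauss_def)

lemma sets_cgauss [simp, measurable_cong]: "sets (cgauss v) = sets borel"
  by (simp add: cgauss_def)

lemma space_cgauss [simp]: "space (cgauss v) = UNIV"
  by (simp add: cgauss_def)

lemma prob_space_rgauss: "0 < v \<Longrightarrow> prob_space (rgauss v)"
  unfolding rgauss_def by (rule prob_space_normal_density) simp

lemma prob_space_cgauss:
  assumes "0 < v" shows "prob_space (cgauss v)"
proof -
  interpret G: prob_space "rgauss v" using assms by (rule prob_space_rgauss)
  interpret P: pair_prob_space "rgauss v" "rgauss v" ..
  show ?thesis unfolding cgauss_def by (rule P.prob_space_distr) measurable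
qed

lemma nn_integral_cgauss:
  assumes "0 < v" and [measurable]: "f \<in> borel_measurable borel"
  shows "(\<integral>\<^sup>+z. f z \<partial>cgauss v) = (\<integral>\<^sup>+x. \<integral>\<^sup>+y. f (Complex x y) \<partial>rgauss v \<partial>rgauss v)"
proof -
  interpret G: prob_space "rgauss v" using assms(1) by (rule prob_space_rgauss)
  interpret P: pair_prob_space "rgauss v" "rgauss v" ..
  show ?thesis
    unfolding cgauss_def by (subst nn_integral_distr) (auto simp: G.nn_integral_fst[symmetric])
qed

lemma nn_integral_cgauss_density:
  assumes v: "0 < v" and [measurable]: "f \<in> borel_measurable borel"
  shows "(\<integral>\<^sup>+z. f z \<partial>cgauss v) =
    (\<integral>\<^sup>+x. \<integral>\<^sup>+y. ennreal (gauss_density v x y) * f (Complex x y) \<partial>lborel \<partial>lborel)"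
proof -
  have dens: "normal_density 0 (sqrt (v / 2)) x * normal_density 0 (sqrt (v / 2)) y = gauss_density v x y" for x y
    using v by (simp add: normal_density_def exp_add[symmetric] add_divide_distrib)
  have "(\<integral>\<^sup>+z. f z \<partial>cgauss v) =
    (\<integral>\<^sup>+x. ennreal (normal_density 0 (sqrt (v / 2)) x) * (\<integral>\<^sup>+y. ennreal (normal_density 0 (sqrt (v / 2)) y) * f (Complex x y) \<partial>lborel) \<partial>lborel)"
    unfolding nn_integral_cgauss[OF assms] unfolding rgauss_def
    by (subst nn_integral_density; (simp add: nn_integral_density)?)
  also have "\<dots> = (\<integral>\<^sup>+x. \<integral>\<^sup>+y. ennreal (normal_density 0 (sqrt (v / 2)) x) * (ennreal (normal_density 0 (sqrt (v / 2)) y) * f (Complex x y)) \<partial>lborel \<partial>lborel)"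
    by (intro nn_integral_cong nn_integral_cmult[symmetric]) measurable
  also have "\<dots> = (\<integral>\<^sup>+x. \<integral>\<^sup>+y. ennreal (gauss_density v x y) * f (Complex x y) \<partial>lborel \<partial>lborel)"
    unfolding dens[symmetric] by (simp add: ennreal_mult mult.assoc)
  finally show ?thesis .
qed

text \<open>Multiplication by \<open>p + i q\<close> has Jacobian \<open>p^2 + q^2\<close>. Fubini
  splits it into one-dimensional affine substitutions, the first of which divides by
  \<open>p\<close>; a purely imaginary factor, a scaled quarter turn, is therefore treated on its
  own.\<close>

lemma nn_integral_complex_rotation:
  fixes g :: "real \<times> real \<Rightarrow> ennreal"
  assumes [measurable]: "g \<in> borel_measurable (borel \<Otimes>\<^sub>M borel)" and pq: "p \<noteq> 0 \<or> q \<noteq> 0"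
  shows "(\<integral>\<^sup>+x. \<integral>\<^sup>+y. g (p * x - q * y, q * x + p * y) \<partial>lborel \<partial>lborel) =
    ennreal (1 / (p^2 + q^2)) * (\<integral>\<^sup>+u. \<integral>\<^sup>+w. g (u, w) \<partial>lborel \<partial>lborel)"
proof (cases "p = 0")
  let ?G = "(\<integral>\<^sup>+x. \<integral>\<^sup>+y. g (p * x - q * y, q * x + p * y) \<partial>lborel \<partial>lborel)"
  case True
  with pq have q: "q \<noteq> 0" by simp
  let ?H = "\<lambda>x. \<integral>\<^sup>+u. g (u, q * x) \<partial>lborel"
  have "?G = (\<integral>\<^sup>+x. \<integral>\<^sup>+y. g (- q * y, q * x) \<partial>lborel \<partial>lborel)"
    using True by simp
  also have "\<dots> = (\<integral>\<^sup>+x. ennreal (1 / \<bar>q\<bar>) * ?H x \<partial>lborel)"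
    using q by (intro nn_integral_cong, subst nn_integral_real_affine[where c="- 1 / q" and t=0]) auto
  also have "\<dots> = ennreal (1 / \<bar>q\<bar>) * (\<integral>\<^sup>+x. ?H x \<partial>lborel)"
    by (rule nn_integral_cmult) measurable
  also have "(\<integral>\<^sup>+x. ?H x \<partial>lborel) = ennreal (1 / \<bar>q\<bar>) * (\<integral>\<^sup>+w. (\<integral>\<^sup>+u. g (u, w) \<partial>lborel) \<partial>lborel)"
    using q by (subst nn_integral_real_affine[where c="1 / q" and t=0]) auto
  also have "(\<integral>\<^sup>+w. (\<integral>\<^sup>+u. g (u, w) \<partial>lborel) \<partial>lborel) = (\<integral>\<^sup>+u. (\<integral>\<^sup>+w. g (u, w) \<partial>lborel) \<partial>lborel)"
    by (rule lborel_pair.Fubini') measurable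
  finally show ?thesis
    using True by (simp add: mult.assoc[symmetric] ennreal_mult'[symmetric] power2_eq_square)
next
  case False
  let ?G = "(\<integral>\<^sup>+x. \<integral>\<^sup>+y. g (p * x - q * y, q * x + p * y) \<partial>lborel \<partial>lborel)"
  let ?I = "\<lambda>y. \<integral>\<^sup>+u. g (u, q / p * u + (p^2 + q^2) / p * y) \<partial>lborel"
  let ?N = "p^2 + q^2"
  have N: "0 < ?N" using False by (simp add: sum_power2_gt_zero_iff)
  have "?G = (\<integral>\<^sup>+y. \<integral>\<^sup>+x. g (p * x - q * y, q * x + p * y) \<partial>lborel \<partial>lborel)"
    by (rule lborel_pair.Fubini'[symmetric]) measurable
  also have "\<dots> = (\<integral>\<^sup>+y. ennreal (1 / \<bar>p\<bar>) * ?I y \<partial>lborel)"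
  proof (rule nn_integral_cong)
    fix y
    have eq: "p * (q * y / p + 1 / p * u) - q * y = u" "q * (q * y / p + 1 / p * u) + p * y = (q / p) * u + (?N / p) * y" for u
      using False by (simp_all add: field_simps power2_eq_square)
    show "(\<integral>\<^sup>+x. g (p * x - q * y, q * x + p * y) \<partial>lborel) = ennreal (1 / \<bar>p\<bar>) * ?I y"
      using False by (subst nn_integral_real_affine[where c="1 / p" and t="q * y / p"]) (simp_all only: eq, auto)
  qed
  also have "\<dots> = ennreal (1 / \<bar>p\<bar>) * (\<integral>\<^sup>+y. ?I y \<partial>lborel)"
    by (rule nn_integral_cmult) measurable
  also have "(\<integral>\<^sup>+y. ?I y \<partial>lborel) = (\<integral>\<^sup>+u. (\<integral>\<^sup>+y. g (u, (q / p) * u + (?N / p) * y) \<partial>lborel) \<partial>lborel)"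
    by (rule lborel_pair.Fubini') measurable
  also have "\<dots> = (\<integral>\<^sup>+u. ennreal (\<bar>p\<bar> / ?N) * (\<integral>\<^sup>+w. g (u, w) \<partial>lborel) \<partial>lborel)"
  proof (rule nn_integral_cong)
    fix u
    have "?N / p * (p / ?N * w) = w" "?N / p * (- (q / ?N * u)) = - (q / p * u)" for w
      using False N by simp_all
    then have eq: "(q / p) * u + (?N / p) * (- (q / ?N * u) + p / ?N * w) = w" for w
      by (simp only: distrib_left)
    have abs: "\<bar>p / ?N\<bar> = \<bar>p\<bar> / ?N" using N by (simp add: abs_divide)
    show "(\<integral>\<^sup>+y. g (u, (q / p) * u + (?N / p) * y) \<partial>lborel) = ennreal (\<bar>p\<bar> / ?N) * (\<integral>\<^sup>+w. g (u, w) \<partial>lborel)"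
      using False N by (subst nn_integral_real_affine[where c="p / ?N" and t="- (q / ?N * u)"]) (simp_all only: eq abs, auto)
  qed
  also have "\<dots> = ennreal (\<bar>p\<bar> / ?N) * (\<integral>\<^sup>+u. \<integral>\<^sup>+w. g (u, w) \<partial>lborel \<partial>lborel)"
    by (rule nn_integral_cmult) measurable
  finally show ?thesis
    using False by (simp add: mult.assoc[symmetric] ennreal_mult'[symmetric])
qed

text \<open>The density depends on the modulus alone, which multiplication by \<open>a\<close>
  scales by \<open>cmod a\<close>; the Jacobian supplies the change in the normalising
  factor.\<close>

lemma cgauss_mult:
  assumes v: "0 < v" and a: "a \<noteq> 0"
  shows "distr (cgauss v) borel (\<lambda>z. a * z) = cgauss ((cmod a)^2 * v)"
proof (rule measure_eqI)
  fix A assume "A \<in> sets (distr (cgauss v) borel (\<lambda>z. a * z))"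
  then have [measurable]: "A \<in> sets borel" by simp
  let ?N = "(cmod a)^2"
  have N: "0 < ?N" using a by simp
  have N_eq: "?N = (Re a)^2 + (Im a)^2" by (simp add: cmod_power2)
  have nz: "Re a \<noteq> 0 \<or> Im a \<noteq> 0" using a by (simp add: complex_eq_iff)
  define g where "g p = ennreal (1 / (pi * v) * exp (- (((fst p)^2 + (snd p)^2) / (?N * v)))) * indicator A (Complex (fst p) (snd p))" for p :: "real \<times> real"
  have [measurable]: "g \<in> borel_measurable (borel \<Otimes>\<^sub>M borel)" unfolding g_def by measurable
  have sq: "(Re a * x - Im a * y)^2 + (Im a * x + Re a * y)^2 = ?N * (x^2 + y^2)" for x y
    unfolding N_eq by (simp add: power2_eq_square algebra_simps)
  have "emeasure (distr (cgauss v) borel (\<lambda>z. a * z)) A = (\<integral>\<^sup>+z. indicator A (a * z) \<partial>cgauss v)"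
    by (subst nn_integral_indicator[symmetric], simp, subst nn_integral_distr) auto
  also have "\<dots> = (\<integral>\<^sup>+x. \<integral>\<^sup>+y. ennreal (gauss_density v x y) * indicator A (a * Complex x y) \<partial>lborel \<partial>lborel)"
    by (rule nn_integral_cgauss_density[OF v]) measurable
  also have "\<dots> = (\<integral>\<^sup>+x. \<integral>\<^sup>+y. g (Re a * x - Im a * y, Im a * x + Re a * y) \<partial>lborel \<partial>lborel)"
  proof (intro nn_integral_cong)
    fix x y
    have "- (?N * (x^2 + y^2) / (?N * v)) = - ((x^2 + y^2) / v)" using N by simp
    moreover have "a * Complex x y = Complex (Re a * x - Im a * y) (Im a * x + Re a * y)"
      by (simp add: complex_eq_iff)
    ultimately show "ennreal (gauss_density v x y) * indicator A (a * Complex x y) =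
      g (Re a * x - Im a * y, Im a * x + Re a * y)"
      unfolding g_def fst_conv snd_conv sq by (simp only:)
  qed
  also have "\<dots> = ennreal (1 / ?N) * (\<integral>\<^sup>+u. \<integral>\<^sup>+w. g (u, w) \<partial>lborel \<partial>lborel)"
    unfolding N_eq by (rule nn_integral_complex_rotation[OF _ nz]) measurable
  also have "\<dots> = (\<integral>\<^sup>+u. \<integral>\<^sup>+w. ennreal (1 / ?N) * g (u, w) \<partial>lborel \<partial>lborel)"
    by (simp add: nn_integral_cmult)
  also have "\<dots> = (\<integral>\<^sup>+u. \<integral>\<^sup>+w. ennreal (gauss_density (?N * v) u w) * indicator A (Complex u w) \<partial>lborel \<partial>lborel)"
  proof (intro nn_integral_cong)
    fix u w
    have "gauss_density (?N * v) u w = 1 / ?N * (1 / (pi * v) * exp (- ((u^2 + w^2) / (?N * v))))"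
      by simp
    then have "ennreal (gauss_density (?N * v) u w) = ennreal (1 / ?N) * ennreal (1 / (pi * v) * exp (- ((u^2 + w^2) / (?N * v))))"
      by (simp only:) (rule ennreal_mult', simp)
    then show "ennreal (1 / ?N) * g (u, w) = ennreal (gauss_density (?N * v) u w) * indicator A (Complex u w)"
      by (simp only: g_def fst_conv snd_conv mult.assoc)
  qed
  also have "\<dots> = (\<integral>\<^sup>+z. indicator A z \<partial>cgauss (?N * v))"
    using N v by (intro nn_integral_cgauss_density[symmetric]) auto
  finally show "emeasure (distr (cgauss v) borel (\<lambda>z. a * z)) A = emeasure (cgauss (?N * v)) A" by simp
qed simp

lemma rgauss_convolution:
  assumes "0 < v" "0 < w"
  shows "rgauss v \<star> rgauss w = rgauss (v + w)"
proof -
  have "rgauss v \<star> rgauss w = density lborel (\<lambda>x. \<integral>\<^sup>+y. ennreal (normal_density 0 (sqrt (v/2)) (x - y)) * ennreal (normal_density 0 (sqrt (w/2)) y) \<partial>lborel)"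
    unfolding rgauss_def
    by (rule convolution_density)
       (use prob_space_rgauss assms in \<open>auto simp: rgauss_def prob_space_def\<close>)
  also have "\<dots> = density lborel (\<lambda>x. \<integral>\<^sup>+y. ennreal (normal_density 0 (sqrt (v/2)) (x - y) * normal_density 0 (sqrt (w/2)) y) \<partial>lborel)"
    by (simp add: ennreal_mult)
  also have "\<dots> = rgauss (v + w)"
    using assms by (subst conv_normal_density_zero_mean) (auto simp: rgauss_def add_divide_distrib)
  finally show ?thesis .
qed

lemma nn_integral_cgauss_add:
  assumes v: "0 < v" and w: "0 < w" and [measurable]: "f \<in> borel_measurable borel"
  shows "(\<integral>\<^sup>+z. \<integral>\<^sup>+z'. f (z + z') \<partial>cgauss w \<partial>cgauss v) = (\<integral>\<^sup>+z. f z \<partial>cgauss (v + w))"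
proof -
  interpret V: prob_space "rgauss v" using v by (rule prob_space_rgauss)
  interpret W: prob_space "rgauss w" using w by (rule prob_space_rgauss)
  interpret VW: pair_prob_space "rgauss v" "rgauss w" ..
  interpret CW: prob_space "cgauss w" using w by (rule prob_space_cgauss)
  have conv: "(\<integral>\<^sup>+x. \<integral>\<^sup>+y. h (x + y) \<partial>rgauss w \<partial>rgauss v) = (\<integral>\<^sup>+x. h x \<partial>rgauss (v + w))"
    if "h \<in> borel_measurable borel" for h
    using that by (subst rgauss_convolution[OF v w, symmetric], subst nn_integral_convolution)
      (auto simp: V.finite_measure_axioms W.finite_measure_axioms)
  have "(\<integral>\<^sup>+z. \<integral>\<^sup>+z'. f (z + z') \<partial>cgauss w \<partial>cgauss v) =
    (\<integral>\<^sup>+x. \<integral>\<^sup>+y. \<integral>\<^sup>+x'. \<integral>\<^sup>+y'. f (Complex (x + x') (y + y')) \<partial>rgauss w \<partial>rgauss w \<partial>rgauss v \<partial>rgauss v)"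
    by (subst nn_integral_cgauss[OF v]) (auto simp: nn_integral_cgauss[OF w] simp flip: complex_add)
  also have "\<dots> = (\<integral>\<^sup>+x. \<integral>\<^sup>+x'. \<integral>\<^sup>+y. \<integral>\<^sup>+y'. f (Complex (x + x') (y + y')) \<partial>rgauss w \<partial>rgauss v \<partial>rgauss w \<partial>rgauss v)"
    by (intro nn_integral_cong VW.Fubini'[symmetric]) measurable
  also have "\<dots> = (\<integral>\<^sup>+x. \<integral>\<^sup>+x'. \<integral>\<^sup>+y. f (Complex (x + x') y) \<partial>rgauss (v + w) \<partial>rgauss w \<partial>rgauss v)"
    by (intro nn_integral_cong conv) measurable
  also have "\<dots> = (\<integral>\<^sup>+x. \<integral>\<^sup>+y. f (Complex x y) \<partial>rgauss (v + w) \<partial>rgauss (v + w))"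
  proof -
    interpret S: prob_space "rgauss (v + w)" using v w by (intro prob_space_rgauss) simp
    show ?thesis by (rule conv) measurable
  qed
  also have "\<dots> = (\<integral>\<^sup>+z. f z \<partial>cgauss (v + w))"
    using v w by (intro nn_integral_cgauss[symmetric]) auto
  finally show ?thesis .
qed

text \<open>The exponential factor grows with the variance, so only the normalising factors cost
  \<open>b / a\<close>. This serves as the limit theorem for Gaussian laws: the constant tends to
  \<open>1\<close> when \<open>a\<close> tends to \<open>b\<close>.\<close>

lemma emeasure_cgauss_le:
  assumes a: "0 < a" "a \<le> b" and [measurable]: "B \<in> sets borel"
  shows "emeasure (cgauss a) B \<le> ennreal (b / a) * emeasure (cgauss b) B"
proof -
  have b: "0 < b" using a by simp
  have "emeasure (cgauss a) B = (\<integral>\<^sup>+z. indicator B z \<partial>cgauss a)" by simp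
  also have "\<dots> = (\<integral>\<^sup>+x. \<integral>\<^sup>+y. ennreal (gauss_density a x y) * indicator B (Complex x y) \<partial>lborel \<partial>lborel)"
    by (rule nn_integral_cgauss_density[OF a(1)]) simp
  also have "\<dots> \<le> (\<integral>\<^sup>+x. \<integral>\<^sup>+y. ennreal (b / a) * (ennreal (gauss_density b x y) * indicator B (Complex x y)) \<partial>lborel \<partial>lborel)"
  proof (intro nn_integral_mono)
    fix x y :: real
    have "(x^2 + y^2) / b \<le> (x^2 + y^2) / a" using a b by (intro divide_left_mono) auto
    then have "gauss_density a x y \<le> b / a * (gauss_density b x y)"
      using a b by (simp add: divide_right_mono mult.commute)
    then show "ennreal (gauss_density a x y) * indicator B (Complex x y)
        \<le> ennreal (b / a) * (ennreal (gauss_density b x y) * indicator B (Complex x y))"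
      using a b by (auto simp: indicator_def ennreal_mult'[symmetric] intro!: ennreal_leI)
  qed
  also have "\<dots> = ennreal (b / a) * (\<integral>\<^sup>+z. indicator B z \<partial>cgauss b)"
    by (subst nn_integral_cgauss_density[OF b], simp, simp add: nn_integral_cmult)
  finally show ?thesis by simp
qed

lemma emeasure_cgauss_Times:
  assumes v: "0 < v" and [measurable]: "A \<in> sets borel" "B \<in> sets borel"
  shows "emeasure (cgauss v) {z. Re z \<in> A \<and> Im z \<in> B} = emeasure (rgauss v) A * emeasure (rgauss v) B"
proof -
  interpret G: prob_space "rgauss v" using v by (rule prob_space_rgauss)
  have "emeasure (cgauss v) {z. Re z \<in> A \<and> Im z \<in> B} = emeasure (rgauss v \<Otimes>\<^sub>M rgauss v) (A \<times> B)"
    unfolding cgauss_def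
    by (subst emeasure_distr) (auto simp: space_pair_measure intro!: arg_cong[where f="emeasure _"])
  then show ?thesis by (simp add: G.emeasure_pair_measure_Times)
qed

text \<open>The squared modulus is exponentially distributed with mean \<open>v\<close>, since in
  the plane the area element is uniform in the squared radius.\<close>

lemma emeasure_cgauss_tail:
  assumes v: "0 < v" and t: "0 \<le> t"
  shows "emeasure (cgauss v) {z. t < (cmod z)^2} = ennreal (exp (- (t / v)))"
proof -
  define F where "F u = ennreal (1 / (pi * v) * exp (- (u / v))) * indicator {t<..} u" for u
  have [measurable]: "F \<in> borel_measurable borel" unfolding F_def by measurable
  have "emeasure (cgauss v) {z. t < (cmod z)^2} = (\<integral>\<^sup>+z. indicator {z. t < (cmod z)^2} z \<partial>cgauss v)" by simp
  also have "\<dots> = (\<integral>\<^sup>+x. \<integral>\<^sup>+y. ennreal (gauss_density v x y) * indicator {z. t < (cmod z)^2} (Complex x y) \<partial>lborel \<partial>lborel)"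
    by (rule nn_integral_cgauss_density[OF v]) measurable
  also have "\<dots> = (\<integral>\<^sup>+x. \<integral>\<^sup>+y. F ((norm (x :: real, y :: real))^2) \<partial>lborel \<partial>lborel)"
    by (intro nn_integral_cong) (simp add: F_def norm_prod_def cmod_power2 indicator_def)
  also have "\<dots> = (\<integral>\<^sup>+p. F ((norm (p :: real \<times> real))^2) \<partial>(lborel \<Otimes>\<^sub>M lborel))"
    by (rule lborel.nn_integral_fst) (simp add: lborel_prod)
  also have "\<dots> = ennreal pi * (\<integral>\<^sup>+u. F u * indicator {0..} u \<partial>lborel)"
    unfolding lborel_prod by (rule nn_integral_norm_square) auto
  also have "(\<integral>\<^sup>+u. F u * indicator {0..} u \<partial>lborel) = (\<integral>\<^sup>+u. ennreal (1 / (pi * v) * exp (- (u / v))) * indicator {t..} u \<partial>lborel)"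
    by (rule nn_integral_cong_AE, rule AE_I[where N="{t}"]) (use t in \<open>auto simp: F_def indicator_def\<close>)
  also have "\<dots> = ennreal (0 - (- 1 / pi * exp (- (t / v))))"
  proof (rule nn_integral_FTC_atLeast)
    show "((\<lambda>u. - 1 / pi * exp (- (u / v))) has_real_derivative 1 / (pi * v) * exp (- (u / v))) (at u)" for u
      using v by (auto intro!: derivative_eq_intros)
    have "filterlim (\<lambda>u. (1 / v) * u) at_top at_top"
      by (rule filterlim_tendsto_pos_mult_at_top[OF tendsto_const _ filterlim_ident]) (use v in simp)
    then have "((\<lambda>u. exp (- (u / v))) \<longlongrightarrow> 0) at_top"
      by (intro filterlim_compose[OF exp_at_bot]) (simp add: filterlim_uminus_at_top)
    then have "((\<lambda>u. - 1 / pi * exp (- (u / v))) \<longlongrightarrow> - 1 / pi * 0) at_top" by (intro tendsto_intros)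
    then show "((\<lambda>u. - 1 / pi * exp (- (u / v))) \<longlongrightarrow> 0) at_top" by simp
  qed (use v in auto)
  also have "ennreal pi * \<dots> = ennreal (exp (- (t / v)))" by (subst ennreal_mult'[symmetric]) auto
  finally show ?thesis .
qed

text \<open>The standard deviation is \<open>sqrt (v / 2)\<close>, so \<open>x = sqrt v * t\<close>
  turns the density into that of \<open>exp (- t^2) / sqrt pi\<close>. Open and closed tails on both
  sides are listed because decision regions with and without their boundary are both needed.\<close>

lemma emeasure_rgauss_tail:
  assumes v: "0 < v"
  shows "emeasure (rgauss v) {k<..} = ennreal (erfc (k / sqrt v) / 2)"
    and "emeasure (rgauss v) {k..} = ennreal (erfc (k / sqrt v) / 2)"
    and "emeasure (rgauss v) {..< - k} = ennreal (erfc (k / sqrt v) / 2)"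
    and "emeasure (rgauss v) {.. - k} = ennreal (erfc (k / sqrt v) / 2)"
proof -
  let ?e = "ennreal (erfc (k / sqrt v) / 2)"
  let ?t = "\<lambda>t. indicator {k / sqrt v..} t *\<^sub>R exp (- t\<^sup>2)"
  let ?d = "\<lambda>x. ennreal (1 / sqrt (pi * v) * exp (- (x^2 / v)))"
  have em: "emeasure (rgauss v) A = (\<integral>\<^sup>+x. ?d x * indicator A x \<partial>lborel)" if "A \<in> sets borel" for A
    using that unfolding rgauss_def
    using v by (subst emeasure_density) (auto simp: normal_density_def)
  have 2: "emeasure (rgauss v) {k..} = ?e"
  proof -
    have "emeasure (rgauss v) {k..} = (\<integral>\<^sup>+x. ?d x * indicator {k..} x \<partial>lborel)" by (rule em) simp
    also have "\<dots> = ennreal (sqrt v) * (\<integral>\<^sup>+t. ?d (sqrt v * t) * indicator {k..} (sqrt v * t) \<partial>lborel)"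
      using v by (subst nn_integral_real_affine[where c="sqrt v" and t=0]) auto
    also have "\<dots> = ennreal (sqrt v) * (\<integral>\<^sup>+t. ennreal (1 / sqrt (pi * v)) * ennreal (?t t) \<partial>lborel)"
    proof (rule arg_cong2[where f="(*)", OF refl], rule nn_integral_cong)
      fix t :: real
      have a: "(sqrt v * t)^2 / v = t^2" using v by (simp add: power_mult_distrib)
      have b: "k \<le> sqrt v * t \<longleftrightarrow> k / sqrt v \<le> t" using v by (simp add: divide_le_eq mult.commute)
      have c: "ennreal (1 / sqrt (pi * v) * exp (- t\<^sup>2)) = ennreal (1 / sqrt (pi * v)) * ennreal (exp (- t\<^sup>2))"
        by (rule ennreal_mult') (use v in simp)
      show "?d (sqrt v * t) * indicator {k..} (sqrt v * t) = ennreal (1 / sqrt (pi * v)) * ennreal (?t t)"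
        unfolding a c by (simp add: indicator_def b)
    qed
    also have "\<dots> = ennreal (sqrt v) * (ennreal (1 / sqrt (pi * v)) * (\<integral>\<^sup>+t. ennreal (?t t) \<partial>lborel))"
      by (subst nn_integral_cmult) auto
    also have "(\<integral>\<^sup>+t. ennreal (?t t) \<partial>lborel) = ennreal (LBINT t:{k / sqrt v..}. exp (- t\<^sup>2))"
      unfolding set_lebesgue_integral_def
      by (rule nn_integral_eq_integral) (use gauss_set_integrable[of "{k / sqrt v..}"] in \<open>auto simp: set_integrable_def\<close>)
    also have "(LBINT t:{k / sqrt v..}. exp (- t\<^sup>2)) = sqrt pi / 2 * erfc (k / sqrt v)"
      by (simp add: erfc_def)
    also have "ennreal (sqrt v) * (ennreal (1 / sqrt (pi * v)) * ennreal (sqrt pi / 2 * erfc (k / sqrt v))) = ?e"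
    proof -
      have "sqrt v * (1 / sqrt (pi * v) * (sqrt pi / 2 * erfc (k / sqrt v))) = erfc (k / sqrt v) / 2"
        using v by (simp add: real_sqrt_mult)
      then show ?thesis using v by (simp only: ennreal_mult'[symmetric] real_sqrt_ge_zero less_imp_le zero_le_divide_1_iff mult_nonneg_nonneg pi_ge_zero)
    qed
    finally show ?thesis .
  qed
  have flip: "emeasure (rgauss v) A = emeasure (rgauss v) (uminus -` A)" if [measurable]: "A \<in> sets borel" for A
  proof -
    have B: "uminus -` A \<in> sets borel" using measurable_sets[OF borel_measurable_uminus[OF measurable_ident] that] by (simp add: vimage_def)
    show ?thesis unfolding em[OF that] em[OF B]
      by (subst nn_integral_real_affine[where c="-1" and t=0]) (auto simp: indicator_def)
  qed
  have 1: "emeasure (rgauss v) {k<..} = emeasure (rgauss v) {k..}"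
    unfolding em[of "{k<..}", simplified] em[of "{k..}", simplified]
    by (rule nn_integral_cong_AE, rule AE_I[where N="{k}"]) (auto simp: indicator_def)
  have "uminus -` {..< - k} = {k<..}" "uminus -` {.. - k} = {k..}" by auto
  with 1 2 flip[of "{..< - k}"] flip[of "{.. - k}"]
  show "emeasure (rgauss v) {k<..} = ?e"
    "emeasure (rgauss v) {k..} = ?e"
    "emeasure (rgauss v) {..< - k} = ?e"
    "emeasure (rgauss v) {.. - k} = ?e"
    by simp_all
qed

text \<open>Outer regularity extends the inequality to all Borel sets. Applied to complements it
  reverses, because both total masses are \<open>1\<close>.\<close>

lemma prob_measure_eqI_open:
  fixes M N :: "'a::{second_countable_topology, complete_space} measure"
  assumes "prob_space M" "prob_space N" and sets: "sets M = sets borel" "sets N = sets borel"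
    and le: "\<And>U. open U \<Longrightarrow> emeasure M U \<le> emeasure N U"
  shows "M = N"
proof (rule measure_eqI)
  interpret M: prob_space M by fact
  interpret N: prob_space N by fact
  have sp: "space M = UNIV" "space N = UNIV" using sets[THEN sets_eq_imp_space_eq] by auto
  have *: "emeasure M B \<le> emeasure N B" if "B \<in> sets borel" for B
  proof -
    have "emeasure M B \<le> (INF U \<in> {U. B \<subseteq> U \<and> open U}. emeasure N U)"
    proof (rule INF_greatest)
      fix U assume U: "U \<in> {U. B \<subseteq> U \<and> open U}"
      have "emeasure M B \<le> emeasure M U" by (rule emeasure_mono) (use U sets in auto)
      also have "\<dots> \<le> emeasure N U" using U by (intro le) simp
      finally show "emeasure M B \<le> emeasure N U" .
    qed
    also have "\<dots> = emeasure N B"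
      by (rule outer_regular[symmetric]) (use sets that N.emeasure_space_1 in auto)
    finally show ?thesis .
  qed
  fix A assume "A \<in> sets M"
  then have A: "A \<in> sets borel" "- A \<in> sets borel" by (auto simp: sets)
  have "measure M A \<le> measure N A" "measure M (- A) \<le> measure N (- A)"
    using *[OF A(1)] *[OF A(2)] by (auto simp: M.emeasure_eq_measure N.emeasure_eq_measure)
  moreover have "measure M (- A) = 1 - measure M A" "measure N (- A) = 1 - measure N A"
    using M.prob_compl[of A] N.prob_compl[of A] A by (auto simp: sets sp Compl_eq_Diff_UNIV)
  ultimately show "emeasure M A = emeasure N A"
    by (simp add: M.emeasure_eq_measure N.emeasure_eq_measure)
qed (simp add: sets)

section \<open>Random variables and series with complex Gaussian law\<close>

context prob_space begin

lemma distributed_Re_cgauss: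
  assumes Z [measurable]: "Z \<in> borel_measurable M" and law: "distr M borel Z = cgauss v" and v: "0 < v"
  shows "distributed M lborel (\<lambda>x. Re (Z x)) (\<lambda>x. ennreal (normal_density 0 (sqrt (v / 2)) x))"
proof -
  interpret G: prob_space "rgauss v" using v by (rule prob_space_rgauss)
  have [measurable]: "Re \<in> borel_measurable borel" by auto
  have "emeasure (distr M lborel (\<lambda>x. Re (Z x))) A = emeasure (rgauss v) A" if A[measurable]: "A \<in> sets borel" for A
  proof -
    have "emeasure (distr M lborel (\<lambda>x. Re (Z x))) A = emeasure (distr M borel Z) {z. Re z \<in> A \<and> Im z \<in> UNIV}"
      by (subst (1 2) emeasure_distr) (auto intro!: arg_cong[where f="emeasure M"])
    then show ?thesis unfolding law by (subst (asm) emeasure_cgauss_Times) (auto simp: v G.emeasure_space_1[simplified])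
  qed
  then have "distr M lborel (\<lambda>x. Re (Z x)) = density lborel (\<lambda>x. ennreal (normal_density 0 (sqrt (v / 2)) x))"
    unfolding rgauss_def by (intro measure_eqI) auto
  then show "distributed M lborel (\<lambda>x. Re (Z x)) (\<lambda>x. ennreal (normal_density 0 (sqrt (v / 2)) x))"
    unfolding distributed_def by auto
qed

lemma circular_gaussian_distr:
  assumes "circular_gaussian Z v" and v: "0 < v"
  shows "Z \<in> borel_measurable M" and "distr M borel Z = cgauss v"
proof -
  have Re: "distributed M lborel (\<lambda>x. Re (Z x)) (\<lambda>x. ennreal (normal_density 0 (sqrt (v / 2)) x))"
    and Im: "distributed M lborel (\<lambda>x. Im (Z x)) (\<lambda>x. ennreal (normal_density 0 (sqrt (v / 2)) x))"
    and ind: "indep_var borel (\<lambda>x. Re (Z x)) borel (\<lambda>x. Im (Z x))"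
    using assms(1) by (auto simp: circular_gaussian_def)
  have [measurable]: "(\<lambda>x. Re (Z x)) \<in> borel_measurable M" "(\<lambda>x. Im (Z x)) \<in> borel_measurable M"
    using distributed_measurable[OF Re] distributed_measurable[OF Im] by auto
  have "(\<lambda>x. Complex (Re (Z x)) (Im (Z x))) \<in> borel_measurable M" by measurable
  then show [measurable]: "Z \<in> borel_measurable M" by simp
  have dRe: "distr M borel (\<lambda>x. Re (Z x)) = rgauss v" and dIm: "distr M borel (\<lambda>x. Im (Z x)) = rgauss v"
    using distributed_distr_eq_density[OF Re] distributed_distr_eq_density[OF Im] by (auto simp: rgauss_def cong: distr_cong)
  have "cgauss v = distr (distr M (borel \<Otimes>\<^sub>M borel) (\<lambda>x. (Re (Z x), Im (Z x)))) borel (\<lambda>p. Complex (fst p) (snd p))"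
    using ind unfolding indep_var_distribution_eq cgauss_def dRe dIm by simp
  also have "\<dots> = distr M borel (\<lambda>x. Complex (Re (Z x)) (Im (Z x)))"
    by (subst distr_distr) (auto simp: comp_def)
  finally show "distr M borel Z = cgauss v" by simp
qed

lemma distr_add_cgauss:
  assumes ind: "indep_var borel U borel V"
    and law: "distr M borel U = cgauss v" "distr M borel V = cgauss w" and "0 < v" "0 < w"
  shows "distr M borel (\<lambda>x. U x + V x) = cgauss (v + w)"
proof (rule measure_eqI)
  have [measurable]: "U \<in> borel_measurable M" "V \<in> borel_measurable M"
    using ind unfolding indep_var_distribution_eq by auto
  interpret W: prob_space "cgauss w" using assms by (intro prob_space_cgauss)
  fix A assume "A \<in> sets (distr M borel (\<lambda>x. U x + V x))"
  then have [measurable]: "A \<in> sets borel" by simp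
  have "emeasure (distr M borel (\<lambda>x. U x + V x)) A = (\<integral>\<^sup>+x. indicator A (U x + V x) \<partial>M)"
    by (subst nn_integral_indicator[symmetric], simp, subst nn_integral_distr) auto
  also have "\<dots> = (\<integral>\<^sup>+p. indicator A (fst p + snd p) \<partial>distr M (borel \<Otimes>\<^sub>M borel) (\<lambda>x. (U x, V x)))"
    by (subst nn_integral_distr) auto
  also have "\<dots> = (\<integral>\<^sup>+p. indicator A (fst p + snd p) \<partial>(cgauss v \<Otimes>\<^sub>M cgauss w))"
    using ind unfolding indep_var_distribution_eq law by simp
  also have "\<dots> = (\<integral>\<^sup>+z. \<integral>\<^sup>+z'. indicator A (z + z') \<partial>cgauss w \<partial>cgauss v)"
    by (subst W.nn_integral_fst[symmetric]) auto
  also have "\<dots> = (\<integral>\<^sup>+z. indicator A z \<partial>cgauss (v + w))"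
    by (rule nn_integral_cgauss_add) (use assms in auto)
  finally show "emeasure (distr M borel (\<lambda>x. U x + V x)) A = emeasure (cgauss (v + w)) A" by simp
qed simp

lemma distr_mult_cgauss:
  assumes [measurable]: "Z \<in> borel_measurable M" and law: "distr M borel Z = cgauss v" and "0 < v" "b \<noteq> 0"
  shows "distr M borel (\<lambda>x. b * Z x) = cgauss ((cmod b)^2 * v)"
proof -
  have "distr M borel (\<lambda>x. b * Z x) = distr (distr M borel Z) borel (\<lambda>z. b * z)"
    by (subst distr_distr) (auto simp: comp_def)
  then show ?thesis using cgauss_mult[OF assms(3,4)] law by simp
qed

lemma cgauss_moments:
  assumes Z [measurable]: "Z \<in> borel_measurable M" and law: "distr M borel Z = cgauss v" and v: "0 < v"
  shows "integrable M (\<lambda>x. Re (b * Z x))" "expectation (\<lambda>x. Re (b * Z x)) = 0"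
    "integrable M (\<lambda>x. (Re (b * Z x))^2)" "expectation (\<lambda>x. (Re (b * Z x))^2) = (cmod b)^2 * v / 2"
proof -
  let ?R = "\<lambda>x. Re (b * Z x)"
  have "integrable M ?R \<and> expectation ?R = 0 \<and>
    integrable M (\<lambda>x. (?R x)^2) \<and> expectation (\<lambda>x. (?R x)^2) = (cmod b)^2 * v / 2"
  proof (cases "b = 0")
    case False
    let ?w = "(cmod b)^2 * v"
    have w: "0 < ?w" using v False by simp
    have D: "distributed M lborel ?R (\<lambda>x. ennreal (normal_density 0 (sqrt (?w / 2)) x))"
      by (rule distributed_Re_cgauss[OF _ distr_mult_cgauss[OF Z law v False] w]) measurable
    have e: "expectation ?R = 0"
      using normal_distributed_expectation[OF _ D] w by simp
    have i1: "integrable M ?R"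
      using distributed_integrable[OF D, of "\<lambda>x. x"] integrable_normal_moment_nz_1[of "sqrt (?w / 2)" 0] w by simp
    have i2: "integrable M (\<lambda>x. (?R x)^2)"
      using distributed_integrable[OF D, of "\<lambda>x. x^2"] integrable_normal_moment[of "sqrt (?w / 2)" 0 2] w by simp
    have "variance ?R = (sqrt (?w / 2))^2"
      using normal_distributed_variance[OF _ D] w by simp
    then have "expectation (\<lambda>x. (?R x)^2) = ?w / 2" using e w by simp
    with e i1 i2 show ?thesis by simp
  qed simp
  then show "integrable M ?R" "expectation ?R = 0"
    "integrable M (\<lambda>x. (?R x)^2)" "expectation (\<lambda>x. (?R x)^2) = (cmod b)^2 * v / 2" by auto
qed

text \<open>Partial sums are exactly Gaussian with variance \<open>V n\<close>. On an open set
  Fatou's lemma bounds the law of the limit by the lower limit of \<open>Vt / V n\<close> times the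
  target measure, and the ratio tends to \<open>1\<close>; two probability measures ordered on open
  sets are equal. The condition \<open>b 0 \<noteq> 0\<close> excludes variance \<open>0\<close>,
  where \<open>cgauss\<close> is not a probability measure.\<close>

lemma cgauss_series:
  fixes T :: "nat \<Rightarrow> 'a \<Rightarrow> complex" and b :: "nat \<Rightarrow> complex"
  assumes ind: "indep_vars (\<lambda>_. borel) T UNIV"
    and law: "\<And>j. distr M borel (T j) = cgauss (v j)" and v: "\<And>j. 0 < v j"
    and b0: "b 0 \<noteq> 0" and summ: "summable (\<lambda>j. (cmod (b j))^2 * v j)"
  shows "AE x in M. summable (\<lambda>j. b j * T j x)"
    and "distr M borel (\<lambda>x. \<Sum>j. b j * T j x) = cgauss (\<Sum>j. (cmod (b j))^2 * v j)"
proof -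
  have T [measurable]: "T j \<in> borel_measurable M" for j using ind unfolding indep_vars_def by auto
  note mom = cgauss_moments[OF T law v]
  have AE_Re: "AE x in M. summable (\<lambda>j. Re (c j * T j x))" if "summable (\<lambda>j. (cmod (c j))^2 * v j)" for c
  proof (rule AE_summable_indep)
    show "indep_vars (\<lambda>_. borel) (\<lambda>j x. Re (c j * T j x)) UNIV"
      by (rule indep_vars_compose2[OF ind]) measurable
    show "summable (\<lambda>j. expectation (\<lambda>x. (Re (c j * T j x))^2))"
      unfolding mom using that by (rule summable_divide)
  qed (rule mom)+
  \<comment> \<open>Since \<open>Re (- \<i> * z) = Im z\<close>, the imaginary parts are covered by
    the statement on real parts.\<close>
  have "AE x in M. summable (\<lambda>j. Re ((- \<i> * b j) * T j x))"
    by (rule AE_Re) (use summ in \<open>simp add: norm_mult\<close>)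
  with AE_Re[OF summ] show AE_summ: "AE x in M. summable (\<lambda>j. b j * T j x)"
    by eventually_elim (simp add: summable_complex_iff)
  define S where "S n x = (\<Sum>j<n. b j * T j x)" for n x
  define V where "V n = (\<Sum>j<n. (cmod (b j))^2 * v j)" for n
  define Vt where "Vt = (\<Sum>j. (cmod (b j))^2 * v j)"
  have nn: "0 \<le> (cmod (b j))\<^sup>2 * v j" for j using v[of j] by simp
  have Vpos: "0 < V (Suc n)" for n
  proof -
    have "0 < (cmod (b 0))^2 * v 0" using b0 v[of 0] by simp
    also have "\<dots> \<le> V (Suc n)" unfolding V_def using nn by (intro member_le_sum) auto
    finally show ?thesis .
  qed
  have V_le: "V n \<le> Vt" for n unfolding V_def Vt_def using nn by (intro sum_le_suminf summ) auto
  have V_lim: "V \<longlonglongrightarrow> Vt" unfolding V_def Vt_def by (rule summable_LIMSEQ[OF summ])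
  have Vt_pos: "0 < Vt" using Vpos[of 0] V_le[of 1] by simp
  have S_meas [measurable]: "S n \<in> borel_measurable M" for n unfolding S_def by measurable
  have S_law: "distr M borel (S (Suc n)) = cgauss (V (Suc n))" for n
  proof (induction n)
    case 0
    have "S (Suc 0) = (\<lambda>x. b 0 * T 0 x)" by (simp add: S_def fun_eq_iff)
    then show ?case using distr_mult_cgauss[OF T law v b0] by (simp add: V_def)
  next
    case (Suc n)
    show ?case
    proof (cases "b (Suc n) = 0")
      case True
      then have "S (Suc (Suc n)) = S (Suc n)" "V (Suc (Suc n)) = V (Suc n)" by (auto simp: S_def V_def fun_eq_iff)
      then show ?thesis using Suc by simp
    next
      case False
      have "indep_var (PiM {..<Suc n} (\<lambda>_. borel)) (\<lambda>x. restrict (\<lambda>i. T i x) {..<Suc n})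
                      (PiM {Suc n} (\<lambda>_. borel)) (\<lambda>x. restrict (\<lambda>i. T i x) {Suc n})"
        by (rule indep_var_restrict[OF ind]) auto
      from indep_var_compose[OF this, of "\<lambda>y. \<Sum>j<Suc n. b j * y j" borel "\<lambda>y. b (Suc n) * y (Suc n)" borel]
      have "indep_var borel ((\<lambda>y. \<Sum>j<Suc n. b j * y j) \<circ> (\<lambda>x. restrict (\<lambda>i. T i x) {..<Suc n}))
             borel ((\<lambda>y. b (Suc n) * y (Suc n)) \<circ> (\<lambda>x. restrict (\<lambda>i. T i x) {Suc n}))"
        by (auto intro!: borel_measurable_sum borel_measurable_times measurable_component_singleton simp del: sum.lessThan_Suc)
      also have "(\<lambda>y. \<Sum>j<Suc n. b j * y j) \<circ> (\<lambda>x. restrict (\<lambda>i. T i x) {..<Suc n}) = S (Suc n)"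
        by (auto simp: S_def fun_eq_iff)
      also have "(\<lambda>y. b (Suc n) * y (Suc n)) \<circ> (\<lambda>x. restrict (\<lambda>i. T i x) {Suc n}) = (\<lambda>x. b (Suc n) * T (Suc n) x)"
        by (auto simp: fun_eq_iff)
      finally have iv: "indep_var borel (S (Suc n)) borel (\<lambda>x. b (Suc n) * T (Suc n) x)" .
      have "distr M borel (\<lambda>x. S (Suc n) x + b (Suc n) * T (Suc n) x) = cgauss (V (Suc n) + (cmod (b (Suc n)))^2 * v (Suc n))"
        by (rule distr_add_cgauss[OF iv Suc distr_mult_cgauss[OF T law v False] Vpos])
           (use False v in auto)
      then show ?thesis by (simp add: S_def V_def)
    qed
  qed
  let ?S = "\<lambda>x. \<Sum>j. b j * T j x"
  have S_lim: "AE x in M. (\<lambda>n. S n x) \<longlonglongrightarrow> ?S x"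
    using AE_summ by eventually_elim (auto simp: S_def intro: summable_LIMSEQ)
  show "distr M borel ?S = cgauss Vt"
  proof (rule prob_measure_eqI_open)
    fix U :: "complex set" assume U: "open U"
    then have [measurable]: "U \<in> sets borel" by simp
    have "emeasure (distr M borel ?S) U = (\<integral>\<^sup>+x. indicator U (?S x) \<partial>M)"
      by (subst nn_integral_indicator[symmetric], simp, subst nn_integral_distr) auto
    \<comment> \<open>Here openness enters: if the limit lies in \<open>U\<close>, then so do all
      late partial sums.\<close>
    also have "\<dots> \<le> (\<integral>\<^sup>+x. liminf (\<lambda>n. indicator U (S (Suc n) x)) \<partial>M)"
    proof (rule nn_integral_mono_AE, use S_lim in eventually_elim)
      fix x assume lim: "(\<lambda>n. S n x) \<longlonglongrightarrow> ?S x"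
      show "indicator U (?S x) \<le> liminf (\<lambda>n. indicator U (S (Suc n) x) :: ennreal)"
      proof (cases "?S x \<in> U")
        case True
        have "\<forall>\<^sub>F n in sequentially. S n x \<in> U" using lim U True by (rule topological_tendstoD)
        then have "\<forall>\<^sub>F n in sequentially. S (Suc n) x \<in> U" by (rule eventually_compose_filterlim[OF _ filterlim_Suc])
        then have "1 \<le> liminf (\<lambda>n. indicator U (S (Suc n) x) :: ennreal)"
          by (intro Liminf_bounded) (auto elim!: eventually_mono)
        then show ?thesis using True by simp
      qed simp
    qed
    also have "\<dots> \<le> liminf (\<lambda>n. \<integral>\<^sup>+x. indicator U (S (Suc n) x) \<partial>M)"
      by (rule nn_integral_liminf) measurable
    also have "\<dots> \<le> liminf (\<lambda>n. ennreal (Vt / V (Suc n)) * emeasure (cgauss Vt) U)"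
    proof (intro Liminf_mono always_eventually allI)
      fix n
      have "(\<integral>\<^sup>+x. indicator U (S (Suc n) x) \<partial>M) = emeasure (distr M borel (S (Suc n))) U"
        by (subst nn_integral_indicator[symmetric], simp, subst nn_integral_distr) auto
      also have "\<dots> \<le> ennreal (Vt / V (Suc n)) * emeasure (cgauss Vt) U"
        unfolding S_law by (rule emeasure_cgauss_le[OF Vpos V_le]) simp
      finally show "(\<integral>\<^sup>+x. indicator U (S (Suc n) x) \<partial>M) \<le> ennreal (Vt / V (Suc n)) * emeasure (cgauss Vt) U" .
    qed
    also have "\<dots> = emeasure (cgauss Vt) U"
    proof (rule lim_imp_Liminf)
      interpret C: prob_space "cgauss Vt" using Vt_pos by (rule prob_space_cgauss)
      have "(\<lambda>n. Vt / V (Suc n)) \<longlonglongrightarrow> Vt / Vt"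
        using Vt_pos by (intro tendsto_divide tendsto_const LIMSEQ_Suc V_lim) auto
      then have "(\<lambda>n. Vt / V (Suc n) * measure (cgauss Vt) U) \<longlonglongrightarrow> 1 * measure (cgauss Vt) U"
        using Vt_pos by (intro tendsto_mult tendsto_const) simp
      then have "(\<lambda>n. ennreal (Vt / V (Suc n) * measure (cgauss Vt) U)) \<longlonglongrightarrow> ennreal (measure (cgauss Vt) U)"
        by (intro tendsto_ennrealI) simp
      moreover have "ennreal (Vt / V (Suc n)) * emeasure (cgauss Vt) U = ennreal (Vt / V (Suc n) * measure (cgauss Vt) U)" for n
        unfolding C.emeasure_eq_measure using Vpos[of n] Vt_pos by (intro ennreal_mult'[symmetric]) simp
      ultimately show "(\<lambda>n. ennreal (Vt / V (Suc n)) * emeasure (cgauss Vt) U) \<longlonglongrightarrow> emeasure (cgauss Vt) U"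
        by (simp add: C.emeasure_eq_measure)
    qed simp
    finally show "emeasure (distr M borel ?S) U \<le> emeasure (cgauss Vt) U" .
  qed (auto intro!: prob_space_distr prob_space_cgauss Vt_pos)
qed

end


section \<open>Path loss and the hypergeometric function\<close>

text \<open>The only possible zero is \<open>w = 1 / q\<close>, and \<open>q \<le> 1\<close> puts it
  on the slit.\<close>

lemma one_minus_slit_nonzero:
  assumes "w \<in> slit_plane" "0 \<le> q" "q \<le> 1"
  shows "1 - w * of_real q \<noteq> 0"
proof
  assume "1 - w * of_real q = 0"
  then have eq: "w * of_real q = 1" by simp
  then have "q \<noteq> 0" by auto
  with eq have "w = complex_of_real (1 / q)" by (simp add: field_simps)
  with assms \<open>q \<noteq> 0\<close> show False by (auto simp: slit_plane_def field_simps)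
qed

lemma open_slit_plane: "open slit_plane"
  unfolding slit_plane_def
  by (intro open_Compl closed_Collect_conj closed_Collect_eq closed_Collect_le continuous_intros)

lemma connected_slit_plane: "connected slit_plane"
proof (rule starlike_imp_connected)
  have "closed_segment 0 x \<subseteq> slit_plane" if x: "x \<in> slit_plane" for x
  proof
    fix y assume "y \<in> closed_segment 0 x"
    then obtain u where u: "0 \<le> u" "u \<le> 1" "y = u *\<^sub>R x" by (auto simp: in_segment)
    show "y \<in> slit_plane"
    proof (rule ccontr)
      assume "y \<notin> slit_plane"
      then have y: "u * Im x = 0" "1 \<le> u * Re x" using u by (auto simp: slit_plane_def)
      then have "u \<noteq> 0" by auto
      with y have "Im x = 0" by simp
      moreover have "1 \<le> Re x"
      proof (rule ccontr)
        assume "\<not> 1 \<le> Re x"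
        then have "u * Re x < u * 1" using u \<open>u \<noteq> 0\<close> by (intro mult_strict_left_mono) auto
        with y u show False by linarith
      qed
      ultimately show False using x by (simp add: slit_plane_def)
    qed
  qed
  moreover have "0 \<in> slit_plane" by (simp add: slit_plane_def)
  ultimately show "starlike slit_plane" unfolding starlike_def by blast
qed

lemma continuous_on_powr_unit:
  assumes "0 < p" shows "continuous_on {0..(y::real)} (\<lambda>v. v powr p)"
  using assms by (intro continuous_on_powr' continuous_intros) auto

lemma powr_unit: "0 < p \<Longrightarrow> 0 \<le> v \<Longrightarrow> v \<le> 1 \<Longrightarrow> 0 \<le> v powr p \<and> v powr p \<le> (1::real)"
  using powr_le1[of p v] by auto

text \<open>Euler's integral for \<open>\<^sub>2F\<^sub>1(1, b; b + 1; w)\<close>, with the singular weight removed by the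
  substitution \<open>t = v powr p\<close>, \<open>p = 1 / b\<close>.\<close>

definition euler_integral :: "real \<Rightarrow> complex \<Rightarrow> complex" where
  "euler_integral p w = integral {0..1} (\<lambda>v. 1 / (1 - w * of_real (v powr p)))"

lemma holomorphic_euler_integral:
  assumes p: "0 < p"
  shows "euler_integral p holomorphic_on slit_plane"
  unfolding holomorphic_on_def
proof
  fix w assume "w \<in> slit_plane"
  then obtain e where e: "0 < e" "ball w e \<subseteq> slit_plane"
    using open_slit_plane open_contains_ball by blast
  have nz: "1 - x * of_real (t powr p) \<noteq> 0" if "x \<in> ball w e" "t \<in> {0..1}" for x t
    using that e powr_unit[OF p, of t] by (intro one_minus_slit_nonzero) auto
  have "(\<lambda>x. integral (cbox 0 (1::real)) (\<lambda>v. 1 / (1 - x * of_real (v powr p)))) holomorphic_on ball w e"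
  proof (rule leibniz_rule_holomorphic[where fx="\<lambda>x v. of_real (v powr p) / (1 - x * of_real (v powr p))^2"])
    fix x t assume "x \<in> ball w e" "t \<in> cbox (0::real) 1"
    then show "((\<lambda>x. 1 / (1 - x * of_real (t powr p))) has_field_derivative
        of_real (t powr p) / (1 - x * of_real (t powr p))^2) (at x within ball w e)"
      using nz[of x t] by (auto intro!: derivative_eq_intros simp: power2_eq_square)
  next
    fix x assume "x \<in> ball w e"
    then show "(\<lambda>v. 1 / (1 - x * of_real (v powr p))) integrable_on cbox 0 1"
      using nz[of x] by (intro integrable_continuous) (auto intro!: continuous_intros continuous_on_powr_unit p)
  next
    have "continuous_on (ball w e \<times> {0..1}) (\<lambda>z. complex_of_real (snd z powr p))"
      using p by (intro continuous_on_of_real continuous_on_powr' continuous_intros) auto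
    then show "continuous_on (ball w e \<times> cbox 0 1) (\<lambda>(x, t). of_real (t powr p) / (1 - x * of_real (t powr p))^2)"
      using nz by (auto simp: case_prod_unfold intro!: continuous_intros)
  qed simp
  then have "euler_integral p holomorphic_on ball w e" unfolding euler_integral_def by simp
  then have "euler_integral p field_differentiable at w"
    using e by (intro holomorphic_on_imp_differentiable_at[of _ "ball w e"]) auto
  then show "euler_integral p field_differentiable at w within slit_plane"
    by (rule field_differentiable_at_within)
qed

text \<open>The integrand is a geometric series with ratio at most \<open>cmod x\<close> in modulus,
  hence uniformly convergent in \<open>v\<close>, and the integral of \<open>v powr (p * n)\<close>
  over the unit interval is \<open>1 / (p * n + 1)\<close>.\<close>

lemma euler_integral_sums:
  assumes p: "0 < p" and x: "cmod x < 1"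
  shows "(\<lambda>n. x ^ n / complex_of_real (p * real n + 1)) sums euler_integral p x"
proof -
  let ?q = "\<lambda>v. complex_of_real (v powr p)"
  have le: "cmod (x * ?q v) \<le> cmod x" if "v \<in> {0..1}" for v
    using powr_unit[OF p, of v] that by (simp add: norm_mult mult_left_le)
  have "uniform_limit {0..1} (\<lambda>N v. \<Sum>n<N. (x * ?q v) ^ n) (\<lambda>v. \<Sum>n. (x * ?q v) ^ n) sequentially"
  proof (rule Weierstrass_m_test)
    show "norm ((x * ?q v) ^ n) \<le> cmod x ^ n" if "v \<in> {0..1}" for n v
      using le[OF that] by (simp only: norm_power) (rule power_mono, auto)
    show "summable (\<lambda>n. cmod x ^ n)" using x by (simp add: summable_geometric)
  qed
  also have "?this \<longleftrightarrow> uniform_limit {0..1} (\<lambda>N v. \<Sum>n<N. (x * ?q v) ^ n) (\<lambda>v. 1 / (1 - x * ?q v)) sequentially"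
  proof (rule uniform_limit_cong')
    fix v :: real assume "v \<in> {0..1}"
    then have "norm (x * ?q v) < 1" using le[of v] x by linarith
    then show "(\<Sum>n. (x * ?q v) ^ n) = 1 / (1 - x * ?q v)" by (rule suminf_geometric)
  qed simp
  finally have unif: "uniform_limit {0..1} (\<lambda>N v. \<Sum>n<N. (x * ?q v) ^ n) (\<lambda>v. 1 / (1 - x * ?q v)) sequentially" .
  have monomial: "((\<lambda>v. (x * ?q v) ^ n) has_integral x ^ n / complex_of_real (p * real n + 1)) {0..1}" for n
  proof -
    have pn: "0 \<le> p * real n" using p by simp
    have "((\<lambda>v. v powr (p * real n)) has_integral (1 powr (p * real n + 1) / (p * real n + 1))) {0..1}"
      by (rule has_integral_powr_from_0) (use pn in auto)
    then have "((\<lambda>v. complex_of_real (v powr (p * real n))) has_integral complex_of_real (1 / (p * real n + 1))) {0..1}"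
      by (intro has_integral_of_real) simp
    then have a: "((\<lambda>v. x ^ n * complex_of_real (v powr (p * real n))) has_integral x ^ n * complex_of_real (1 / (p * real n + 1))) {0..1}"
      by (rule has_integral_mult_right)
    \<comment> \<open>The point \<open>0\<close> is left out because \<open>0 powr 0 = 0\<close>,
      while the power with exponent \<open>n = 0\<close> is \<open>1\<close> there.\<close>
    have b: "(x * ?q v) ^ n = x ^ n * complex_of_real (v powr (p * real n))" if "v \<in> {0..1} - {0}" for v
    proof -
      have "(v powr p) ^ n = v powr (p * real n)" using that by (simp add: powr_power mult.commute)
      then show ?thesis by (simp only: power_mult_distrib of_real_power[symmetric])
    qed
    have "((\<lambda>v. (x * ?q v) ^ n) has_integral x ^ n * complex_of_real (1 / (p * real n + 1))) {0..1}"
      by (rule has_integral_spike[where S="{0}", OF _ b a]) simp_all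
    then show ?thesis by simp
  qed
  have "(\<lambda>N. integral {0..1} (\<lambda>v. \<Sum>n<N. (x * ?q v) ^ n)) \<longlonglongrightarrow> integral {0..1} (\<lambda>v. 1 / (1 - x * ?q v))"
  proof -
    obtain I J where IJ: "\<And>N. ((\<lambda>v. \<Sum>n<N. (x * ?q v) ^ n) has_integral I N) {0..1}"
      "((\<lambda>v. 1 / (1 - x * ?q v)) has_integral J) {0..1}" "I \<longlonglongrightarrow> J"
      by (rule uniform_limit_integral[OF unif]) (auto intro!: continuous_intros continuous_on_powr_unit p)
    have "I = (\<lambda>N. integral {0..1} (\<lambda>v. \<Sum>n<N. (x * ?q v) ^ n))"
      by (rule ext) (rule integral_unique[OF IJ(1), symmetric])
    with IJ(2,3) show ?thesis by (simp only: integral_unique)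
  qed
  moreover have "integral {0..1} (\<lambda>v. \<Sum>n<N. (x * ?q v) ^ n) = (\<Sum>n<N. x ^ n / complex_of_real (p * real n + 1))" for N
    by (intro integral_unique has_integral_sum monomial) auto
  ultimately show ?thesis unfolding sums_def euler_integral_def by simp
qed

text \<open>The quotient of the two rising factorials telescopes to \<open>b / (b + n)\<close>, and
  \<open>pochhammer 1 n\<close> is \<open>fact n\<close>.\<close>

lemma hypergeometric_coeff:
  fixes b :: complex
  assumes "\<And>k. b + of_nat k \<noteq> 0"
  shows "pochhammer 1 n * pochhammer b n / pochhammer (b + 1) n * x ^ n / fact n = x ^ n * (b / (b + of_nat n))"
proof -
  have "pochhammer (b + 1) n \<noteq> 0"
  proof
    assume "pochhammer (b + 1) n = 0"
    then obtain k where "b + 1 = - of_nat k" unfolding pochhammer_eq_0_iff by blast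
    then have "b + of_nat (Suc k) = 0" by (simp add: add.assoc[symmetric])
    with assms show False by blast
  qed
  moreover have "b * pochhammer (b + 1) n = pochhammer b n * (b + of_nat n)"
    by (metis pochhammer_Suc pochhammer_rec)
  ultimately have "pochhammer b n / pochhammer (b + 1) n = b / (b + of_nat n)"
    using assms[of n] by (metis frac_eq_eq)
  then have "fact n * (pochhammer b n / pochhammer (b + 1) n) * x ^ n / fact n = fact n * (b / (b + of_nat n)) * x ^ n / fact n" by simp
  then show ?thesis by (simp add: pochhammer_fact[symmetric])
qed

text \<open>Existence in the definite description comes from Euler's integral. Uniqueness is the
  identity theorem: two holomorphic functions with the same sum on the unit disc agree on the
  connected slit plane.\<close>

lemma hypergeometric_eq_euler_integral:
  assumes b: "0 < b" and z: "z \<in> slit_plane"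
  shows "hypergeometric_2F1 1 (complex_of_real b) (complex_of_real b + 1) z = euler_integral (1 / b) z"
proof -
  let ?g = "euler_integral (1 / b)"
  let ?c = "\<lambda>n. pochhammer 1 n * pochhammer (complex_of_real b) n / pochhammer (complex_of_real b + 1) n"
  let ?t = "\<lambda>x n. ?c n * x ^ n / fact n"
  have nz: "complex_of_real b + of_nat k \<noteq> 0" for k
  proof -
    have "b + real k \<noteq> 0" using b by linarith
    then show ?thesis by (metis of_real_add of_real_eq_0_iff of_real_of_nat_eq)
  qed
  have sums: "?t x sums ?g x" if "cmod x < 1" for x
  proof -
    have "x ^ n / complex_of_real (1 / b * real n + 1) = ?c n * x ^ n / fact n" for n
      unfolding hypergeometric_coeff[OF nz] using b by (simp add: field_simps)
    then show ?thesis using euler_integral_sums[OF _ that, of "1 / b"] b by simp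
  qed
  have holo: "?g holomorphic_on slit_plane" using b by (intro holomorphic_euler_integral) simp
  show ?thesis
    unfolding hypergeometric_2F1_def
  proof (rule the_equality)
    show "z \<in> slit_plane \<and> (\<exists>g. g holomorphic_on slit_plane \<and>
      (\<forall>x. cmod x < 1 \<longrightarrow> ?t x sums g x) \<and> ?g z = g z)"
      using z holo sums by blast
  next
    fix w assume "z \<in> slit_plane \<and> (\<exists>g. g holomorphic_on slit_plane \<and>
      (\<forall>x. cmod x < 1 \<longrightarrow> ?t x sums g x) \<and> w = g z)"
    then obtain g where g: "g holomorphic_on slit_plane"
      "\<And>x. cmod x < 1 \<Longrightarrow> ?t x sums g x" "w = g z" by blast
    have "ball 0 1 \<subseteq> slit_plane"
    proof
      fix x :: complex assume "x \<in> ball 0 1"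
      then have "Re x < 1" using complex_Re_le_cmod[of x] by simp
      then show "x \<in> slit_plane" by (simp add: slit_plane_def)
    qed
    then have "g z = ?g z"
      by (intro analytic_continuation_open[of "ball 0 1" slit_plane g ?g z] open_slit_plane connected_slit_plane g(1) holo z)
         (auto intro: sums_unique2[OF g(2) sums])
    then show "w = ?g z" using g(3) by simp
  qed
qed

text \<open>At a nonpositive argument Euler's integrand is real, so taking the real part discards
  nothing.\<close>

lemma Re_hypergeometric:
  assumes b: "0 < b" and c: "0 \<le> c"
  shows "Re (hypergeometric_2F1 1 (complex_of_real b) (complex_of_real b + 1) (complex_of_real (- c))) =
    integral {0..1} (\<lambda>v. 1 / (1 + c * v powr (1 / b)))"
proof -
  let ?h = "\<lambda>v. 1 / (1 + c * v powr (1 / b))"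
  have pos: "1 + c * v powr (1 / b) \<noteq> 0" for v using c by (smt (verit) mult_nonneg_nonneg powr_ge_zero)
  have "(?h has_integral integral {0..1} ?h) {0..1}"
    using b pos by (intro integrable_integral integrable_continuous_real continuous_intros continuous_on_powr_unit) auto
  then have "((\<lambda>v. complex_of_real (1 / (1 + c * v powr (1 / b)))) has_integral complex_of_real (integral {0..1} ?h)) {0..1}"
    by (rule has_integral_of_real)
  then have "euler_integral (1 / b) (complex_of_real (- c)) = complex_of_real (integral {0..1} ?h)"
    unfolding euler_integral_def by (intro integral_unique) simp
  moreover have "complex_of_real (- c) \<in> slit_plane" using c by (simp add: slit_plane_def)
  ultimately show ?thesis by (subst hypergeometric_eq_euler_integral[OF b]) auto
qed

lemma integral_arctan:
  assumes "0 < c"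
  shows "integral {0..1} (\<lambda>v. 1 / (1 + c * v powr 2)) = arctan (sqrt c) / sqrt c"
proof -
  have "((\<lambda>v. 1 / (1 + c * v powr 2)) has_integral (arctan (sqrt c * 1) / sqrt c - arctan (sqrt c * 0) / sqrt c)) {0..1}"
  proof (rule fundamental_theorem_of_calculus)
    fix v :: real assume v: "v \<in> {0..1}"
    have "((\<lambda>v. arctan (sqrt c * v) / sqrt c) has_real_derivative (inverse (1 + (sqrt c * v)^2) * sqrt c / sqrt c)) (at v within {0..1})"
      using assms by (auto intro!: derivative_eq_intros simp: mult.assoc)
    also have "inverse (1 + (sqrt c * v)^2) * sqrt c / sqrt c = 1 / (1 + c * v powr 2)"
      using assms v by (simp add: power_mult_distrib inverse_eq_divide powr_numeral)
    finally show "((\<lambda>v. arctan (sqrt c * v) / sqrt c) has_vector_derivative 1 / (1 + c * v powr 2)) (at v within {0..1})"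
      by (simp add: has_real_derivative_iff_has_vector_derivative)
  qed simp
  then show ?thesis by (simp add: integral_unique)
qed

section \<open>The path-loss integral over the exterior of the disc of radius
  \<open>r0\<close>\<close>

lemma kernel_integral:
  fixes c p y :: real
  assumes c: "0 < c" and p: "0 < p"
  defines "h \<equiv> \<lambda>v. 1 / (1 + c * v powr p)"
  shows "continuous_on {0..y} h" and "0 \<le> integral {0..y} h" and "0 \<le> y \<Longrightarrow> integral {0..y} h \<le> y"
proof -
  have pos: "0 < 1 + c * v powr p" for v using c by (simp add: add_pos_nonneg)
  have "1 + c * v powr p \<noteq> 0" for v using pos[of v] by simp
  then show cont: "continuous_on {0..y} h"
    unfolding h_def by (intro continuous_intros continuous_on_powr_unit p ballI)
  have i: "h integrable_on {0..y}" by (rule integrable_continuous_real[OF cont])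
  show "0 \<le> integral {0..y} h"
    by (rule integral_nonneg[OF i]) (use pos in \<open>simp add: h_def less_imp_le\<close>)
  have "integral {0..y} h \<le> integral {0..y} (\<lambda>_. 1)"
    by (intro integral_le i integrable_const_ivl) (use c in \<open>simp add: h_def divide_le_eq_1_pos[OF pos]\<close>)
  then show "integral {0..y} h \<le> y" if "0 \<le> y" using that by simp
qed

text \<open>With \<open>u = (norm x)^2\<close> the planar integral becomes one-dimensional, and
  \<open>v = (u / r0^2) powr (1 - \<eta> / 2)\<close> maps the half-line from \<open>r0^2\<close>
  onto the interval from \<open>1\<close> down to \<open>0\<close>, which produces Euler's integral.
  The factor \<open>r0 powr \<eta>\<close> makes \<open>c\<close> the normalised strength at the
  edge \<open>norm x = r0\<close>.\<close>

lemma nn_integral_path_loss: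
  fixes r0 \<eta> c :: real
  assumes r0: "0 < r0" and \<eta>: "2 < \<eta>" and c: "0 < c"
  shows "(\<integral>\<^sup>+x. ennreal (1 - 1 / (1 + c * r0 powr \<eta> * norm (x :: real^2) powr (- \<eta>))) * indicator {x. r0 < norm x} x \<partial>lborel) =
    ennreal (2 * pi * r0^2 * c / (\<eta> - 2) * integral {0..1} (\<lambda>v. 1 / (1 + c * v powr (\<eta> / (\<eta> - 2)))))"
proof -
  let ?y = "\<lambda>u. (u / r0^2) powr (1 - \<eta> / 2)"
  let ?z = "\<lambda>u. (u / r0^2) powr (- \<eta> / 2)"
  \<comment> \<open>The exponent is chosen so that \<open>?y u powr ?p = ?z u\<close>;
    \<open>?K\<close> cancels the inner derivative of \<open>?y\<close> and leaves the factor
    \<open>c\<close>.\<close>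
  let ?p = "\<eta> / (\<eta> - 2)" and ?K = "2 * r0^2 * c / (\<eta> - 2)"
  let ?h = "\<lambda>v. 1 / (1 + c * v powr ?p)"
  define H where "H y = integral {0..y} ?h" for y
  define f where "f u = c * ?z u / (1 + c * ?z u)" for u
  define F where "F u = - ?K * H (?y u)" for u
  have p: "0 < ?p" using \<eta> by simp
  have pos: "0 < 1 + c * v powr a" for v a :: real using c by (smt (verit) mult_nonneg_nonneg powr_ge_zero)
  have H_deriv: "(H has_real_derivative ?h y) (at y)" if "0 < y" for y
  proof -
    have "(H has_real_derivative ?h y) (at y within {0..y + 1})"
      unfolding H_def by (rule integral_has_real_derivative[OF kernel_integral(1)[OF c p]]) (use that in auto)
    then show ?thesis using that by (subst (asm) at_within_interior) auto
  qed
  have H_bounds: "0 \<le> H y" "H y \<le> y" if "0 \<le> y" for y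
    using kernel_integral(2,3)[OF c p, of y] that by (auto simp: H_def)
  have r02: "0 < r0^2" using r0 by simp
  have F_deriv: "(F has_real_derivative f u) (at u)" if u: "r0^2 \<le> u" for u
  proof -
    have u0: "0 < u" using u r02 by linarith
    have ur: "0 < u / r0^2" using u0 r02 by simp
    have "((\<lambda>u. (u / r0^2) powr (1 - \<eta> / 2)) has_real_derivative ((1 - \<eta> / 2) * (u / r0^2) powr (1 - \<eta> / 2 - 1) * (1 / r0^2))) (at u)"
      by (rule DERIV_chain2[where f="\<lambda>z. z powr (1 - \<eta> / 2)" and g="\<lambda>u. u / r0^2", OF has_real_derivative_powr[OF ur]])
        (rule DERIV_cdivide[OF DERIV_ident])
    then have "((\<lambda>u. H (?y u)) has_real_derivative
       (?h (?y u) * ((1 - \<eta> / 2) * (u / r0^2) powr (1 - \<eta> / 2 - 1) * (1 / r0^2)))) (at u)"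
      by (intro DERIV_chain2[OF H_deriv]) (use ur in auto)
    then have "(F has_real_derivative - ?K *
       (?h (?y u) * ((1 - \<eta> / 2) * (u / r0^2) powr (1 - \<eta> / 2 - 1) * (1 / r0^2)))) (at u)"
      unfolding F_def by (rule DERIV_cmult)
    also have "(?y u) powr ?p = ?z u"
    proof -
      have "(1 - \<eta> / 2) * ?p = - \<eta> / 2" using \<eta> by (simp add: field_simps)
      then show ?thesis by (simp only: powr_powr)
    qed
    also have "1 - \<eta> / 2 - 1 = - \<eta> / 2" by simp
    also have "- ?K * (1 / (1 + c * ?z u) * ((1 - \<eta> / 2) * ?z u * (1 / r0^2))) =
      (- ?K * (1 - \<eta> / 2) * (1 / r0^2)) * (?z u * (1 / (1 + c * ?z u)))"
      by (simp only: mult_ac)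
    also have "- ?K * (1 - \<eta> / 2) * (1 / r0^2) = c" using r0 \<eta> by (simp add: field_simps)
    also have "c * (?z u * (1 / (1 + c * ?z u))) = f u"
      by (simp add: f_def)
    finally show ?thesis .
  qed
  have F_lim: "(F \<longlongrightarrow> 0) at_top"
  proof -
    have y: "((\<lambda>u. (u / r0^2) powr (1 - \<eta> / 2)) \<longlongrightarrow> 0) at_top"
    proof (rule tendsto_neg_powr)
      have "filterlim (\<lambda>u. (1 / r0^2) * u) at_top at_top"
        by (rule filterlim_tendsto_pos_mult_at_top[OF tendsto_const _ filterlim_ident]) (use r02 in simp)
      then show "filterlim (\<lambda>u. u / r0^2) at_top at_top" by simp
    qed (use \<eta> in simp)
    have "((\<lambda>u. H (?y u)) \<longlongrightarrow> 0) at_top"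
      by (rule tendsto_sandwich[OF _ _ tendsto_const y]) (auto intro!: always_eventually H_bounds)
    then have "(F \<longlongrightarrow> - ?K * 0) at_top" unfolding F_def by (intro tendsto_intros)
    then show ?thesis by simp
  qed
  have f_nonneg: "0 \<le> f u" for u unfolding f_def using c pos[of "u / r0^2" "- \<eta> / 2"] by (auto intro!: divide_nonneg_nonneg)
  have [measurable]: "f \<in> borel_measurable borel" unfolding f_def by measurable
  have "(\<integral>\<^sup>+x. ennreal (1 - 1 / (1 + c * r0 powr \<eta> * norm (x :: real^2) powr (- \<eta>))) * indicator {x. r0 < norm x} x \<partial>lborel) =
     (\<integral>\<^sup>+x. ennreal (f ((norm (x :: real^2))^2)) * indicator {r0^2<..} ((norm x)^2) \<partial>lborel)"
  proof (rule nn_integral_cong)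
    fix x :: "real^2"
    have eq: "1 - 1 / (1 + c * r0 powr \<eta> * norm x powr (- \<eta>)) = f ((norm x)^2)" if "r0 < norm x"
    proof -
      have "((norm x)^2 / r0^2) powr (- \<eta> / 2) = ((norm x / r0) powr 2) powr (- \<eta> / 2)"
        using r0 that by (simp add: power_divide powr_numeral)
      also have "\<dots> = (norm x / r0) powr (- \<eta>)" by (simp add: powr_powr)
      also have "\<dots> = r0 powr \<eta> * norm x powr (- \<eta>)"
        using r0 that by (simp add: powr_divide powr_minus_divide[of r0])
      finally have *: "c * ((norm x)^2 / r0^2) powr (- \<eta> / 2) = c * r0 powr \<eta> * norm x powr (- \<eta>)" by simp
      have "1 - 1 / (1 + A) = A / (1 + A)" if "0 < 1 + A" for A :: real using that by (simp add: field_simps)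
      from this[OF pos[of "(norm x)^2 / r0^2" "- \<eta> / 2"]] show ?thesis unfolding f_def * .
    qed
    have "r0^2 < (norm x)^2 \<longleftrightarrow> r0 < norm x" using r0 by (auto intro: power2_less_imp_less power_strict_mono)
    then show "ennreal (1 - 1 / (1 + c * r0 powr \<eta> * norm x powr (- \<eta>))) * indicator {x. r0 < norm x} x =
      ennreal (f ((norm x)^2)) * indicator {r0^2<..} ((norm x)^2)"
      using eq by (auto simp: indicator_def)
  qed
  also have "\<dots> = ennreal pi * (\<integral>\<^sup>+u. (ennreal (f u) * indicator {r0^2<..} u) * indicator {0..} u \<partial>lborel)"
    by (rule nn_integral_norm_square[where F="\<lambda>u. ennreal (f u) * indicator {r0^2<..} u"]) auto
  also have "(\<integral>\<^sup>+u. (ennreal (f u) * indicator {r0^2<..} u) * indicator {0..} u \<partial>lborel) = (\<integral>\<^sup>+u. ennreal (f u) * indicator {r0^2..} u \<partial>lborel)"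
  proof (rule nn_integral_cong_AE, rule AE_I[where N="{r0^2}"])
    have "0 \<le> u" if "r0^2 \<le> u" for u using r02 that by linarith
    then show "{u \<in> space lborel. ennreal (f u) * indicator {r0^2<..} u * indicator {0..} u \<noteq> ennreal (f u) * indicator {r0^2..} u} \<subseteq> {r0^2}"
      by (auto simp: indicator_def)
  qed auto
  also have "\<dots> = ennreal (0 - F (r0^2))"
    by (rule nn_integral_FTC_atLeast) (auto intro: F_deriv f_nonneg F_lim)
  also have "ennreal pi * ennreal (0 - F (r0^2)) = ennreal (pi * (?K * H 1))"
    using r0 by (subst ennreal_mult'[symmetric]) (auto simp: F_def)
  also have "pi * (?K * H 1) = 2 * pi * r0^2 * c / (\<eta> - 2) * integral {0..1} ?h" by (simp add: H_def)
  finally show ?thesis .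
qed


section \<open>Nearest points of the constellation\<close>

text \<open>Half the distance between neighbouring points, and thus the distance from a point to its
  decision thresholds.\<close>

definition qam_scale :: "nat \<Rightarrow> real" where
  "qam_scale M = sqrt (3 / (2 * (real M - 1)))"

definition qam_point :: "nat \<Rightarrow> nat \<times> nat \<Rightarrow> complex" where
  "qam_point m p = complex_of_real (qam_scale (m^2)) * Complex (2 * real (fst p) - real m - 1) (2 * real (snd p) - real m - 1)"

lemma qam_eq_image: "qam (m^2) = qam_point m ` ({1..m} \<times> {1..m})"
proof -
  have "sqrt (real (m^2)) = real m" by simp
  then have "qam (m^2) = {qam_point m (a, b) | a b. a \<in> {1..m} \<and> b \<in> {1..m}}"
    unfolding qam_def qam_point_def qam_scale_def by (simp only: of_nat_le_iff atLeastAtMost_iff conj_assoc fst_conv snd_conv)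
  also have "\<dots> = qam_point m ` ({1..m} \<times> {1..m})"
  proof -
    have "{f (a, b) | a b. a \<in> A \<and> b \<in> B} = f ` (A \<times> B)" for f :: "nat \<times> nat \<Rightarrow> complex" and A B
      by force
    then show ?thesis .
  qed
  finally show ?thesis .
qed

lemma qam_scale_pos: "2 \<le> m \<Longrightarrow> 0 < qam_scale (m^2)"
proof -
  assume "2 \<le> m"
  then have "1 < real (m^2)" by (simp add: one_less_power)
  then show ?thesis by (simp add: qam_scale_def)
qed

lemma inj_qam_point: "2 \<le> m \<Longrightarrow> inj (qam_point m)"
  using qam_scale_pos[of m] by (auto simp: inj_def qam_point_def prod_eq_iff)

lemma finite_qam: "finite (qam (m^2))"
  by (simp add: qam_eq_image)

lemma card_qam: "2 \<le> m \<Longrightarrow> card (qam (m^2)) = m^2"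
  unfolding qam_eq_image by (subst card_image) (auto intro: inj_on_subset[OF inj_qam_point] simp: power2_eq_square)

text \<open>The squares differ by \<open>4 * k * d * (x + k * d)\<close>, which is positive when
  \<open>x\<close> has not crossed the threshold on the side given by the sign of \<open>d\<close>;
  a larger \<open>d\<close> in modulus only helps.\<close>

lemma shift_square_less:
  fixes x k d :: real
  assumes k: "0 < k" and d: "1 \<le> d \<and> - k < x \<or> d \<le> - 1 \<and> x < k"
  shows "x^2 < (x + 2 * k * d)^2"
proof -
  have "0 < d * (x + k * d)"
  proof (cases "1 \<le> d")
    case True
    then have "k * 1 \<le> k * d" using k by (intro mult_left_mono) auto
    with True d show ?thesis by (intro mult_pos_pos) auto
  next
    case False
    with d have d: "d \<le> - 1" "x < k" by auto
    then have "k * d \<le> k * (- 1)" using k by (intro mult_left_mono) auto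
    with d show ?thesis by (intro mult_neg_neg) auto
  qed
  then have "0 < 4 * k * (d * (x + k * d))" using k by simp
  then show ?thesis by (simp add: power2_eq_square algebra_simps)
qed

lemma qam_point_diff:
  "T + qam_point m (a, b) - qam_point m (a', b') =
    Complex (Re T + 2 * qam_scale (m^2) * (real a - real a')) (Im T + 2 * qam_scale (m^2) * (real b - real b'))"
  by (simp add: complex_eq_iff qam_point_def algebra_simps)

text \<open>\<open>T\<close> plays the role of the disturbance divided by the gain. Squared
  distances add over the coordinates: a coordinate in which the two points agree contributes
  equally, every other one strictly more.\<close>

lemma qam_nearest_strict:
  fixes T :: complex
  assumes m: "2 \<le> m" and ab: "a \<in> {1..m}" "b \<in> {1..m}"
    and Re: "a < m \<longrightarrow> Re T < qam_scale (m^2)" "1 < a \<longrightarrow> - qam_scale (m^2) < Re T"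
    and Im: "b < m \<longrightarrow> Im T < qam_scale (m^2)" "1 < b \<longrightarrow> - qam_scale (m^2) < Im T"
    and s: "s \<in> qam (m^2)" "s \<noteq> qam_point m (a, b)"
  shows "cmod T < cmod (T + qam_point m (a, b) - s)"
proof -
  let ?k = "qam_scale (m^2)"
  have k: "0 < ?k" using m by (rule qam_scale_pos)
  have one: "x^2 < (x + 2 * ?k * (real i - real i'))^2"
    if "i \<in> {1..m}" "i' \<in> {1..m}" "i < m \<longrightarrow> x < ?k" "1 < i \<longrightarrow> - ?k < x" "i \<noteq> i'" for x i i'
    using that by (intro shift_square_less k) (cases "i' < i"; auto)
  obtain a' b' where s': "s = qam_point m (a', b')" "a' \<in> {1..m}" "b' \<in> {1..m}"
    using s(1) by (auto simp: qam_eq_image)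
  with s(2) have ne: "a \<noteq> a' \<or> b \<noteq> b'" by auto
  have "(cmod T)^2 < (cmod (T + qam_point m (a, b) - s))^2"
    unfolding s' qam_point_diff cmod_power2 complex.sel
    using ne one[OF ab(1) s'(2) Re] one[OF ab(2) s'(3) Im]
    by (cases "a = a'"; cases "b = b'") auto
  then show ?thesis by (rule power2_less_imp_less) simp
qed

text \<open>Comparison with the at most four adjacent points already yields all bounds.\<close>

lemma qam_nearest_weak:
  fixes T :: complex
  assumes m: "2 \<le> m" and ab: "a \<in> {1..m}" "b \<in> {1..m}"
    and near: "\<And>s. s \<in> qam (m^2) \<Longrightarrow> cmod T \<le> cmod (T + qam_point m (a, b) - s)"
  shows "a < m \<longrightarrow> Re T \<le> qam_scale (m^2)" "1 < a \<longrightarrow> - qam_scale (m^2) \<le> Re T"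
    "b < m \<longrightarrow> Im T \<le> qam_scale (m^2)" "1 < b \<longrightarrow> - qam_scale (m^2) \<le> Im T"
proof -
  let ?k = "qam_scale (m^2)"
  have k: "0 < ?k" using m by (rule qam_scale_pos)
  have near': "(Re T)^2 + (Im T)^2 \<le> (Re T + 2 * ?k * (real a - real a'))\<^sup>2 + (Im T + 2 * ?k * (real b - real b'))^2"
    if "a' \<in> {1..m}" "b' \<in> {1..m}" for a' b'
  proof -
    have "cmod T \<le> cmod (T + qam_point m (a, b) - qam_point m (a', b'))"
      using that by (intro near) (auto simp: qam_eq_image)
    then have "(cmod T)^2 \<le> (cmod (T + qam_point m (a, b) - qam_point m (a', b')))\<^sup>2" by (rule power_mono) simp
    then show ?thesis unfolding qam_point_diff cmod_power2 complex.sel .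
  qed
  have up: "x \<le> ?k" if "x^2 \<le> (x - 2 * ?k)\<^sup>2" for x
  proof -
    have "0 \<le> 4 * ?k * (?k - x)" using that by (simp add: power2_eq_square algebra_simps)
    then show ?thesis using k by (simp add: zero_le_mult_iff)
  qed
  have down: "- ?k \<le> x" if "x^2 \<le> (x + 2 * ?k)\<^sup>2" for x
    using up[of "- x"] that by (simp add: power2_eq_square algebra_simps)
  have "real a - real (a - 1) = 1" if "1 < a" for a using that by (simp add: of_nat_diff)
  then show "1 < a \<longrightarrow> - ?k \<le> Re T" "1 < b \<longrightarrow> - ?k \<le> Im T"
    using near'[of "a - 1" b] near'[of a "b - 1"] ab by (intro impI down; force)+
  have "real a - real (Suc a) = - 1" for a by simp
  then show "a < m \<longrightarrow> Re T \<le> ?k" "b < m \<longrightarrow> Im T \<le> ?k"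
    using near'[of "Suc a" b] near'[of a "Suc b"] ab by (intro impI up; force)+
qed

section \<open>Probabilities of the decision regions\<close>

text \<open>A boundary level has only one neighbour, so it can be left on one side only.\<close>

definition level_prob :: "nat \<Rightarrow> real \<Rightarrow> nat \<Rightarrow> real" where
  "level_prob m e a = 1 - (of_bool (a < m) + of_bool (1 < a)) * e / 2"

lemma level_prob_nonneg: "e \<le> 1 \<Longrightarrow> 0 \<le> level_prob m e a"
  by (auto simp: level_prob_def of_bool_def)

text \<open>Exactly one of the \<open>m\<close> levels has no upper neighbour and exactly one no
  lower neighbour, so each of the two indicators sums to \<open>m - 1\<close>.\<close>

lemma sum_level_prob: "1 \<le> m \<Longrightarrow> (\<Sum>a=1..m. level_prob m e a) = real m - (real m - 1) * e"
proof -
  assume m: "1 \<le> m"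
  have "(\<Sum>a=1..m. of_bool (a < m) :: real) = real (card {a \<in> {1..m}. a < m})"
    by (simp add: Int_def)
  also have "{a \<in> {1..m}. a < m} = {1..<m}" by auto
  finally have 1: "(\<Sum>a=1..m. of_bool (a < m) :: real) = real m - 1" using m by (simp add: of_nat_diff)
  have "(\<Sum>a=1..m. of_bool (1 < a) :: real) = real (card {a \<in> {1..m}. 1 < a})"
    by (simp add: Int_def)
  also have "{a \<in> {1..m}. 1 < a} = {1<..m}" by auto
  finally have 2: "(\<Sum>a=1..m. of_bool (1 < a) :: real) = real m - 1" using m by (simp add: of_nat_diff)
  have "(\<Sum>a=1..m. level_prob m e a) = real m - ((\<Sum>a=1..m. of_bool (a < m)) + (\<Sum>a=1..m. of_bool (1 < a))) * e / 2"
    by (simp only: level_prob_def sum_subtractf sum.distrib sum_distrib_right[symmetric] sum_divide_distrib[symmetric])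
       (simp del: sum_of_bool_eq)
  then show ?thesis unfolding 1 2 by simp
qed

text \<open>The complement consists of at most two tails, disjoint because \<open>k > 0\<close>,
  each of mass half of the \<open>erfc\<close> value.\<close>

lemma rgauss_band:
  assumes u: "0 < u" and k: "0 < k"
  shows "emeasure (rgauss u) {x. (a < m \<longrightarrow> x < k) \<and> (1 < a \<longrightarrow> - k < x)} = ennreal (level_prob m (erfc (k / sqrt u)) a)"
    and "emeasure (rgauss u) {x. (a < m \<longrightarrow> x \<le> k) \<and> (1 < a \<longrightarrow> - k \<le> x)} = ennreal (level_prob m (erfc (k / sqrt u)) a)"
proof -
  interpret G: prob_space "rgauss u" using u by (rule prob_space_rgauss)
  have e: "measure (rgauss u) {k<..} = erfc (k / sqrt u) / 2" "measure (rgauss u) {k..} = erfc (k / sqrt u) / 2"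
    "measure (rgauss u) {..< - k} = erfc (k / sqrt u) / 2" "measure (rgauss u) {.. - k} = erfc (k / sqrt u) / 2"
    using emeasure_rgauss_tail[OF u, of k] by (auto simp: measure_def erfc_nonneg)
  have compl: "measure (rgauss u) (UNIV - (A \<union> B)) = 1 - (measure (rgauss u) A + measure (rgauss u) B)"
    if "A \<inter> B = {}" "A \<in> sets borel" "B \<in> sets borel" for A B
    using G.prob_compl[of "A \<union> B"] G.finite_measure_Union[of A B] that by simp
  have 1: "{x. (a < m \<longrightarrow> x < k) \<and> (1 < a \<longrightarrow> - k < x)} = UNIV - ((if a < m then {k..} else {}) \<union> (if 1 < a then {.. - k} else {}))"
    by (auto simp: not_le)
  have 2: "{x. (a < m \<longrightarrow> x \<le> k) \<and> (1 < a \<longrightarrow> - k \<le> x)} = UNIV - ((if a < m then {k<..} else {}) \<union> (if 1 < a then {..< - k} else {}))"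
    by (auto simp: not_less)
  show "emeasure (rgauss u) {x. (a < m \<longrightarrow> x < k) \<and> (1 < a \<longrightarrow> - k < x)} = ennreal (level_prob m (erfc (k / sqrt u)) a)"
    unfolding 1 G.emeasure_eq_measure using k by (subst compl) (auto simp: e level_prob_def)
  show "emeasure (rgauss u) {x. (a < m \<longrightarrow> x \<le> k) \<and> (1 < a \<longrightarrow> - k \<le> x)} = ennreal (level_prob m (erfc (k / sqrt u)) a)"
    unfolding 2 G.emeasure_eq_measure using k by (subst compl) (auto simp: e level_prob_def)
qed

text \<open>The two predicates differ by ties, which the detector may break at will; they turn out to have
  the same probability.\<close>

definition nearest_strict :: "nat \<Rightarrow> complex \<Rightarrow> complex \<Rightarrow> complex \<Rightarrow> bool" where
  "nearest_strict m g \<sigma> V \<longleftrightarrow> (\<forall>s\<in>qam (m^2). s \<noteq> \<sigma> \<longrightarrow> cmod V < cmod (V + g * \<sigma> - g * s))"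

definition nearest_weak :: "nat \<Rightarrow> complex \<Rightarrow> complex \<Rightarrow> complex \<Rightarrow> bool" where
  "nearest_weak m g \<sigma> V \<longleftrightarrow> (\<forall>s\<in>qam (m^2). cmod V \<le> cmod (V + g * \<sigma> - g * s))"

lemma measurable_nearest [measurable (raw)]:
  assumes [measurable]: "g \<in> borel_measurable M" "\<sigma> \<in> borel_measurable M" "V \<in> borel_measurable M"
  shows "Measurable.pred M (\<lambda>x. nearest_strict m (g x) (\<sigma> x) (V x))"
    and "Measurable.pred M (\<lambda>x. nearest_weak m (g x) (\<sigma> x) (V x))"
  unfolding nearest_strict_def nearest_weak_def by (auto intro!: pred_intros_finite finite_qam) measurable

text \<open>Dividing by \<open>g\<close> changes the variance to \<open>v / (cmod g)^2\<close>. The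
  open rectangle is contained in the strict region, this in the weak region, and that in the closed
  rectangle; the two rectangles have the same probability, so all four agree.\<close>

lemma emeasure_nearest:
  assumes m: "2 \<le> m" and ab: "a \<in> {1..m}" "b \<in> {1..m}" and g: "g \<noteq> 0" and v: "0 < v"
  defines "e \<equiv> erfc (qam_scale (m^2) * cmod g / sqrt v)"
  shows "emeasure (cgauss v) {V. nearest_strict m g (qam_point m (a, b)) V} = ennreal (level_prob m e a * level_prob m e b)"
    and "emeasure (cgauss v) {V. nearest_weak m g (qam_point m (a, b)) V} = ennreal (level_prob m e a * level_prob m e b)"
proof -
  let ?p = "ennreal (level_prob m e a * level_prob m e b)"
  let ?k = "qam_scale (m^2)" and ?u = "v / (cmod g)^2" and ?\<sigma> = "qam_point m (a, b)"
  have k: "0 < ?k" using m by (rule qam_scale_pos)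
  have u: "0 < ?u" using g v by simp
  have "cgauss v = distr (cgauss ?u) borel (\<lambda>z. g * z)"
    using cgauss_mult[OF u g] g by simp
  then have pull: "emeasure (cgauss v) {V. Q V} = emeasure (cgauss ?u) {T. Q (g * T)}"
    if "Measurable.pred borel Q" for Q
    using that by (simp add: emeasure_distr vimage_def)
  have e: "e = erfc (?k / sqrt ?u)" using g by (simp add: e_def real_sqrt_divide)
  have e1: "e \<le> 1" unfolding e using k u by (intro erfc_le_1) simp
  have fac: "g * T + g * ?\<sigma> - g * s = g * (T + ?\<sigma> - s)" for T s by (simp add: algebra_simps)
  have scale: "nearest_strict m g ?\<sigma> (g * T) \<longleftrightarrow> (\<forall>s\<in>qam (m^2). s \<noteq> ?\<sigma> \<longrightarrow> cmod T < cmod (T + ?\<sigma> - s))"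
    "nearest_weak m g ?\<sigma> (g * T) \<longleftrightarrow> (\<forall>s\<in>qam (m^2). cmod T \<le> cmod (T + ?\<sigma> - s))" for T
    unfolding nearest_strict_def nearest_weak_def fac norm_mult using g by auto
  let ?O = "\<lambda>i. {x. (i < m \<longrightarrow> x < ?k) \<and> (1 < i \<longrightarrow> - ?k < x)}"
  let ?C = "\<lambda>i. {x. (i < m \<longrightarrow> x \<le> ?k) \<and> (1 < i \<longrightarrow> - ?k \<le> x)}"
  have [measurable]: "?O i \<in> sets borel" "?C i \<in> sets borel" for i by measurable
  have rect: "emeasure (cgauss ?u) {z. Re z \<in> ?O a \<and> Im z \<in> ?O b} = ?p"
    "emeasure (cgauss ?u) {z. Re z \<in> ?C a \<and> Im z \<in> ?C b} = ?p"
    using level_prob_nonneg[OF e1]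
    by (simp_all only: emeasure_cgauss_Times[OF u] rgauss_band[OF u k] e[symmetric] ennreal_mult
         \<open>\<And>i. ?O i \<in> sets borel\<close> \<open>\<And>i. ?C i \<in> sets borel\<close>)
  have sub: "{z. Re z \<in> ?O a \<and> Im z \<in> ?O b} \<subseteq> {T. nearest_strict m g ?\<sigma> (g * T)}"
    "{T. nearest_strict m g ?\<sigma> (g * T)} \<subseteq> {T. nearest_weak m g ?\<sigma> (g * T)}"
    "{T. nearest_weak m g ?\<sigma> (g * T)} \<subseteq> {z. Re z \<in> ?C a \<and> Im z \<in> ?C b}"
  proof -
    show "{z. Re z \<in> ?O a \<and> Im z \<in> ?O b} \<subseteq> {T. nearest_strict m g ?\<sigma> (g * T)}"
      unfolding scale using qam_nearest_strict[OF m ab] by blast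
    show "{T. nearest_strict m g ?\<sigma> (g * T)} \<subseteq> {T. nearest_weak m g ?\<sigma> (g * T)}"
    proof safe
      fix T assume *: "nearest_strict m g ?\<sigma> (g * T)"
      show "nearest_weak m g ?\<sigma> (g * T)" unfolding scale
      proof
        fix s assume "s \<in> qam (m^2)"
        then show "cmod T \<le> cmod (T + ?\<sigma> - s)" using *[unfolded scale] by (cases "s = ?\<sigma>") (auto simp: less_imp_le)
      qed
    qed
    show "{T. nearest_weak m g ?\<sigma> (g * T)} \<subseteq> {z. Re z \<in> ?C a \<and> Im z \<in> ?C b}"
      unfolding scale using qam_nearest_weak[OF m ab] by blast
  qed
  have [measurable]: "{T. nearest_strict m g ?\<sigma> (g * T)} \<in> sets borel" "{T. nearest_weak m g ?\<sigma> (g * T)} \<in> sets borel"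
    by measurable
  have le: "emeasure (cgauss ?u) {z. Re z \<in> ?O a \<and> Im z \<in> ?O b} \<le> emeasure (cgauss ?u) {T. nearest_strict m g ?\<sigma> (g * T)}"
    "emeasure (cgauss ?u) {T. nearest_strict m g ?\<sigma> (g * T)} \<le> emeasure (cgauss ?u) {T. nearest_weak m g ?\<sigma> (g * T)}"
    "emeasure (cgauss ?u) {T. nearest_weak m g ?\<sigma> (g * T)} \<le> emeasure (cgauss ?u) {z. Re z \<in> ?C a \<and> Im z \<in> ?C b}"
    by (intro emeasure_mono sub; simp)+
  have strict: "emeasure (cgauss v) {V. nearest_strict m g ?\<sigma> V} = emeasure (cgauss ?u) {T. nearest_strict m g ?\<sigma> (g * T)}"
    by (rule pull) measurable
  have weak: "emeasure (cgauss v) {V. nearest_weak m g ?\<sigma> V} = emeasure (cgauss ?u) {T. nearest_weak m g ?\<sigma> (g * T)}"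
    by (rule pull) measurable
  show "emeasure (cgauss v) {V. nearest_strict m g ?\<sigma> V} = ?p"
    "emeasure (cgauss v) {V. nearest_weak m g ?\<sigma> V} = ?p"
    using le unfolding strict weak rect by (auto intro: antisym order_trans)
qed


section \<open>Independence of the sources of randomness\<close>

text \<open>A positive infimum \<open>q\<close> would bound the partial sums by
  \<open>- ln q / c\<close>. The dichotomy allows the Laplace transform to be computed before the
  series is known to converge.\<close>

lemma inf_prod_exp:
  assumes a: "\<And>k. 0 \<le> a k" and c: "0 < c"
  shows "summable a \<Longrightarrow> inf_prod (\<lambda>k. exp (- (c * a k))) = ennreal (exp (- (c * suminf a)))"
    and "\<not> summable a \<Longrightarrow> inf_prod (\<lambda>k. exp (- (c * a k))) = 0"
proof -
  let ?f = "\<lambda>k. exp (- (c * a k))"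
  have prod: "(\<Prod>k<n. exp (- (c * a k))) = exp (- (c * (\<Sum>k<n. a k)))" for n
    by (simp add: exp_sum[symmetric] sum_negf sum_distrib_left)
  have unit: "0 \<le> exp (- (c * a k))" "exp (- (c * a k)) \<le> 1" for k using a[of k] c by auto
  show "inf_prod ?f = ennreal (exp (- (c * suminf a)))" if "summable a"
    by (rule inf_prod_eqI[OF unit], unfold prod)
       (intro tendsto_intros summable_LIMSEQ that)
  show "inf_prod ?f = 0" if ns: "\<not> summable a"
  proof (rule ccontr)
    assume nz: "inf_prod ?f \<noteq> 0"
    have "inf_prod ?f < top" using inf_prod_le_1 by (rule le_less_trans) simp
    then obtain q where q: "inf_prod ?f = ennreal q" "0 \<le> q" by (auto simp: less_top_ennreal)
    with nz have q0: "0 < q" by (cases "q = 0") auto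
    have "(\<Sum>k<n. a k) \<le> - ln q / c" for n
    proof -
      have "ennreal q \<le> ennreal (\<Prod>k<n. exp (- (c * a k)))" unfolding q(1)[symmetric] inf_prod_def by (rule INF_lower) simp
      then have "q \<le> exp (- (c * (\<Sum>k<n. a k)))" unfolding prod by simp
      then have "ln q \<le> - (c * (\<Sum>k<n. a k))" using q0 by (metis exp_gt_zero ln_exp ln_le_cancel_iff)
      then show ?thesis using c by (simp add: field_simps)
    qed
    then have "summable a" by (rule summableI_nonneg_bounded[OF a])
    with ns show False by simp
  qed
qed

abbreviation seq_borel :: "(nat \<Rightarrow> 'a::topological_space) measure" where
  "seq_borel \<equiv> \<Pi>\<^sub>M k\<in>UNIV. borel"

lemma Int_stable_vimage: "Int_stable {f -` A \<inter> S | A. A \<in> sets N}"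
proof (rule Int_stableI, safe)
  fix A B assume AB: "A \<in> sets N" "B \<in> sets N"
  have eq: "(f -` A \<inter> S) \<inter> (f -` B \<inter> S) = f -` (A \<inter> B) \<inter> S" by auto
  show "\<exists>C. (f -` A \<inter> S) \<inter> (f -` B \<inter> S) = f -` C \<inter> S \<and> C \<in> sets N"
    unfolding eq using AB by blast
qed

context prob_space begin

lemma indep_sets_reindex:
  assumes ind: "indep_sets F I" and g: "inj_on g J" "g ` J \<subseteq> I"
  shows "indep_sets (\<lambda>j. F (g j)) J"
proof (rule indep_setsI)
  show "F (g i) \<subseteq> events" if "i \<in> J" for i using ind g(2) that unfolding indep_sets_def by auto
  fix A K assume K: "K \<noteq> {}" "K \<subseteq> J" "finite K" "\<forall>j\<in>K. A j \<in> F (g j)"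
  have inj: "inj_on g K" using g(1) K(2) by (rule inj_on_subset)
  have "prob (\<Inter>i\<in>g ` K. A (inv_into K g i)) = (\<Prod>i\<in>g ` K. prob (A (inv_into K g i)))"
    by (rule indep_setsD[OF ind]) (use K g(2) inj in auto)
  then show "prob (\<Inter>j\<in>K. A j) = (\<Prod>j\<in>K. prob (A j))"
    by (simp add: prod.reindex inj)
qed

text \<open>Disjoint groups of independent, intersection-stable families generate independent
  \<open>\<sigma>\<close>-algebras, so the joint law of \<open>U\<close> and \<open>V\<close> is a
  product and Fubini applies. The second integration uses an independent copy of the sample point
  instead of a conditional expectation.\<close>

lemma nn_integral_indep_sigma:
  assumes ind: "indep_sets F UNIV" and stable: "\<And>i. Int_stable (F i)" and AB: "A \<inter> B = {}"
    and U: "U \<in> measurable (sigma (space M) (\<Union>i\<in>A. F i)) N1"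
    and V: "V \<in> measurable (sigma (space M) (\<Union>i\<in>B. F i)) N2"
    and f [measurable]: "f \<in> borel_measurable (N1 \<Otimes>\<^sub>M N2)"
  shows "(\<integral>\<^sup>+w. f (U w, V w) \<partial>M) = (\<integral>\<^sup>+w. \<integral>\<^sup>+w'. f (U w, V w') \<partial>M \<partial>M)"
proof -
  let ?I = "\<integral>\<^sup>+w. \<integral>\<^sup>+w'. f (U w, V w') \<partial>M \<partial>M" and ?S = "\<lambda>C. sigma_sets (space M) (\<Union>i\<in>C. F i)"
  have F_sub: "F i \<subseteq> events" for i using ind unfolding indep_sets_def by auto
  have Pow: "(\<Union>i\<in>C. F i) \<subseteq> Pow (space M)" for C using F_sub sets.space_closed by blast
  have setsG: "sets (sigma (space M) (\<Union>i\<in>C. F i)) = ?S C"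
    and spaceG: "space (sigma (space M) (\<Union>i\<in>C. F i)) = space M" for C
    using Pow by (auto intro: sets_measure_of space_measure_of)
  have sub: "?S C \<subseteq> events" for C
    by (rule sets.sigma_sets_subset) (use F_sub in blast)
  have [measurable]: "U \<in> measurable M N1" using U sub[of A] unfolding measurable_def spaceG setsG by blast
  have [measurable]: "V \<in> measurable M N2" using V sub[of B] unfolding measurable_def spaceG setsG by blast
  have indep: "indep_set (?S A) (?S B)"
  proof -
    have "indep_sets (\<lambda>j. sigma_sets (space M) (\<Union>i\<in>case_bool A B j. F i)) UNIV"
      by (rule indep_sets_collect_sigma)
         (use AB stable in \<open>auto intro: indep_sets_mono_index[OF _ ind] simp: disjoint_family_on_def split: bool.splits\<close>)
    then show ?thesis unfolding indep_set_def
      by (rule indep_sets_mono_sets) (auto split: bool.split)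
  qed
  interpret D1: prob_space "distr M N1 U" by (rule prob_space_distr) measurable
  interpret D2: prob_space "distr M N2 V" by (rule prob_space_distr) measurable
  have dist: "distr M N1 U \<Otimes>\<^sub>M distr M N2 V = distr M (N1 \<Otimes>\<^sub>M N2) (\<lambda>w. (U w, V w))"
  proof (rule pair_measure_eqI)
    fix S T assume "S \<in> sets (distr M N1 U)" "T \<in> sets (distr M N2 V)"
    then have ST [measurable]: "S \<in> sets N1" "T \<in> sets N2" by auto
    have "U -` S \<inter> space M \<in> ?S A" "V -` T \<inter> space M \<in> ?S B"
      using measurable_sets[OF U ST(1)] measurable_sets[OF V ST(2)] unfolding setsG spaceG .
    then have "prob ((U -` S \<inter> space M) \<inter> (V -` T \<inter> space M)) = prob (U -` S \<inter> space M) * prob (V -` T \<inter> space M)"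
      by (rule indep_setD[OF indep])
    moreover have "(\<lambda>w. (U w, V w)) -` (S \<times> T) \<inter> space M = (U -` S \<inter> space M) \<inter> (V -` T \<inter> space M)" by auto
    ultimately show "emeasure (distr M N1 U) S * emeasure (distr M N2 V) T = emeasure (distr M (N1 \<Otimes>\<^sub>M N2) (\<lambda>w. (U w, V w))) (S \<times> T)"
      by (simp add: emeasure_distr emeasure_eq_measure ennreal_mult)
  qed (auto intro: D1.sigma_finite_measure_axioms D2.sigma_finite_measure_axioms sets_pair_measure_cong)
  have "(\<integral>\<^sup>+w. f (U w, V w) \<partial>M) = (\<integral>\<^sup>+p. f p \<partial>(distr M N1 U \<Otimes>\<^sub>M distr M N2 V))"
    unfolding dist by (subst nn_integral_distr) auto
  also have "\<dots> = (\<integral>\<^sup>+x. \<integral>\<^sup>+y. f (x, y) \<partial>distr M N2 V \<partial>distr M N1 U)"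
    by (rule D2.nn_integral_fst[symmetric]) (simp cong: measurable_cong_sets)
  also have "\<dots> = ?I"
  proof -
    have "(\<integral>\<^sup>+x. \<integral>\<^sup>+y. f (x, y) \<partial>distr M N2 V \<partial>distr M N1 U) = (\<integral>\<^sup>+x. \<integral>\<^sup>+w'. f (x, V w') \<partial>M \<partial>distr M N1 U)"
      by (intro nn_integral_cong nn_integral_distr) auto
    also have "\<dots> = ?I"
      by (rule nn_integral_distr) measurable
    finally show ?thesis .
  qed
  finally show ?thesis .
qed

text \<open>The weight \<open>exp (- u * (cmod z)^2)\<close> merges with the Gaussian density into
  one of variance \<open>1 / (1 + u)\<close>, up to exactly this factor.\<close>

lemma fading_laplace:
  assumes [measurable]: "Z \<in> borel_measurable M" and law: "distr M borel Z = cgauss 1" and u: "0 \<le> u"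
  shows "(\<integral>\<^sup>+w. ennreal (exp (- (u * (cmod (Z w))^2))) \<partial>M) = ennreal (1 / (1 + u))"
proof -
  let ?v = "1 / (1 + u)"
  have v: "0 < ?v" using u by simp
  interpret C: prob_space "cgauss ?v" using v by (rule prob_space_cgauss)
  have "(\<integral>\<^sup>+w. ennreal (exp (- (u * (cmod (Z w))^2))) \<partial>M) = (\<integral>\<^sup>+z. ennreal (exp (- (u * (cmod z)^2))) \<partial>cgauss 1)"
    unfolding law[symmetric] by (subst nn_integral_distr) auto
  also have "\<dots> = (\<integral>\<^sup>+x. \<integral>\<^sup>+y. ennreal (gauss_density 1 x y) * ennreal (exp (- (u * (cmod (Complex x y))^2))) \<partial>lborel \<partial>lborel)"
    by (rule nn_integral_cgauss_density) auto
  also have "\<dots> = (\<integral>\<^sup>+x. \<integral>\<^sup>+y. ennreal ?v * (ennreal (gauss_density ?v x y) * 1) \<partial>lborel \<partial>lborel)"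
  proof (intro nn_integral_cong)
    fix x y :: real
    have "exp (- (x^2 + y^2)) * exp (- (u * (x^2 + y^2))) = exp (- ((x^2 + y^2) / ?v))"
      by (simp add: exp_add[symmetric] algebra_simps)
    then have "gauss_density 1 x y * exp (- (u * (cmod (Complex x y))^2)) = ?v * (gauss_density ?v x y)"
      using u by (simp add: cmod_power2)
    then show "ennreal (gauss_density 1 x y) * ennreal (exp (- (u * (cmod (Complex x y))^2))) =
      ennreal ?v * (ennreal (gauss_density ?v x y) * 1)"
      using u by (subst (1 2) mult_1_right, subst (1 2) ennreal_mult[symmetric]) auto
  qed
  also have "\<dots> = ennreal ?v * (\<integral>\<^sup>+z. 1 \<partial>cgauss ?v)"
    by (subst nn_integral_cgauss_density[OF v], simp, simp add: nn_integral_cmult)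
  finally show ?thesis using C.emeasure_space_1 by simp
qed

end

locale downlink = prob_space M for M :: "'w measure" +
  fixes m :: nat and lam P N0 r0 \<eta> :: real
    and X :: "nat \<Rightarrow> 'w \<Rightarrow> real ^ 2"
    and s0 h0 n :: "'w \<Rightarrow> complex"
    and s h :: "nat \<Rightarrow> 'w \<Rightarrow> complex"
  assumes m: "2 \<le> m"
    and lam: "0 < lam" and P: "0 < P" and N0: "0 < N0" and r0: "0 < r0" and \<eta>: "2 < \<eta>"
    and ppp: "homogeneous_ppp X lam {x. r0 < norm x}"
    and s0: "uniform_on s0 (qam (m^2))"
    and h0: "circular_gaussian h0 1"
    and n: "circular_gaussian n N0"
    and s: "\<And>k. circular_gaussian (s k) 1"
    and h: "\<And>k. circular_gaussian (h k) 1"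
    and indep: "mutually_independent X s0 h0 n s h"
begin

definition source_events :: "source \<Rightarrow> 'w set set" where
  "source_events i = (case i of
          Points \<Rightarrow> {(\<lambda>w k. X k w) -` A \<inter> space M | A. A \<in> sets seq_borel}
        | Useful_Symbol \<Rightarrow> {s0 -` A \<inter> space M | A. A \<in> sets borel}
        | Useful_Fading \<Rightarrow> {h0 -` A \<inter> space M | A. A \<in> sets borel}
        | Noise \<Rightarrow> {n -` A \<inter> space M | A. A \<in> sets borel}
        | Symbol k \<Rightarrow> {s k -` A \<inter> space M | A. A \<in> sets borel}
        | Fading k \<Rightarrow> {h k -` A \<inter> space M | A. A \<in> sets borel})"

definition source_algebra :: "source set \<Rightarrow> 'w measure" where
  "source_algebra A = sigma (space M) (\<Union>i\<in>A. source_events i)"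

lemma indep_sources: "indep_sets source_events UNIV"
  using indep unfolding mutually_independent_def source_events_def .

lemma Int_stable_source_events: "Int_stable (source_events i)"
  unfolding source_events_def by (cases i) (simp_all add: Int_stable_vimage)

lemma measurable_source:
  assumes "{f -` A \<inter> space M | A. A \<in> sets N} \<subseteq> source_events i" "i \<in> A" "f \<in> space M \<rightarrow> space N"
  shows "f \<in> measurable (source_algebra A) N"
proof -
  have F: "source_events i \<subseteq> Pow (space M)" for i
    using indep_sources sets.space_closed unfolding indep_sets_def by auto
  then have P: "(\<Union>i\<in>A. source_events i) \<subseteq> Pow (space M)" by blast
  show ?thesis
  proof (rule measurableI)
    fix S assume S: "S \<in> sets N"
    have "f -` S \<inter> space M \<in> source_events i" using assms(1) S by auto
    then show "f -` S \<inter> space (source_algebra A) \<in> sets (source_algebra A)"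
      using assms(2) P unfolding source_algebra_def by (subst sets_measure_of[OF P], subst space_measure_of[OF P]) auto
  qed (use assms(3) space_measure_of[OF P] in \<open>auto simp: source_algebra_def\<close>)
qed

lemma measurable_X_source: "Points \<in> A \<Longrightarrow> (\<lambda>w k. X k w) \<in> measurable (source_algebra A) seq_borel"
  by (rule measurable_source[of _ _ Points]) (auto simp: source_events_def space_PiM)

lemma measurable_s0_source: "Useful_Symbol \<in> A \<Longrightarrow> s0 \<in> borel_measurable (source_algebra A)"
  by (rule measurable_source[of _ _ Useful_Symbol]) (auto simp: source_events_def)

lemma measurable_h0_source: "Useful_Fading \<in> A \<Longrightarrow> h0 \<in> borel_measurable (source_algebra A)"
  by (rule measurable_source[of _ _ Useful_Fading]) (auto simp: source_events_def)

lemma measurable_n_source: "Noise \<in> A \<Longrightarrow> n \<in> borel_measurable (source_algebra A)"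
  by (rule measurable_source[of _ _ Noise]) (auto simp: source_events_def)

lemma measurable_s_source: "range Symbol \<subseteq> A \<Longrightarrow> (\<lambda>w k. s k w) \<in> measurable (source_algebra A) seq_borel"
  by (rule measurable_PiM_single', rule measurable_source[of _ _ "Symbol _"]) (auto simp: source_events_def)

lemma measurable_h_source: "range Fading \<subseteq> A \<Longrightarrow> (\<lambda>w k. h k w) \<in> measurable (source_algebra A) seq_borel"
  by (rule measurable_PiM_single', rule measurable_source[of _ _ "Fading _"]) (auto simp: source_events_def)

lemmas measurable_sources = measurable_X_source measurable_s0_source measurable_h0_source
  measurable_n_source measurable_s_source measurable_h_source

lemma nn_integral_sources:
  assumes "A \<inter> B = {}" "U \<in> measurable (source_algebra A) N1" "V \<in> measurable (source_algebra B) N2"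
    and "f \<in> borel_measurable (N1 \<Otimes>\<^sub>M N2)"
  shows "(\<integral>\<^sup>+w. f (U w, V w) \<partial>M) = (\<integral>\<^sup>+w. \<integral>\<^sup>+w'. f (U w, V w') \<partial>M \<partial>M)"
  by (rule nn_integral_indep_sigma[OF indep_sources Int_stable_source_events])
     (use assms in \<open>auto simp: source_algebra_def\<close>)

lemma measurable_X [measurable]: "X k \<in> borel_measurable M"
  using ppp by (simp add: homogeneous_ppp_def)

lemma measurable_s0 [measurable]: "s0 \<in> borel_measurable M"
  using s0 by (simp add: uniform_on_def)

lemmas h0_law = circular_gaussian_distr[OF h0, simplified]
lemmas n_law = circular_gaussian_distr[OF n N0]
lemmas s_law = circular_gaussian_distr[OF s, simplified]
lemmas h_law = circular_gaussian_distr[OF h, simplified]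
declare h0_law(1) [measurable] n_law(1) [measurable] s_law(1) [measurable] h_law(1) [measurable]

lemma indep_vars_h: "indep_vars (\<lambda>_. borel) h UNIV"
  unfolding indep_vars_def2
  using indep_sets_reindex[OF indep_sources, of Fading UNIV] h_law(1)
  by (auto simp: source_events_def inj_def)

text \<open>The noise takes index \<open>0\<close> in front of the symbols, so that noise plus
  interference is one Gaussian series whose first coefficient is \<open>1\<close>.\<close>

lemma indep_vars_noise_symbols: "indep_vars (\<lambda>_. borel) (case_nat n s) UNIV"
  unfolding indep_vars_def2
proof (intro conjI ballI)
  show "random_variable borel (case_nat n s j)" for j by (cases j) (auto simp: n_law s_law)
  have inj: "inj (case_nat Noise Symbol)" by (rule injI) (auto split: nat.splits)
  have "(\<lambda>j. source_events (case_nat Noise Symbol j)) = (\<lambda>j. {case_nat n s j -` A \<inter> space M | A. A \<in> sets borel})"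
    by (rule ext) (simp add: source_events_def split: nat.split)
  with indep_sets_reindex[OF indep_sources inj]
  show "indep_sets (\<lambda>j. {case_nat n s j -` A \<inter> space M | A. A \<in> sets borel}) UNIV" by simp
qed

end


section \<open>The interference\<close>

lemma measurable_coordinate:
  assumes "U \<in> measurable N seq_borel"
  shows "(\<lambda>w. U w k) \<in> borel_measurable N"
  by (rule measurable_compose[OF assms measurable_component_singleton[OF UNIV_I, where M="\<lambda>_. borel"]])

lemma measurable_const_seq: "(\<lambda>_. x) \<in> measurable N seq_borel"
  by (rule measurable_const) (simp add: space_PiM)

context downlink begin

text \<open>Times \<open>lam\<close>, this is the negative logarithm of the Laplace transform of the
  interference power sum at \<open>c * r0 powr \<eta>\<close>.\<close>

definition path_exponent :: "real \<Rightarrow> real" where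
  "path_exponent c = 2 * pi * r0^2 * c / (\<eta> - 2) * integral {0..1} (\<lambda>v. 1 / (1 + c * v powr (\<eta> / (\<eta> - 2))))"

definition attenuation :: "(nat \<Rightarrow> real ^ 2) \<Rightarrow> (nat \<Rightarrow> complex) \<Rightarrow> nat \<Rightarrow> real" where
  "attenuation x y k = norm (x k) powr (- \<eta>) * (cmod (y k))^2"

text \<open>A divergent series has an unspecified sum. The \<open>max 0\<close> makes the value
  nonnegative everywhere, so that noise variances are positive at every sample point and not just
  almost surely.\<close>

definition interference :: "(nat \<Rightarrow> real ^ 2) \<Rightarrow> (nat \<Rightarrow> complex) \<Rightarrow> real" where
  "interference x y = max 0 (\<Sum>k. attenuation x y k)"

definition disturbance :: "(nat \<Rightarrow> real ^ 2) \<Rightarrow> (nat \<Rightarrow> complex) \<Rightarrow> (nat \<Rightarrow> complex) \<Rightarrow> complex \<Rightarrow> complex" where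
  "disturbance x y u z = (\<Sum>k. complex_of_real (sqrt P) * u k * y k * complex_of_real (norm (x k) powr (- \<eta> / 2))) + z"

lemma attenuation_nonneg: "0 \<le> attenuation x y k"
  by (simp add: attenuation_def)

lemma interference_nonneg: "0 \<le> interference x y"
  by (simp add: interference_def)

lemma interference_summable: "summable (attenuation x y) \<Longrightarrow> interference x y = suminf (attenuation x y)"
  unfolding interference_def by (simp add: suminf_nonneg attenuation_nonneg max_absorb2)

lemma measurable_attenuation:
  assumes "U \<in> measurable N seq_borel" "V \<in> measurable N seq_borel"
  shows "(\<lambda>w. attenuation (U w) (V w) k) \<in> borel_measurable N"
proof -
  note [measurable] = measurable_coordinate[OF assms(1), of k] measurable_coordinate[OF assms(2), of k]
  show ?thesis unfolding attenuation_def by measurable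
qed

lemma measurable_interference:
  assumes "U \<in> measurable N seq_borel" "V \<in> measurable N seq_borel"
  shows "(\<lambda>w. interference (U w) (V w)) \<in> borel_measurable N"
proof -
  note [measurable] = measurable_attenuation[OF assms]
  show ?thesis unfolding interference_def by measurable
qed

lemma measurable_disturbance:
  assumes "U \<in> measurable N seq_borel" "V \<in> measurable N seq_borel"
    "W \<in> measurable N seq_borel" and [measurable]: "Z \<in> borel_measurable N"
  shows "(\<lambda>w. disturbance (U w) (V w) (W w) (Z w)) \<in> borel_measurable N"
proof -
  note [measurable] = measurable_coordinate[OF assms(1)] measurable_coordinate[OF assms(2)] measurable_coordinate[OF assms(3)]
  show ?thesis unfolding disturbance_def by measurable
qed

lemma measurable_sequences [measurable]:
  "(\<lambda>w k. X k w) \<in> measurable M seq_borel"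
  "(\<lambda>w k. h k w) \<in> measurable M seq_borel"
  "(\<lambda>w k. s k w) \<in> measurable M seq_borel"
  by (auto intro!: measurable_PiM_single')

abbreviation gain :: "'w \<Rightarrow> real" where
  "gain w \<equiv> interference (\<lambda>k. X k w) (\<lambda>k. h k w)"

lemma measurable_gain [measurable]: "gain \<in> borel_measurable M"
  by (intro measurable_interference measurable_sequences)

text \<open>The positions are frozen and only the fading is averaged: independence factorises every
  finite product, and dominated convergence, with bound \<open>1\<close>, passes to the infinite
  one.\<close>

lemma attenuation_laplace:
  assumes t: "0 < t"
  shows "(\<integral>\<^sup>+w. inf_prod (\<lambda>k. exp (- (t * attenuation x (\<lambda>k. h k w) k))) \<partial>M) =
    inf_prod (\<lambda>k. 1 / (1 + t * norm (x k) powr (- \<eta>)))"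
proof -
  let ?\<rho> = "\<lambda>k. norm (x k) powr (- \<eta>)"
  let ?e = "\<lambda>k w. exp (- (t * attenuation x (\<lambda>k. h k w) k))"
  have e: "?e k w = exp (- ((t * ?\<rho> k) * (cmod (h k w))^2))" for k w by (simp add: attenuation_def mult.assoc)
  have unit: "0 \<le> ?e k w" "?e k w \<le> 1" for k w using t attenuation_nonneg by auto
  have \<rho>: "0 \<le> t * ?\<rho> k" for k using t by simp
  have "(\<lambda>N. \<integral>\<^sup>+w. ennreal (\<Prod>k<N. ?e k w) \<partial>M) \<longlonglongrightarrow> (\<integral>\<^sup>+w. inf_prod (\<lambda>k. ?e k w) \<partial>M)"
  proof (rule nn_integral_dominated_convergence[where w="\<lambda>_. 1"])
    show "AE w in M. (\<lambda>N. ennreal (\<Prod>k<N. ?e k w)) \<longlonglongrightarrow> inf_prod (\<lambda>k. ?e k w)"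
      by (intro AE_I2 inf_prod_LIMSEQ unit)
    show "AE w in M. ennreal (\<Prod>k<N. ?e k w) \<le> 1" for N
      using prod_le_1[of "{..<N}" "\<lambda>k. ?e k _"] unit by (intro AE_I2) (simp add: prod_le_1)
    show "(\<lambda>w. inf_prod (\<lambda>k. ?e k w)) \<in> borel_measurable M"
      unfolding inf_prod_def e by measurable
  qed (auto simp: e emeasure_space_1)
  moreover have "(\<integral>\<^sup>+w. ennreal (\<Prod>k<N. ?e k w) \<partial>M) = ennreal (\<Prod>k<N. 1 / (1 + t * ?\<rho> k))" for N
  proof -
    have "(\<integral>\<^sup>+w. ennreal (\<Prod>k<N. ?e k w) \<partial>M) = (\<integral>\<^sup>+w. (\<Prod>k<N. ennreal (?e k w)) \<partial>M)"
      by (simp add: prod_ennreal)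
    also have "\<dots> = (\<Prod>k<N. \<integral>\<^sup>+w. ennreal (?e k w) \<partial>M)"
    proof (rule indep_vars_nn_integral)
      show "indep_vars (\<lambda>_. borel) (\<lambda>k w. ennreal (?e k w)) {..<N}"
        unfolding e by (rule indep_vars_compose2[OF indep_vars_subset[OF indep_vars_h]]) auto
    qed auto
    also have "\<dots> = (\<Prod>k<N. ennreal (1 / (1 + t * ?\<rho> k)))"
      unfolding e by (intro prod.cong refl fading_laplace h_law \<rho>)
    also have "\<dots> = ennreal (\<Prod>k<N. 1 / (1 + t * ?\<rho> k))" using \<rho> by (simp add: prod_ennreal)
    finally show ?thesis .
  qed
  moreover have "(\<lambda>N. ennreal (\<Prod>k<N. 1 / (1 + t * ?\<rho> k))) \<longlonglongrightarrow> inf_prod (\<lambda>k. 1 / (1 + t * ?\<rho> k))"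
    by (rule inf_prod_LIMSEQ) (use \<rho> in \<open>auto simp: divide_le_eq_1 add_nonneg_pos add_pos_nonneg\<close>)
  ultimately show ?thesis by (simp add: LIMSEQ_unique)
qed

lemma path_exponent_bounds:
  assumes "0 < c"
  shows "0 \<le> path_exponent c" "path_exponent c \<le> 2 * pi * r0^2 / (\<eta> - 2) * c"
proof -
  let ?p = "\<eta> / (\<eta> - 2)"
  let ?h = "\<lambda>v. 1 / (1 + c * v powr ?p)"
  have p: "0 < ?p" using \<eta> by simp
  have "0 \<le> integral {0..1} ?h" "integral {0..1} ?h \<le> 1"
    using kernel_integral(2,3)[OF assms p, of 1] by simp_all
  moreover have K: "0 \<le> 2 * pi * r0^2 * c / (\<eta> - 2)" using assms \<eta> by simp
  ultimately show "0 \<le> path_exponent c" "path_exponent c \<le> 2 * pi * r0^2 / (\<eta> - 2) * c"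
    using mult_left_mono[OF _ K, of "integral {0..1} ?h" 1] mult_nonneg_nonneg[OF K, of "integral {0..1} ?h"]
    by (auto simp: path_exponent_def)
qed

text \<open>Averaging the fading first leaves a product over the points, to which the generating
  functional of the Poisson process applies. The left side keeps the product instead of the
  exponential of a sum, because convergence of the sum is deduced from this identity.\<close>

lemma interference_laplace_product:
  assumes c: "0 < c"
  shows "(\<integral>\<^sup>+w. inf_prod (\<lambda>k. exp (- (c * r0 powr \<eta> * attenuation (\<lambda>k. X k w) (\<lambda>k. h k w) k))) \<partial>M) =
    ennreal (exp (- (lam * path_exponent c)))"
proof -
  let ?t = "c * r0 powr \<eta>"
  have t: "0 < ?t" using c r0 by simp
  define f where "f p = inf_prod (\<lambda>k. exp (- (?t * attenuation (fst p) (snd p) k)))" for p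
  have f: "f \<in> borel_measurable (seq_borel \<Otimes>\<^sub>M seq_borel)"
  proof -
    note [measurable] = measurable_attenuation[OF measurable_fst measurable_snd]
    show ?thesis unfolding f_def inf_prod_def by measurable
  qed
  have "(\<integral>\<^sup>+w. f (\<lambda>k. X k w, \<lambda>k. h k w) \<partial>M) = (\<integral>\<^sup>+w. \<integral>\<^sup>+w'. f (\<lambda>k. X k w, \<lambda>k. h k w') \<partial>M \<partial>M)"
    by (rule nn_integral_sources[of "{Points}" "range Fading", OF _ measurable_X_source measurable_h_source f]) auto
  also have "\<dots> = (\<integral>\<^sup>+w. inf_prod (\<lambda>k. 1 / (1 + ?t * norm (X k w) powr (- \<eta>))) \<partial>M)"
    unfolding f_def fst_conv snd_conv by (simp only: attenuation_laplace[OF t])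
  also have "\<dots> = ennreal (exp (- (lam * path_exponent c)))"
  proof (rule ppp_pgfl[OF ppp])
    show "(\<integral>\<^sup>+x. ennreal (1 - 1 / (1 + ?t * norm x powr (- \<eta>))) * indicator {x. r0 < norm (x :: real^2)} x \<partial>lborel) = ennreal (path_exponent c)"
      unfolding path_exponent_def by (rule nn_integral_path_loss[OF r0 \<eta> c])
    show "0 \<le> 1 / (1 + ?t * norm x powr (- \<eta>))" "1 / (1 + ?t * norm x powr (- \<eta>)) \<le> 1" for x :: "real^2"
      using t by (auto simp: divide_le_eq_1 add_pos_nonneg)
  qed (use lam path_exponent_bounds(1)[OF c] in auto)
  finally show ?thesis unfolding f_def fst_conv snd_conv .
qed

text \<open>The product in the preceding identity is at most \<open>1\<close> and vanishes where the
  series diverges, so its mean is a lower bound for the probability of convergence. That mean tends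
  to \<open>1\<close> as \<open>c\<close> tends to \<open>0\<close>.\<close>

lemma AE_summable_attenuation: "AE w in M. summable (attenuation (\<lambda>k. X k w) (\<lambda>k. h k w))"
proof -
  let ?a = "\<lambda>w. attenuation (\<lambda>k. X k w) (\<lambda>k. h k w)"
  let ?E = "{w\<in>space M. summable (?a w)}"
  note [measurable] = measurable_attenuation[OF measurable_sequences(1,2)]
  have E: "?E \<in> events"
  proof -
    \<comment> \<open>For nonnegative terms summability is finiteness of the \<open>ennreal\<close>
      series, which makes the event measurable.\<close>
    have "summable (?a w) \<longleftrightarrow> (\<Sum>k. ennreal (?a w k)) \<noteq> top" for w
      by (rule iffI, rule ennreal_suminf_neq_top, assumption, rule attenuation_nonneg, rule summable_suminf_not_top, rule attenuation_nonneg)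
    then have "?E = {w\<in>space M. (\<Sum>k. ennreal (?a w k)) \<noteq> top}" by (simp only:)
    also have "\<dots> \<in> events" by measurable
    finally show ?thesis .
  qed
  have le: "exp (- (lam * path_exponent c)) \<le> prob ?E" if c: "0 < c" for c
  proof -
    have c': "0 < c * r0 powr \<eta>" using c r0 by simp
    have "ennreal (exp (- (lam * path_exponent c))) \<le> (\<integral>\<^sup>+w. indicator ?E w \<partial>M)"
      unfolding interference_laplace_product[OF c, symmetric]
      using inf_prod_exp(2)[OF attenuation_nonneg c'] inf_prod_le_1
      by (intro nn_integral_mono) (auto simp: indicator_def)
    then show ?thesis by (simp only: nn_integral_indicator[OF E] emeasure_eq_measure ennreal_le_iff measure_nonneg)
  qed
  let ?c = "\<lambda>i. inverse (real (Suc i))"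
  have le': "exp (- (lam * path_exponent (?c i))) \<le> prob ?E" for i
    by (rule le) (simp only: inverse_positive_iff_positive of_nat_0_less_iff zero_less_Suc)
  have lim: "(\<lambda>i. exp (- (lam * path_exponent (?c i)))) \<longlonglongrightarrow> 1"
  proof -
    have inv: "(\<lambda>i. ?c i) \<longlonglongrightarrow> 0" by (rule LIMSEQ_inverse_real_of_nat)
    have *: "(\<lambda>i. 2 * pi * r0^2 / (\<eta> - 2) * ?c i) \<longlonglongrightarrow> 2 * pi * r0^2 / (\<eta> - 2) * 0"
      by (rule tendsto_mult[OF tendsto_const inv])
    have "(\<lambda>i. path_exponent (?c i)) \<longlonglongrightarrow> 0"
    proof (rule tendsto_sandwich[OF _ _ tendsto_const, rotated 2])
      have "0 < ?c i" for i by (simp only: inverse_positive_iff_positive of_nat_0_less_iff zero_less_Suc)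
      note bounds = path_exponent_bounds[OF this]
      show "\<forall>\<^sub>F i in sequentially. 0 \<le> path_exponent (?c i)"
        "\<forall>\<^sub>F i in sequentially. path_exponent (?c i) \<le> 2 * pi * r0^2 / (\<eta> - 2) * ?c i"
        by (intro always_eventually allI bounds)+
    next
      show "(\<lambda>i. 2 * pi * r0^2 / (\<eta> - 2) * ?c i) \<longlonglongrightarrow> 0"
        using * by (simp only: mult_zero_right)
    qed
    then have "(\<lambda>i. exp (- (lam * path_exponent (?c i)))) \<longlonglongrightarrow> exp (- (lam * 0))"
      by (rule tendsto_exp[OF tendsto_minus[OF tendsto_mult[OF tendsto_const]]])
    then show ?thesis by simp
  qed
  have "1 \<le> prob ?E" by (rule LIMSEQ_le_const2[OF lim]) (rule exI[of _ 0], rule allI, rule impI, rule le')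
  then have "prob ?E = 1" using prob_le_1[of ?E] by linarith
  then show ?thesis by (rule prob_Collect_eq_1[OF E, THEN iffD1])
qed

lemma gain_laplace:
  assumes c: "0 < c"
  shows "(\<integral>\<^sup>+w. ennreal (exp (- (c * r0 powr \<eta> * gain w))) \<partial>M) = ennreal (exp (- (lam * path_exponent c)))"
proof -
  have c': "0 < c * r0 powr \<eta>" using c r0 by simp
  have "(\<integral>\<^sup>+w. ennreal (exp (- (c * r0 powr \<eta> * gain w))) \<partial>M) =
    (\<integral>\<^sup>+w. inf_prod (\<lambda>k. exp (- (c * r0 powr \<eta> * attenuation (\<lambda>k. X k w) (\<lambda>k. h k w) k))) \<partial>M)"
    by (rule nn_integral_cong_AE, use AE_summable_attenuation in eventually_elim)
       (simp add: inf_prod_exp(1)[OF attenuation_nonneg c'] interference_summable)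
  then show ?thesis using interference_laplace_product[OF c] by simp
qed

text \<open>Positions and fading are frozen, so only noise and symbols are random. The squared
  coefficients are \<open>P\<close> times the attenuations, whose summability is exactly what the
  Gaussian series needs.\<close>

lemma disturbance_law:
  assumes summ: "summable (attenuation x y)"
  shows "distr M borel (\<lambda>w. disturbance x y (\<lambda>k. s k w) (n w)) = cgauss (N0 + P * interference x y)"
proof -
  let ?T = "case_nat n s" and ?v = "case_nat N0 (\<lambda>_. 1)"
  let ?a = "\<lambda>k. complex_of_real (sqrt P) * y k * complex_of_real (norm (x k) powr (- \<eta> / 2))"
  let ?b = "case_nat 1 ?a"
  have a: "(cmod (?a k))^2 = P * attenuation x y k" for k
  proof -
    have "(norm (x k) powr (- \<eta> / 2))^2 = norm (x k) powr (- \<eta>)"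
      by (simp add: power2_eq_square powr_add[symmetric])
    then show ?thesis using P by (simp add: norm_mult power_mult_distrib attenuation_def)
  qed
  have Suc: "(\<lambda>j. (cmod (?b (Suc j)))^2 * ?v (Suc j)) = (\<lambda>j. P * attenuation x y j)" by (simp only: nat.case a mult_1_right)
  have summ_b: "summable (\<lambda>j. (cmod (?b j))^2 * ?v j)"
    using summ by (subst summable_Suc_iff[symmetric], unfold Suc) (rule summable_mult)
  have suminf_b: "(\<Sum>j. (cmod (?b j))^2 * ?v j) = N0 + P * interference x y"
    using suminf_split_head[OF summ_b] summ unfolding Suc by (simp add: suminf_mult interference_summable)
  note series = cgauss_series[OF indep_vars_noise_symbols _ _ _ summ_b]
  have law: "distr M borel (?T j) = cgauss (?v j)" for j by (cases j) (auto simp: n_law s_law)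
  have v: "0 < ?v j" for j using N0 by (cases j) auto
  note [measurable] = indep_vars_noise_symbols[unfolded indep_vars_def2, THEN conjunct1, rule_format, OF UNIV_I]
  have "AE w in M. summable (\<lambda>j. ?b j * ?T j w)" by (rule series(1)) (auto simp: law v)
  then have "AE w in M. disturbance x y (\<lambda>k. s k w) (n w) = (\<Sum>j. ?b j * ?T j w)"
  proof eventually_elim
    case (elim w)
    from suminf_split_head[OF elim] have "(\<Sum>j. ?b j * ?T j w) = n w + (\<Sum>j. ?a j * s j w)" by simp
    then show ?case unfolding disturbance_def by (simp add: mult_ac)
  qed
  then have "distr M borel (\<lambda>w. disturbance x y (\<lambda>k. s k w) (n w)) = distr M borel (\<lambda>w. \<Sum>j. ?b j * ?T j w)"
    by (intro distr_cong_AE refl borel_measurable_suminf borel_measurable_times measurable_disturbance measurable_const_seq) auto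
  also have "\<dots> = cgauss (N0 + P * interference x y)"
    unfolding suminf_b[symmetric] by (rule series(2)) (auto simp: law v)
  finally show ?thesis .
qed

end


section \<open>The detector\<close>

context downlink begin

abbreviation amplitude :: "complex \<Rightarrow> complex" where
  "amplitude \<equiv> useful_gain P r0 \<eta>"

text \<open>The numerator is half the distance between neighbouring received points and
  \<open>N0 + P * v\<close> the variance of the disturbance, so half of this value is the
  probability of crossing one given threshold.\<close>

definition pairwise_erfc :: "complex \<Rightarrow> real \<Rightarrow> real" where
  "pairwise_erfc z v = erfc (qam_scale (m^2) * cmod (amplitude z) / sqrt (N0 + P * v))"

abbreviation link_erfc :: "'w \<Rightarrow> real" where
  "link_erfc w \<equiv> pairwise_erfc (h0 w) (gain w)"

lemma measurable_useful_gain [measurable (raw)]: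
  assumes [measurable]: "f \<in> borel_measurable N"
  shows "(\<lambda>x. amplitude (f x)) \<in> borel_measurable N"
  unfolding useful_gain_def by measurable

lemma measurable_pairwise_erfc [measurable (raw)]:
  assumes [measurable]: "f \<in> borel_measurable N" "g \<in> borel_measurable N"
  shows "(\<lambda>x. pairwise_erfc (f x) (g x)) \<in> borel_measurable N"
  unfolding pairwise_erfc_def by measurable

lemma noise_pos: "0 \<le> v \<Longrightarrow> 0 < N0 + P * v"
  using N0 P by (simp add: add_pos_nonneg)

lemma pairwise_erfc_bounds: "0 \<le> v \<Longrightarrow> 0 \<le> pairwise_erfc z v \<and> pairwise_erfc z v \<le> 1"
  unfolding pairwise_erfc_def using qam_scale_pos[OF m] noise_pos[of v]
  by (auto intro!: erfc_nonneg erfc_le_1)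

lemma link_erfc_bounds: "0 \<le> link_erfc w" "link_erfc w \<le> 1"
  using pairwise_erfc_bounds[OF interference_nonneg] by auto

lemma emeasure_h0_tail: "0 \<le> t \<Longrightarrow> emeasure M {w\<in>space M. t < (cmod (h0 w))^2} = ennreal (exp (- t))"
proof -
  assume t: "0 \<le> t"
  have "emeasure M {w\<in>space M. t < (cmod (h0 w))^2} = emeasure (distr M borel h0) {z. t < (cmod z)^2}"
    by (subst emeasure_distr) (auto intro!: arg_cong[where f="emeasure M"])
  then show ?thesis unfolding h0_law(2) using emeasure_cgauss_tail[of 1 t] t by simp
qed

lemma AE_h0_nonzero: "AE w in M. h0 w \<noteq> 0"
proof -
  have "prob {w\<in>space M. 0 < (cmod (h0 w))^2} = 1"
    using emeasure_h0_tail[of 0] by (simp add: measure_def)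
  then have "AE w in M. 0 < (cmod (h0 w))^2"
    by (subst (asm) prob_Collect_eq_1) auto
  then show ?thesis by eventually_elim auto
qed

lemma prob_s0: "p \<in> {1..m} \<times> {1..m} \<Longrightarrow> prob {w\<in>space M. s0 w = qam_point m p} = 1 / (real m)^2"
  using s0 card_qam[OF m] unfolding uniform_on_def by (auto simp: qam_eq_image)

text \<open>\<open>uniform_on\<close> prescribes only the probabilities of single points; these
  already add up to \<open>1\<close>.\<close>

lemma AE_s0_qam: "AE w in M. s0 w \<in> qam (m^2)"
proof -
  let ?I = "{1..m} \<times> {1..m}"
  have [measurable]: "qam (m^2) \<in> sets borel" using finite_qam by (intro borel_closed finite_imp_closed)
  have "{w\<in>space M. s0 w \<in> qam (m^2)} = (\<Union>p\<in>?I. {w\<in>space M. s0 w = qam_point m p})"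
    unfolding qam_eq_image by auto
  also have "prob \<dots> = (\<Sum>p\<in>?I. prob {w\<in>space M. s0 w = qam_point m p})"
    by (rule finite_measure_finite_Union) (auto simp: disjoint_family_on_def inj_eq[OF inj_qam_point[OF m]])
  also have "\<dots> = (\<Sum>p\<in>?I. 1 / (real m)^2)" by (intro sum.cong refl prob_s0)
  also have "\<dots> = 1" using m by (simp add: power2_eq_square)
  finally show ?thesis by (subst (asm) prob_Collect_eq_1) auto
qed

text \<open>Conditioning in two stages: with positions, fading and the useful symbol frozen, the
  disturbance is Gaussian and \<open>val\<close> applies; then the useful symbol is averaged over
  the \<open>m^2\<close> points. The predicate \<open>Q\<close> is left open because both tie
  conventions are needed.\<close>

lemma nearest_probability:
  assumes Q [measurable]: "Measurable.pred (borel \<Otimes>\<^sub>M borel \<Otimes>\<^sub>M borel) (\<lambda>(g, \<sigma>, V). Q g \<sigma> V)"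
    and val: "\<And>a b g v. a \<in> {1..m} \<Longrightarrow> b \<in> {1..m} \<Longrightarrow> g \<noteq> 0 \<Longrightarrow> 0 < v \<Longrightarrow>
      emeasure (cgauss v) {V. Q g (qam_point m (a, b)) V} =
      ennreal (level_prob m (erfc (qam_scale (m^2) * cmod g / sqrt v)) a * level_prob m (erfc (qam_scale (m^2) * cmod g / sqrt v)) b)"
  shows "(\<integral>\<^sup>+w. indicator {w. Q (amplitude (h0 w)) (s0 w) (disturbance (\<lambda>k. X k w) (\<lambda>k. h k w) (\<lambda>k. s k w) (n w))} w \<partial>M) =
    (\<integral>\<^sup>+w. ennreal ((1 - (real m - 1) / real m * link_erfc w)^2) \<partial>M)"
proof -
  let ?I = "{1..m} \<times> {1..m}"
  let ?seq = "seq_borel :: (nat \<Rightarrow> complex) measure" and ?pts = "seq_borel :: (nat \<Rightarrow> real^2) measure"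
  let ?L = "\<lambda>p e. level_prob m e (fst p) * level_prob m e (snd p)"
  let ?t = "\<lambda>p w. indicator {qam_point m p} (s0 w) * ennreal (?L p (link_erfc w))"
  let ?D = "\<lambda>w w'. disturbance (\<lambda>k. X k w) (\<lambda>k. h k w) (\<lambda>k. s k w') (n w')"
  let ?d = "\<lambda>p. disturbance (fst (fst p)) (fst (snd (fst p))) (fst (snd p)) (snd (snd p))"
  let ?z = "\<lambda>p. amplitude (snd (snd (snd (fst p))))" and ?s = "\<lambda>p. fst (snd (snd (fst p)))"
  have L_nonneg: "0 \<le> ?L p (link_erfc w)" for p w
    using link_erfc_bounds by (intro mult_nonneg_nonneg level_prob_nonneg)
  define A where "A = {Points, Useful_Symbol, Useful_Fading} \<union> range Fading"
  define B where "B = {Noise} \<union> range Symbol"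
  define U where "U w = (\<lambda>k. X k w, \<lambda>k. h k w, s0 w, h0 w)" for w
  define W where "W w = (\<lambda>k. s k w, n w)" for w
  define f where "f = (\<lambda>((x, y, \<sigma>, z), (u, v)). indicator {V. Q (amplitude z) \<sigma> V} (disturbance x y u v) :: ennreal)"
  let ?N1 = "?pts \<Otimes>\<^sub>M ?seq \<Otimes>\<^sub>M borel \<Otimes>\<^sub>M borel" and ?N2 = "?seq \<Otimes>\<^sub>M borel"
  have U: "U \<in> measurable (source_algebra A) ?N1"
    unfolding U_def A_def by (intro measurable_Pair measurable_sources) auto
  have W: "W \<in> measurable (source_algebra B) ?N2"
    unfolding W_def B_def by (intro measurable_Pair measurable_sources) auto
  have f: "f \<in> borel_measurable (?N1 \<Otimes>\<^sub>M ?N2)" (is "_ \<in> borel_measurable ?N")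
  proof -
    have [measurable]: "?d \<in> borel_measurable ?N"
      by (rule measurable_disturbance) measurable
    have "Measurable.pred ?N (\<lambda>p. (\<lambda>(g, \<sigma>, V). Q g \<sigma> V) (?z p, ?s p,
         ?d p))"
      by (rule measurable_compose[OF _ Q]) measurable
    then have [measurable]: "Measurable.pred ?N (\<lambda>p. Q (?z p) (?s p)
         (?d p))" by simp
    have "f = (\<lambda>p. if Q (?z p) (?s p)
         (?d p) then 1 else 0)"
      by (auto simp: f_def fun_eq_iff indicator_def)
    then show ?thesis by simp
  qed
  \<comment> \<open>The conditional value is written as a sum over all points, of which only the
    transmitted one contributes. This separates the dependence on \<open>s0\<close> from that on
    \<open>link_erfc\<close>.\<close>
  have inner: "(\<integral>\<^sup>+w'. f (U w, W w') \<partial>M) = (\<Sum>p\<in>?I. ?t p w)"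
    if summ: "summable (attenuation (\<lambda>k. X k w) (\<lambda>k. h k w))" and h0: "h0 w \<noteq> 0" and s0: "s0 w \<in> qam (m^2)" for w
  proof -
    let ?g = "amplitude (h0 w)" and ?v = "N0 + P * gain w"
    have g: "?g \<noteq> 0" using h0 P r0 by (simp add: useful_gain_def)
    obtain a b where ab: "a \<in> {1..m}" "b \<in> {1..m}" "s0 w = qam_point m (a, b)"
      using s0 unfolding qam_eq_image by auto
    have "Measurable.pred borel (\<lambda>V. (\<lambda>(g, \<sigma>, V). Q g \<sigma> V) (?g, s0 w, V))"
      by (rule measurable_compose[OF _ Q]) measurable
    then have [measurable]: "{V. Q ?g (s0 w) V} \<in> sets borel" by (simp add: pred_def)
    have [measurable]: "(\<lambda>w'. ?D w w') \<in> borel_measurable M"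
      by (intro measurable_disturbance measurable_const_seq) auto
    have "(\<integral>\<^sup>+w'. f (U w, W w') \<partial>M) = (\<integral>\<^sup>+V. indicator {V. Q ?g (s0 w) V} V \<partial>distr M borel (\<lambda>w'. ?D w w'))"
      by (subst nn_integral_distr) (auto simp: f_def U_def W_def)
    also have "\<dots> = emeasure (cgauss ?v) {V. Q ?g (s0 w) V}"
      unfolding disturbance_law[OF summ] by simp
    also have "\<dots> = ennreal (?L (a, b) (link_erfc w))"
      unfolding ab(3) pairwise_erfc_def fst_conv snd_conv by (rule val[OF ab(1,2) g noise_pos[OF interference_nonneg]])
    also have "\<dots> = (\<Sum>p\<in>?I. if p = (a, b) then ennreal (?L p (link_erfc w)) else 0)"
      using ab by (subst sum.delta) auto
    also have "\<dots> = (\<Sum>p\<in>?I. ?t p w)"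
      using injD[OF inj_qam_point[OF m]] by (intro sum.cong) (auto simp: ab(3) indicator_def)
    finally show ?thesis .
  qed
  \<comment> \<open>\<open>link_erfc\<close> is a function of the positions and the fading
    coefficients, hence independent of the useful symbol, which contributes the factor
    \<open>1 / m^2\<close>.\<close>
  have pick: "(\<integral>\<^sup>+w. ?t p w \<partial>M) =
    ennreal (1 / (real m)^2) * (\<integral>\<^sup>+w. ennreal (?L p (link_erfc w)) \<partial>M)" if p: "p \<in> ?I" for p
  proof -
    have e: "link_erfc \<in> borel_measurable (source_algebra ({Points, Useful_Fading} \<union> range Fading))"
      by (intro measurable_pairwise_erfc measurable_interference measurable_sources) auto
    have k: "(\<lambda>q. indicator {qam_point m p} (fst q) * ennreal (?L p (snd q))) \<in> borel_measurable (borel \<Otimes>\<^sub>M borel)"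
      unfolding level_prob_def by measurable
    have "(\<integral>\<^sup>+w. ?t p w \<partial>M) =
      (\<integral>\<^sup>+w. \<integral>\<^sup>+w'. indicator {qam_point m p} (s0 w) * ennreal (?L p (link_erfc w')) \<partial>M \<partial>M)"
      using nn_integral_sources[of "{Useful_Symbol}" "{Points, Useful_Fading} \<union> range Fading", OF _ measurable_s0_source e k] by auto
    also have "\<dots> = (\<integral>\<^sup>+w. indicator {qam_point m p} (s0 w) * (\<integral>\<^sup>+w'. ennreal (?L p (link_erfc w')) \<partial>M) \<partial>M)"
      unfolding level_prob_def by (intro nn_integral_cong nn_integral_cmult) measurable
    also have "\<dots> = (\<integral>\<^sup>+w. indicator {qam_point m p} (s0 w) \<partial>M) * (\<integral>\<^sup>+w'. ennreal (?L p (link_erfc w')) \<partial>M)"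
      by (rule nn_integral_multc) measurable
    also have "(\<integral>\<^sup>+w. indicator {qam_point m p} (s0 w) \<partial>M) = (\<integral>\<^sup>+w. indicator {w\<in>space M. s0 w = qam_point m p} w \<partial>M)"
      by (intro nn_integral_cong) (auto simp: indicator_def)
    also have "\<dots> = ennreal (1 / (real m)^2)"
      using prob_s0[OF p] by (simp add: emeasure_eq_measure)
    finally show ?thesis .
  qed
  have "(\<integral>\<^sup>+w. indicator {w. Q (amplitude (h0 w)) (s0 w) (?D w w)} w \<partial>M)
    = (\<integral>\<^sup>+w. f (U w, W w) \<partial>M)"
    by (intro nn_integral_cong) (simp add: f_def U_def W_def indicator_def)
  also have "\<dots> = (\<integral>\<^sup>+w. \<integral>\<^sup>+w'. f (U w, W w') \<partial>M \<partial>M)"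
    by (rule nn_integral_sources[OF _ U W f]) (auto simp: A_def B_def)
  also have "\<dots> = (\<integral>\<^sup>+w. (\<Sum>p\<in>?I. ?t p w) \<partial>M)"
    by (rule nn_integral_cong_AE, use AE_summable_attenuation AE_h0_nonzero AE_s0_qam in eventually_elim) (rule inner)
  also have "\<dots> = (\<Sum>p\<in>?I. ennreal (1 / (real m)^2) * (\<integral>\<^sup>+w. ennreal (?L p (link_erfc w)) \<partial>M))"
  proof (subst nn_integral_sum)
    show "?t p \<in> borel_measurable M" for p
      unfolding level_prob_def by measurable
  qed (intro sum.cong refl pick)
  also have "\<dots> = (\<integral>\<^sup>+w. ennreal (1 / (real m)^2) * (\<Sum>p\<in>?I. ennreal (?L p (link_erfc w))) \<partial>M)"
    unfolding level_prob_def by (subst nn_integral_cmult, measurable) (subst nn_integral_sum, measurable, simp add: sum_distrib_left)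
  also have "\<dots> = (\<integral>\<^sup>+w. ennreal ((1 - (real m - 1) / real m * link_erfc w)^2) \<partial>M)"
  proof (rule nn_integral_cong)
    fix w
    let ?e = "link_erfc w"
    have "(\<Sum>p\<in>?I. ?L p ?e) = (\<Sum>a=1..m. level_prob m ?e a) * (\<Sum>b=1..m. level_prob m ?e b)"
      by (simp add: sum_product sum.cartesian_product case_prod_unfold)
    also have "(\<Sum>a=1..m. level_prob m ?e a) = real m - (real m - 1) * ?e" by (rule sum_level_prob) (use m in simp)
    also have "(real m - (real m - 1) * ?e) * (real m - (real m - 1) * ?e) = (real m - (real m - 1) * ?e)^2"
      by (simp only: power2_eq_square)
    finally have total: "(\<Sum>p\<in>?I. ?L p ?e) = (real m - (real m - 1) * ?e)^2" .
    have "1 / (real m)^2 * (\<Sum>p\<in>?I. ?L p ?e) = (1 - (real m - 1) / real m * ?e)^2"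
    proof -
      have "1 - (real m - 1) / real m * ?e = (real m - (real m - 1) * ?e) / real m"
        using m by (simp add: field_simps)
      then show ?thesis unfolding total by (simp add: power_divide)
    qed
    moreover have "(\<Sum>p\<in>?I. ennreal (?L p ?e)) = ennreal (\<Sum>p\<in>?I. ?L p ?e)"
      by (intro sum_ennreal L_nonneg)
    ultimately show "ennreal (1 / (real m)^2) * (\<Sum>p\<in>?I. ennreal (?L p ?e)) = ennreal ((1 - (real m - 1) / real m * ?e)^2)"
      by (simp add: ennreal_mult'[symmetric])
  qed
  finally show ?thesis .
qed

text \<open>A strictly nearest transmitted symbol forces a correct decision, and a correct decision
  makes it a weakly nearest one. Both bounds have the same probability, whatever the rule for ties.
  The first implication holds almost surely, since \<open>s0\<close> has to lie in the
  constellation.\<close>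

lemma correct_probability:
  assumes shat [measurable]: "shat \<in> borel_measurable M"
    and ml: "\<And>w. w \<in> space M \<Longrightarrow> ml_detection (qam (m^2)) (amplitude (h0 w))
             (received_signal P r0 \<eta> (s0 w) (h0 w) (n w) (\<lambda>k. X k w) (\<lambda>k. s k w) (\<lambda>k. h k w)) (shat w)"
  shows "emeasure M {w\<in>space M. shat w = s0 w} = (\<integral>\<^sup>+w. ennreal ((1 - (real m - 1) / real m * link_erfc w)^2) \<partial>M)"
proof -
  let ?g = "\<lambda>w. amplitude (h0 w)"
  let ?V = "\<lambda>w. disturbance (\<lambda>k. X k w) (\<lambda>k. h k w) (\<lambda>k. s k w) (n w)"
  let ?R = "(\<integral>\<^sup>+w. ennreal ((1 - (real m - 1) / real m * link_erfc w)^2) \<partial>M)"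
  let ?I = "\<lambda>Q. \<integral>\<^sup>+w. indicator {w. Q m (?g w) (s0 w) (?V w)} w \<partial>M"
  let ?C = "{w\<in>space M. shat w = s0 w}"
  have C: "?C \<in> events" by measurable
  have strict: "?I nearest_strict = ?R"
    by (rule nearest_probability) (auto simp: case_prod_unfold intro: emeasure_nearest m)
  have weak: "?I nearest_weak = ?R"
    by (rule nearest_probability) (auto simp: case_prod_unfold intro: emeasure_nearest m)
  have detect: "shat w \<in> qam (m^2)" "\<And>s. s \<in> qam (m^2) \<Longrightarrow> cmod (?V w + ?g w * s0 w - ?g w * shat w) \<le> cmod (?V w + ?g w * s0 w - ?g w * s)"
    if "w \<in> space M" for w
  proof -
    have y: "received_signal P r0 \<eta> (s0 w) (h0 w) (n w) (\<lambda>k. X k w) (\<lambda>k. s k w) (\<lambda>k. h k w) = ?V w + ?g w * s0 w"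
      by (simp add: received_signal_def disturbance_def)
    show "shat w \<in> qam (m^2)" "\<And>s. s \<in> qam (m^2) \<Longrightarrow> cmod (?V w + ?g w * s0 w - ?g w * shat w) \<le> cmod (?V w + ?g w * s0 w - ?g w * s)"
      using ml[OF that] unfolding ml_detection_def is_arg_min_def y by (auto simp: not_less)
  qed
  have "?I nearest_strict \<le> (\<integral>\<^sup>+w. indicator ?C w \<partial>M)"
  proof (rule nn_integral_mono_AE, use AE_s0_qam AE_space in eventually_elim)
    case (elim w)
    have "shat w = s0 w" if "nearest_strict m (?g w) (s0 w) (?V w)"
    proof (rule ccontr)
      assume "shat w \<noteq> s0 w"
      with that detect(1)[OF elim(2)] have "cmod (?V w) < cmod (?V w + ?g w * s0 w - ?g w * shat w)"
        unfolding nearest_strict_def by blast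
      with detect(2)[OF elim(2) elim(1)] show False by simp
    qed
    then show ?case using elim(2) by (auto simp: indicator_def)
  qed
  moreover have "(\<integral>\<^sup>+w. indicator ?C w \<partial>M) \<le> ?I nearest_weak"
  proof (rule nn_integral_mono)
    fix w assume w: "w \<in> space M"
    have "nearest_weak m (?g w) (s0 w) (?V w)" if "shat w = s0 w"
      unfolding nearest_weak_def using detect(2)[OF w] that by simp
    then show "indicator ?C w \<le> (indicator {w. nearest_weak m (?g w) (s0 w) (?V w)} w :: ennreal)"
      by (auto simp: indicator_def)
  qed
  ultimately show ?thesis unfolding strict weak using C by (simp add: antisym)
qed

end


section \<open>The error probability\<close>

context downlink begin

definition half_dist2 :: real where
  "half_dist2 = (qam_scale (m^2))^2"

text \<open>The affine quantity \<open>A\<close> of the overview: \<open>(cmod (h0 w))^2\<close>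
  divided by it is the square of the argument of \<open>erfc\<close>.\<close>

definition noise_ratio :: "real \<Rightarrow> real" where
  "noise_ratio v = (N0 + P * v) * r0 powr \<eta> / (P * half_dist2)"

lemma half_dist2_pos: "0 < half_dist2"
  using qam_scale_pos[OF m] by (simp add: half_dist2_def)

lemma noise_ratio_pos: "0 \<le> v \<Longrightarrow> 0 < noise_ratio v"
  using noise_pos[of v] P r0 half_dist2_pos by (simp add: noise_ratio_def)

lemma pairwise_erfc_eq:
  assumes v: "0 \<le> v"
  shows "pairwise_erfc z v = erfc (sqrt ((cmod z)^2 / noise_ratio v))"
proof -
  have "(r0 powr (- \<eta> / 2))^2 = 1 / r0 powr \<eta>"
    using r0 by (simp add: power2_eq_square powr_add[symmetric] powr_minus_divide)
  then have "(qam_scale (m^2) * cmod (amplitude z) / sqrt (N0 + P * v))^2 = (cmod z)^2 / noise_ratio v"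
    using P r0 noise_pos[OF v]
    by (simp add: useful_gain_def noise_ratio_def norm_mult power_mult_distrib power_divide half_dist2_def mult_ac)
  then have "sqrt ((cmod z)^2 / noise_ratio v) = qam_scale (m^2) * cmod (amplitude z) / sqrt (N0 + P * v)"
    using qam_scale_pos[OF m] noise_pos[OF v] by (intro real_sqrt_unique) auto
  then show ?thesis by (simp add: pairwise_erfc_def)
qed

lemma outage_probability:
  assumes z: "0 < z"
  shows "emeasure M {w\<in>space M. noise_ratio (gain w) * z < (cmod (h0 w))^2} =
    ennreal (exp (- (z * (N0 * r0 powr \<eta> / (P * half_dist2)))) * exp (- (lam * path_exponent (z / half_dist2))))"
proof -
  let ?\<beta> = half_dist2
  let ?J = "indicator {p. noise_ratio (fst p) * z < (cmod (snd p))^2}"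
  let ?E = "\<lambda>w. ennreal (exp (- (noise_ratio (gain w) * z)))"
  let ?F = "\<lambda>w. ennreal (exp (- (z / ?\<beta> * r0 powr \<eta> * gain w)))" and ?N = "ennreal (exp (- (z * (N0 * r0 powr \<eta> / (P * ?\<beta>)))))"
  have [measurable]: "noise_ratio \<in> borel_measurable borel" unfolding noise_ratio_def by measurable
  have g: "gain \<in> borel_measurable (source_algebra ({Points} \<union> range Fading))"
    by (intro measurable_interference measurable_sources) auto
  have f: "(?J :: _ \<Rightarrow> ennreal) \<in> borel_measurable (borel \<Otimes>\<^sub>M borel)"
    by measurable
  have "emeasure M {w\<in>space M. noise_ratio (gain w) * z < (cmod (h0 w))^2} =
    (\<integral>\<^sup>+w. indicator {w\<in>space M. noise_ratio (gain w) * z < (cmod (h0 w))^2} w \<partial>M)" by simp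
  also have "\<dots> = (\<integral>\<^sup>+w. ?J (gain w, h0 w) \<partial>M)"
    by (intro nn_integral_cong) (simp add: indicator_def)
  also have "\<dots> = (\<integral>\<^sup>+w. \<integral>\<^sup>+w'. ?J (gain w, h0 w') \<partial>M \<partial>M)"
    by (rule nn_integral_sources[OF _ g measurable_h0_source[of "{Useful_Fading}"] f]) auto
  also have "\<dots> = (\<integral>\<^sup>+w. ?E w \<partial>M)"
  proof (rule nn_integral_cong)
    fix w
    have "(\<integral>\<^sup>+w'. ?J (gain w, h0 w') \<partial>M) =
      (\<integral>\<^sup>+w'. indicator {w'\<in>space M. noise_ratio (gain w) * z < (cmod (h0 w'))^2} w' \<partial>M)"
      by (intro nn_integral_cong) (simp add: indicator_def)
    also have "\<dots> = emeasure M {w'\<in>space M. noise_ratio (gain w) * z < (cmod (h0 w'))^2}" by simp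
    also have "\<dots> = ?E w"
      using z noise_ratio_pos[OF interference_nonneg] by (intro emeasure_h0_tail) (simp add: less_imp_le)
    finally show "(\<integral>\<^sup>+w'. ?J (gain w, h0 w') \<partial>M) = ?E w" .
  qed
  also have "\<dots> = (\<integral>\<^sup>+w. ?N * ?F w \<partial>M)"
  proof (rule nn_integral_cong)
    fix w
    \<comment> \<open>The transmit power cancels in the interference part and survives only in the
      noise part.\<close>
    have "noise_ratio (gain w) * z = z * (N0 * r0 powr \<eta> / (P * ?\<beta>)) + z / ?\<beta> * r0 powr \<eta> * gain w"
      using P half_dist2_pos by (simp add: noise_ratio_def field_simps)
    then show "?E w = ?N * ?F w"
      by (simp only: ennreal_mult[symmetric] exp_ge_zero exp_add[symmetric] minus_add_distrib)
  qed
  also have "\<dots> = ?N * (\<integral>\<^sup>+w. ?F w \<partial>M)"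
    by (rule nn_integral_cmult) measurable
  also have "(\<integral>\<^sup>+w. ?F w \<partial>M) = ennreal (exp (- (lam * path_exponent (z / ?\<beta>))))"
    by (rule gain_laplace) (use z half_dist2_pos in simp)
  finally show ?thesis by (simp only: ennreal_mult[symmetric] exp_ge_zero)
qed

definition error_kernel :: "nat \<Rightarrow> real \<Rightarrow> real" where
  "error_kernel c z = erfc_kernel c z * (exp (- (z * (N0 * r0 powr \<eta> / (P * half_dist2)))) * exp (- (lam * path_exponent (z / half_dist2))))"

lemma nn_integral_link_erfc:
  "(\<integral>\<^sup>+w. ennreal (1 - link_erfc w ^ c) \<partial>M) = (\<integral>\<^sup>+z. ennreal (indicator {0<..} z *\<^sub>R error_kernel c z) \<partial>lborel)"
proof -
  interpret pair_sigma_finite M lborel ..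
  have [measurable]: "noise_ratio \<in> borel_measurable borel" unfolding noise_ratio_def by measurable
  define x where "x w = (cmod (h0 w))^2 / noise_ratio (gain w)" for w
  have [measurable]: "x \<in> borel_measurable M" unfolding x_def by measurable
  have x_nonneg: "0 \<le> x w" for w using noise_ratio_pos[OF interference_nonneg] by (simp add: x_def less_imp_le)
  let ?k = "\<lambda>z w. if 0 < z \<and> z < x w then ennreal (erfc_kernel c z) else 0"
  have "(\<integral>\<^sup>+w. ennreal (1 - link_erfc w ^ c) \<partial>M) = (\<integral>\<^sup>+w. \<integral>\<^sup>+z. ennreal (erfc_kernel c z) * indicator {0<..<x w} z \<partial>lborel \<partial>M)"
  proof (rule nn_integral_cong)
    fix w
    have "link_erfc w = erfc (sqrt (x w))" unfolding x_def by (rule pairwise_erfc_eq[OF interference_nonneg])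
    then show "ennreal (1 - link_erfc w ^ c) = (\<integral>\<^sup>+z. ennreal (erfc_kernel c z) * indicator {0<..<x w} z \<partial>lborel)"
      by (simp only: erfc_power_layer_cake[OF x_nonneg])
  qed
  also have "\<dots> = (\<integral>\<^sup>+w. \<integral>\<^sup>+z. ?k z w \<partial>lborel \<partial>M)"
    by (intro nn_integral_cong) (simp add: indicator_def)
  \<comment> \<open>Tonelli, with a nonnegative kernel. Afterwards the inner integral is the kernel
    times the probability that the useful fading exceeds a random level.\<close>
  also have "\<dots> = (\<integral>\<^sup>+z. \<integral>\<^sup>+w. ?k z w \<partial>M \<partial>lborel)"
    by (rule Fubini'[symmetric]) measurable
  also have "\<dots> = (\<integral>\<^sup>+z. ennreal (indicator {0<..} z *\<^sub>R error_kernel c z) \<partial>lborel)"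
  proof (rule nn_integral_cong)
    fix z :: real
    show "(\<integral>\<^sup>+w. ?k z w \<partial>M) = ennreal (indicator {0<..} z *\<^sub>R error_kernel c z)"
    proof (cases "0 < z")
      case True
      have iff: "z < x w \<longleftrightarrow> noise_ratio (gain w) * z < (cmod (h0 w))^2" for w
        using noise_ratio_pos[OF interference_nonneg] by (simp add: x_def less_divide_eq mult.commute)
      have "(\<integral>\<^sup>+w. ?k z w \<partial>M) =
        (\<integral>\<^sup>+w. ennreal (erfc_kernel c z) * indicator {w\<in>space M. noise_ratio (gain w) * z < (cmod (h0 w))^2} w \<partial>M)"
        using True by (intro nn_integral_cong) (simp add: indicator_def iff)
      also have "\<dots> = ennreal (erfc_kernel c z) * emeasure M {w\<in>space M. noise_ratio (gain w) * z < (cmod (h0 w))^2}"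
        by (rule nn_integral_cmult_indicator) measurable
      finally show ?thesis
        using True erfc_kernel_nonneg[of z c] by (simp add: outage_probability error_kernel_def ennreal_mult)
    qed simp
  qed
  finally show ?thesis .
qed

lemma expectation_link_erfc:
  "expectation (\<lambda>w. 1 - link_erfc w ^ c) = (LBINT z:{0<..}. error_kernel c z)"
proof -
  let ?\<beta> = half_dist2
  have "expectation (\<lambda>w. 1 - link_erfc w ^ c) = enn2real (\<integral>\<^sup>+w. ennreal (1 - link_erfc w ^ c) \<partial>M)"
    using link_erfc_bounds by (intro integral_eq_nn_integral) (auto simp: power_le_one)
  also have "\<dots> = (\<integral>z. indicator {0<..} z *\<^sub>R error_kernel c z \<partial>lborel)"
    unfolding nn_integral_link_erfc
  proof (rule integral_eq_nn_integral[symmetric])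
    define G where "G = gain"
    have [measurable]: "G \<in> borel_measurable M" unfolding G_def by measurable
    \<comment> \<open>Measurability of \<open>error_kernel\<close> in \<open>z\<close> is not read
      off from \<open>path_exponent\<close>, which is an integral depending on a parameter. On the
      positive axis its exponential is the Laplace transform \<open>F\<close>, measurable as a
      parametrised expectation.\<close>
    define F where "F z = enn2real (\<integral>\<^sup>+w. ennreal (exp (- (z / ?\<beta> * r0 powr \<eta> * G w))) \<partial>M)" for z
    have [measurable]: "F \<in> borel_measurable borel" unfolding F_def by measurable
    let ?f = "\<lambda>z. indicator {0<..} z *\<^sub>R (erfc_kernel c z * (exp (- (z * (N0 * r0 powr \<eta> / (P * ?\<beta>)))) * F z))" and ?g = "\<lambda>z. indicator {0<..} z *\<^sub>R error_kernel c z"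
    have meas: "?f \<in> borel_measurable borel"
      by measurable
    have "F z = exp (- (lam * path_exponent (z / ?\<beta>)))" if "0 < z" for z
      unfolding F_def G_def using that half_dist2_pos by (subst gain_laplace) auto
    then have eq: "?f = ?g"
      by (auto simp: fun_eq_iff error_kernel_def indicator_def)
    show "?g \<in> borel_measurable lborel"
      using meas unfolding eq by (simp only: measurable_cong_sets[OF sets_lborel refl])
    show "AE z in lborel. 0 \<le> indicator {0<..} z *\<^sub>R error_kernel c z"
      by (intro AE_I2) (auto simp: indicator_def error_kernel_def erfc_kernel_nonneg)
  qed
  finally show ?thesis by (simp add: set_lebesgue_integral_def)
qed

text \<open>Expanding the square gives the error probability as \<open>2 * \<rho>\<close> times the
  mean of \<open>e\<close> minus \<open>\<rho>^2\<close> times the mean of \<open>e^2\<close>, for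
  \<open>e = link_erfc\<close>. Each mean is \<open>1\<close> minus an integral of
  \<open>error_kernel\<close>.\<close>

lemma symbol_error_probability:
  assumes "shat \<in> borel_measurable M"
    and "\<And>w. w \<in> space M \<Longrightarrow> ml_detection (qam (m^2)) (amplitude (h0 w))
             (received_signal P r0 \<eta> (s0 w) (h0 w) (n w) (\<lambda>k. X k w) (\<lambda>k. s k w) (\<lambda>k. h k w)) (shat w)"
  defines "\<rho> \<equiv> (real m - 1) / real m"
  shows "measure M {w\<in>space M. shat w \<noteq> s0 w} =
    2 * \<rho> * (1 - (LBINT z:{0<..}. error_kernel 1 z)) + (- (\<rho>^2)) * (1 - (LBINT z:{0<..}. error_kernel 2 z))"
proof -
  note [measurable] = assms(1)
  have int: "integrable M (\<lambda>w. link_erfc w ^ c)" for c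
    by (rule integrable_const_bound[of _ 1]) (use link_erfc_bounds in \<open>auto simp: power_le_one\<close>)
  have E: "(LBINT z:{0<..}. error_kernel c z) = 1 - expectation (\<lambda>w. link_erfc w ^ c)" for c
    unfolding expectation_link_erfc[symmetric] using int by (simp add: prob_space)
  have "measure M {w\<in>space M. shat w = s0 w} = enn2real (\<integral>\<^sup>+w. ennreal ((1 - \<rho> * link_erfc w)^2) \<partial>M)"
    using correct_probability[OF assms(1,2)] by (simp add: measure_def \<rho>_def)
  also have "\<dots> = expectation (\<lambda>w. (1 - \<rho> * link_erfc w)^2)"
    by (rule integral_eq_nn_integral[symmetric]) auto
  also have "\<dots> = expectation (\<lambda>w. 1 - 2 * \<rho> * link_erfc w ^ 1 + \<rho>^2 * link_erfc w ^ 2)"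
    by (intro Bochner_Integration.integral_cong) (auto simp: power2_eq_square algebra_simps)
  also have "\<dots> = 1 - 2 * \<rho> * expectation (\<lambda>w. link_erfc w ^ 1) + \<rho>^2 * expectation (\<lambda>w. link_erfc w ^ 2)"
    using int[of 1] int[of 2] by (simp add: prob_space)
  finally have "measure M {w\<in>space M. shat w = s0 w} = \<dots>" .
  moreover have "measure M {w\<in>space M. shat w \<noteq> s0 w} = 1 - measure M {w\<in>space M. shat w = s0 w}"
  proof -
    have "{w\<in>space M. shat w \<noteq> s0 w} = space M - {w\<in>space M. shat w = s0 w}" by auto
    then show ?thesis by (simp add: prob_compl)
  qed
  ultimately show ?thesis unfolding E by (simp add: algebra_simps)
qed

text \<open>The indicator inside \<open>erfc\<close> encodes the exponent \<open>c - 1\<close>: for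
  \<open>c = 1\<close> the argument is \<open>0\<close>, and \<open>erfc 0 = 1\<close>.\<close>

lemma integral_error_kernel:
  assumes c: "c \<in> {1, 2}"
    and g: "\<And>z. 0 < z \<Longrightarrow> g z = lam * path_exponent (z / half_dist2)"
  shows "(LBINT z:{0<..}. error_kernel c z) = real c / sqrt pi * (LBINT z:{0<..}. erfc (sqrt z * of_bool (c = 2)) / sqrt z *
     exp (- z * (1 + N0 * r0 powr \<eta> / (P * half_dist2)) - g z))"
proof -
  let ?E = "\<lambda>z. - z * (1 + N0 * r0 powr \<eta> / (P * half_dist2)) - g z"
  let ?f = "\<lambda>z. real c / sqrt pi * (erfc (sqrt z * of_bool (c = 2)) / sqrt z * exp (?E z))"
  have "(LBINT z:{0<..}. error_kernel c z) = (LBINT z:{0<..}. ?f z)"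
  proof (rule set_lebesgue_integral_cong)
    show "\<forall>z. z \<in> {0<..} \<longrightarrow> error_kernel c z = ?f z"
    proof (intro allI impI)
      fix z :: real assume "z \<in> {0<..}"
      then have z: "0 < z" by simp
      have "?E z =
        - z + (- (z * (N0 * r0 powr \<eta> / (P * half_dist2))) + - (lam * path_exponent (z / half_dist2)))"
        unfolding g[OF z] by (simp add: distrib_left)
      then have "exp (?E z) =
        exp (- z) * (exp (- (z * (N0 * r0 powr \<eta> / (P * half_dist2)))) * exp (- (lam * path_exponent (z / half_dist2))))"
        by (simp only: exp_add)
      moreover have "erfc (sqrt z * of_bool (c = 2)) = erfc (sqrt z) ^ (c - 1)" using c by (auto simp: erfc_0)
      ultimately show "error_kernel c z = ?f z"
        unfolding error_kernel_def erfc_kernel_def by (simp only: mult.assoc)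
    qed
  qed simp
  then show ?thesis by (simp only: set_integral_mult_right)
qed

lemma path_exponent_hypergeometric:
  assumes c: "0 < c"
  shows "path_exponent c = 2 * pi * r0^2 * c / (\<eta> - 2) *
    Re (hypergeometric_2F1 1 (complex_of_real (1 - 2 / \<eta>)) (complex_of_real (2 - 2 / \<eta>)) (complex_of_real (- c)))"
proof -
  have b: "0 < 1 - 2 / \<eta>" using \<eta> by simp
  have "complex_of_real (2 - 2 / \<eta>) = complex_of_real (1 - 2 / \<eta>) + 1" by simp
  moreover have "1 / (1 - 2 / \<eta>) = \<eta> / (\<eta> - 2)" using \<eta> by (simp add: field_simps)
  ultimately show ?thesis using Re_hypergeometric[OF b less_imp_le[OF c]] by (simp only: path_exponent_def)
qed

lemma path_exponent_arctan:
  assumes c: "0 < c" and "\<eta> = 4"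
  shows "path_exponent c = pi * r0^2 * sqrt c * arctan (sqrt c)"
proof -
  have "\<eta> / (\<eta> - 2) = 2" "\<eta> - 2 = 2" using assms(2) by simp_all
  then have "path_exponent c = pi * r0^2 * (c / sqrt c) * arctan (sqrt c)"
    unfolding path_exponent_def by (simp add: integral_arctan[OF c])
  then show ?thesis using c by (simp add: real_div_sqrt)
qed

end

theorem theorem3:
  fixes \<Omega> :: "'w measure"
    and M :: nat
    and lam P N0 r0 \<eta> :: real
    and X :: "nat \<Rightarrow> 'w \<Rightarrow> real ^ 2"
    and s0 h0 n shat :: "'w \<Rightarrow> complex"
    and s h :: "nat \<Rightarrow> 'w \<Rightarrow> complex"
    and w \<beta> :: "nat \<Rightarrow> real"
    and sep :: real
  assumes "prob_space \<Omega>"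
    and "M \<ge> 4" and "\<exists>m::nat. M = m ^ 2"
    and "lam > 0" and "P > 0" and "N0 > 0" and "r0 > 0" and "\<eta> > 2"
    and "prob_space.homogeneous_ppp \<Omega> X lam {x. r0 < norm x}"
    and "prob_space.uniform_on \<Omega> s0 (qam M)"
    and "prob_space.circular_gaussian \<Omega> h0 1"
    and "prob_space.circular_gaussian \<Omega> n N0"
    and "\<And>k. prob_space.circular_gaussian \<Omega> (s k) 1"
    and "\<And>k. prob_space.circular_gaussian \<Omega> (h k) 1"
    and "prob_space.mutually_independent \<Omega> X s0 h0 n s h"
    and "shat \<in> borel_measurable \<Omega>"
    and "\<And>\<omega>. \<omega> \<in> space \<Omega> \<Longrightarrow>
           ml_detection (qam M) (useful_gain P r0 \<eta> (h0 \<omega>))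
             (received_signal P r0 \<eta> (s0 \<omega>) (h0 \<omega>) (n \<omega>)
                (\<lambda>k. X k \<omega>) (\<lambda>k. s k \<omega>) (\<lambda>k. h k \<omega>))
             (shat \<omega>)"
    and "sep = measure \<Omega> {\<omega> \<in> space \<Omega>. shat \<omega> \<noteq> s0 \<omega>}"
    and "w 1 = 2 * ((sqrt (real M) - 1) / sqrt (real M))"
    and "w 2 = - (((sqrt (real M) - 1) / sqrt (real M))\<^sup>2)"
    and "\<beta> 1 = 3 / (2 * (real M - 1))" and "\<beta> 2 = 3 / (2 * (real M - 1))"
  shows "sep = (\<Sum>c = 1..2. w c * (1 - real c / sqrt pi *
           (LBINT z:{0<..}. erfc (sqrt z * of_bool (c = 2)) / sqrt z *
              exp (- z * (1 + N0 * r0 powr \<eta> / (P * \<beta> c))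
                   - 2 * pi * lam * z * r0\<^sup>2 / (\<beta> c * (\<eta> - 2)) *
                     Re (hypergeometric_2F1 1 (complex_of_real (1 - 2 / \<eta>))
                           (complex_of_real (2 - 2 / \<eta>)) (complex_of_real (- z / \<beta> c))))))) \<and>
         (\<eta> = 4 \<longrightarrow>
          sep = (\<Sum>c = 1..2. w c * (1 - real c / sqrt pi *
           (LBINT z:{0<..}. erfc (sqrt z * of_bool (c = 2)) / sqrt z *
              exp (- z * (1 + N0 * r0 ^ 4 / (P * \<beta> c))
                   - pi * lam * r0\<^sup>2 * sqrt (z / \<beta> c) * arctan (sqrt (z / \<beta> c)))))))"
proof -
  obtain m where M: "M = m^2" using assms(3) by blast
  have m: "2 \<le> m"
  proof (rule ccontr)
    assume "\<not> 2 \<le> m"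
    then have "m = 0 \<or> m = 1" by auto
    then show False using assms(2) M by auto
  qed
  interpret prob_space \<Omega> by fact
  interpret downlink \<Omega> m lam P N0 r0 \<eta> X s0 h0 n s h
    by unfold_locales (use m assms(4-15) in \<open>auto simp: M\<close>)
  let ?\<beta> = "3 / (2 * (real M - 1))"
  have M1: "1 < real M" using assms(2) by simp
  have \<beta>: "half_dist2 = ?\<beta>"
    using M1 unfolding half_dist2_def qam_scale_def M by simp
  have sqrtM: "sqrt (real M) = real m" unfolding M by simp
  have sep: "sep = (\<Sum>c = 1..2. w c * (1 - (LBINT z:{0<..}. error_kernel c z)))"
  proof -
    have sum12: "(\<Sum>c = 1..2. f c) = f 1 + f 2" for f :: "nat \<Rightarrow> real" by (simp add: numeral_2_eq_2)
    have "w 1 = 2 * ((real m - 1) / real m)" "w 2 = - (((real m - 1) / real m)^2)"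
      using assms(19,20) by (simp_all only: sqrtM)
    moreover have "sep = 2 * ((real m - 1) / real m) * (1 - (LBINT z:{0<..}. error_kernel 1 z)) +
      (- (((real m - 1) / real m)^2)) * (1 - (LBINT z:{0<..}. error_kernel 2 z))"
      unfolding assms(18) by (rule symbol_error_probability[OF assms(16) assms(17)[unfolded M]])
    ultimately show ?thesis unfolding sum12 by (simp only:)
  qed
  \<comment> \<open>The exponent \<open>g\<close> is left open, so that the hypergeometric and the
    arctangent formula are two instances of one identity.\<close>
  have kernel: "sep = (\<Sum>c = 1..2. w c * (1 - real c / sqrt pi *
           (LBINT z:{0<..}. erfc (sqrt z * of_bool (c = 2)) / sqrt z *
              exp (- z * (1 + N0 * r0 powr \<eta> / (P * \<beta> c)) - g c z))))"
    (is "_ = (\<Sum>c = 1..2. w c * (1 - ?r c))")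
    if "\<And>c z. c \<in> {1, 2} \<Longrightarrow> 0 < z \<Longrightarrow> g c z = lam * path_exponent (z / \<beta> c)" for g
    unfolding sep
  proof (intro sum.cong refl)
    fix c :: nat assume "c \<in> {1..2}"
    then have c: "c \<in> {1, 2}" by auto
    then have \<beta>c: "half_dist2 = \<beta> c" using assms(21,22) \<beta> by auto
    show "w c * (1 - (LBINT z:{0<..}. error_kernel c z)) = w c * (1 - ?r c)"
    proof -
      have "(LBINT z:{0<..}. error_kernel c z) = real c / sqrt pi *
           (LBINT z:{0<..}. erfc (sqrt z * of_bool (c = 2)) / sqrt z *
              exp (- z * (1 + N0 * r0 powr \<eta> / (P * half_dist2)) - g c z))"
        by (rule integral_error_kernel[OF c]) (simp only: that[OF c] \<beta>c)
      then show ?thesis unfolding \<beta>c by (simp only:)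
    qed
  qed
  have pos: "0 < z / \<beta> c" if "c \<in> {1, 2}" "0 < z" for c z
    using that assms(21,22) M1 by auto
  show ?thesis
  proof (intro conjI impI, goal_cases)
    case 1
    show ?case by (rule kernel) (simp add: path_exponent_hypergeometric[OF pos])
  next
    case 2
    have "r0 powr \<eta> = r0 ^ 4" using assms(7) by (simp add: 2 powr_numeral)
    moreover have "pi * lam * r0^2 * sqrt (z / \<beta> c) * arctan (sqrt (z / \<beta> c)) = lam * path_exponent (z / \<beta> c)"
      if "c \<in> {1, 2}" "0 < z" for c z
      unfolding path_exponent_arctan[OF pos[OF that] 2] by simp
    ultimately show ?case
      using kernel[of "\<lambda>c z. pi * lam * r0^2 * sqrt (z / \<beta> c) * arctan (sqrt (z / \<beta> c))"] by simp
  qed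
qed

end
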